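(* Let $\mu_i$ ($i\in\mathbb N$) and $\mu$ be finite Borel measures on $S^{n-1}$ which are not concentrated on any closed hemisphere, with $\mu_i\to\mu$ weakly. Let $G\in\mathcal G_I$ be a continuous function such that, for some $q\ge n-1$, $$\inf\Big\{\frac{G(t,u)}{t^q}:\ t\ge 1,\ u\in S^{n-1}\Big\}>0,$$ and let $\varphi\in\mathcal I$. The following statements hold. i) Let $\widetilde M_i\in\widetilde{\mathcal B}$ ($i\in\mathbb N$) and $\widetilde M\in\widetilde{\mathcal B}$ be solutions of the minimization problem $\inf\{\|h_Q\|_{\nu,\varphi}:Q\in\widetilde{\mathcal B}\}$ for $\nu=\mu_i$ and $\nu=\mu$, respectively (i.e. the infimum is attained at them). Then $$\lim_{i\to\infty}\|h_{\widetilde M_i}\|_{\mu_i,\varphi}=\|h_{\widetilde M}\|_{\mu,\varphi}.$$ If, in addition, $\varphi$ is convex on $(0,\infty)$ and $t\mapsto G(t,u)$ is convex on $(0,\infty)$ for each $u\in S^{n-1}$, then $\widetilde M_i\to\widetilde M$ in the Hausdorff metric as $i\to\infty$. ii) Let $\widehat M_i\in\widehat{\mathcal B}$ ($i\in\mathbb N$) and $\widehat M\in\widehat{\mathcal B}$ be solutions of the minimization problem $\inf\{\|h_Q\|_{\nu,\varphi}:Q\in\widehat{\mathcal B}\}$ for $\nu=\mu_i$ and $\nu=\mu$, respectively. Then $$\lim_{i\to\infty}\|h_{\widehat M_i}\|_{\mu_i,\varphi}=\|h_{\widehat M}\|_{\mu,\varphi}.$$ If, in addition, $\varphi$ is convex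 on $(0,\infty)$ and $t\mapsto G(t,u)$ is convex on $(0,\infty)$ for each $u\in S^{n-1}$, then $\widehat M_i\to\widehat M$ in the Hausdorff metric as $i\to\infty$.
   Context: Work in $\mathbb R^n$, $n\ge2$, with inner product $\langle\cdot,\cdot\rangle$, unit ball $B^n$ and unit sphere $S^{n-1}$; $du$ denotes the spherical measure on $S^{n-1}$ (the $(n-1)$-dimensional Hausdorff measure). $\mathcal K_{(o)}^n$ is the set of compact convex subsets of $\mathbb R^n$ with the origin $o$ in their interiors. For $K\in\mathcal K_{(o)}^n$ and $u\in S^{n-1}$: $h_K(u)=\max_{x\in K}\langle x,u\rangle$, $\rho_K(u)=\max\{\lambda\ge0:\lambda u\in K\}$, and $K^\circ=\{x\in\mathbb R^n:\langle x,y\rangle\le1\ \forall y\in K\}$. The Hausdorff metric is $d_H(K,L)=\max_{u\in S^{n-1}}|h_K(u)-h_L(u)|$. $\mathcal I$ is the set of continuous strictly increasing functions $\varphi:(0,\infty)\to(0,\infty)$ with $\lim_{t\to0^+}\varphi(t)=0$, $\varphi(1)=1$, $\lim_{t\to\infty}\varphi(t)=\infty$. For $\varphi\in\mathcal I$, a nonzero finite Borel measure $\mu$ on $S^{n-1}$ and $Q\in\mathcal K_{(o)}^n$, the "Orlicz norm" is $$\|h_Q\|_{\mu,\varphi}=\inf\Big\{\lambda>0:\ \frac1{\mu(S^{n-1})}\int_{S^{n-1}}\varphi\Big(\frac{h_Q(u)}{\lambda}\Big)\,d\mu(u)\le1\Big\}.$$ $\mathcal G_I$ is the set of continuous $G:(0,\infty)\times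 S^{n-1}\to(0,\infty)$ such that for each $u\in S^{n-1}$, $t\mapsto G(t,u)$ is strictly increasing with $\lim_{t\to0^+}G(t,u)=0$ and $\lim_{t\to\infty}G(t,u)=\infty$. The general dual volume is $\widetilde V_G(K)=\int_{S^{n-1}}G(\rho_K(u),u)\,du$ for $K\in\mathcal K_{(o)}^n$. For $G\in\mathcal G_I$ the homogeneous general dual volume is $\widehat V_G(K)=\inf\{\eta>0:\int_{S^{n-1}}G(\rho_K(u)/\eta,u)\,du\le1\}$. Set $$\widetilde{\mathcal B}=\{Q\in\mathcal K_{(o)}^n:\widetilde V_G(Q^\circ)=\widetilde V_G(B^n)\},\qquad \widehat{\mathcal B}=\{Q\in\mathcal K_{(o)}^n:\widehat V_G(Q^\circ)=\widehat V_G(B^n)\}.$$ A finite Borel measure $\mu$ on $S^{n-1}$ is not concentrated on any closed hemisphere if $\mu(\{u\in S^{n-1}:\langle u,v\rangle>0\})>0$ for every $v\in S^{n-1}$. Weak convergence $\mu_i\to\mu$ means $\int f\,d\mu_i\to\int f\,d\mu$ for every continuous $f$ on $S^{n-1}$. *)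

theory Defs
  imports "HOL-Analysis.Analysis"
begin

section \<open>Spherical measure\<close>

text \<open>
  Hausdorff measure of dimension \<open>s > 0\<close>, normalised so that for integer \<open>s\<close> it agrees with
  \<open>s\<close>-dimensional Lebesgue measure. The boundedness guard is needed because \<^const>\<open>diameter\<close> is
  meaningless on unbounded sets, and \<open>s = 0\<close> is excluded because \<open>0 powr 0 = 0\<close>.
\<close>

definition hausdorff_premeasure :: "real \<Rightarrow> real \<Rightarrow> 'a::metric_space set \<Rightarrow> ennreal" where
  "hausdorff_premeasure s \<delta> A =
     (INF E \<in> {E :: nat \<Rightarrow> 'a set. A \<subseteq> (\<Union>i. E i) \<and> (\<forall>i. bounded (E i) \<and> diameter (E i) \<le> \<delta>)}.
        \<Sum>i. ennreal (unit_ball_vol s * (diameter (E i) / 2) powr s))"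

definition hausdorff_outer :: "real \<Rightarrow> 'a::metric_space set \<Rightarrow> ennreal" where
  "hausdorff_outer s A = (SUP \<delta> \<in> {0<..}. hausdorff_premeasure s \<delta> A)"

text \<open>
  \<^const>\<open>hausdorff_outer\<close> is a metric outer measure, hence countably additive on Borel sets by
  Caratheodory's criterion; so \<^const>\<open>measure_of\<close> does not fall back to the zero measure here.
\<close>

definition hausdorff_measure :: "real \<Rightarrow> 'a::metric_space measure" where
  "hausdorff_measure s = measure_of UNIV (sets borel) (hausdorff_outer s)"

definition spherical_measure :: "'a::euclidean_space measure" where
  "spherical_measure = restrict_space (hausdorff_measure (real DIM('a) - 1)) (sphere 0 1)"


section \<open>Convex bodies\<close>

definition convex_bodies_o :: "'a::euclidean_space set set" where
  "convex_bodies_o = {K. compact K \<and> convex K \<and> 0 \<in> interior K}"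

text \<open>For \<open>K\<close> in \<^const>\<open>convex_bodies_o\<close> the suprema in the next two definitions are maxima.\<close>

definition support_fun :: "'a::euclidean_space set \<Rightarrow> 'a \<Rightarrow> real" where
  "support_fun K u = (SUP x\<in>K. x \<bullet> u)"

definition radial_fun :: "'a::euclidean_space set \<Rightarrow> 'a \<Rightarrow> real" where
  "radial_fun K u = Sup {t. 0 \<le> t \<and> t *\<^sub>R u \<in> K}"

definition polar_body :: "'a::euclidean_space set \<Rightarrow> 'a set" where
  "polar_body K = {x. \<forall>y\<in>K. x \<bullet> y \<le> 1}"

definition hausdorff_dist :: "'a::euclidean_space set \<Rightarrow> 'a set \<Rightarrow> real" where
  "hausdorff_dist K L = (SUP u\<in>sphere 0 1. \<bar>support_fun K u - support_fun L u\<bar>)"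


section \<open>Measures on the sphere\<close>

definition finite_borel_on_sphere :: "'a::euclidean_space measure \<Rightarrow> bool" where
  "finite_borel_on_sphere \<mu> \<longleftrightarrow>
     finite_measure \<mu> \<and> sets \<mu> = sets (restrict_space borel (sphere 0 1))"

definition not_concentrated_on_closed_hemisphere :: "'a::euclidean_space measure \<Rightarrow> bool" where
  "not_concentrated_on_closed_hemisphere \<mu> \<longleftrightarrow>
     (\<forall>v\<in>sphere 0 1. measure \<mu> {u \<in> sphere 0 1. u \<bullet> v > 0} > 0)"

definition weakly_converges_on_sphere ::
  "(nat \<Rightarrow> 'a::euclidean_space measure) \<Rightarrow> 'a measure \<Rightarrow> bool" where
  "weakly_converges_on_sphere \<mu>s \<mu> \<longleftrightarrow>
     (\<forall>f :: 'a \<Rightarrow> real. continuous_on (sphere 0 1) f \<longrightarrow>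
        (\<lambda>i. \<integral>u. f u \<partial>\<mu>s i) \<longlonglongrightarrow> (\<integral>u. f u \<partial>\<mu>))"


section \<open>Orlicz norms and dual volumes\<close>

text \<open>
  Functions defined on the open half-line \<open>(0, \<infinity>)\<close> only are rendered as total functions of which
  nothing is assumed or used off \<open>{0<..}\<close>.
\<close>

definition class_I :: "(real \<Rightarrow> real) set" where
  "class_I = {\<phi>. continuous_on {0<..} \<phi> \<and> strict_mono_on {0<..} \<phi> \<and> (\<forall>t>0. \<phi> t > 0) \<and>
     (\<phi> \<longlongrightarrow> 0) (at_right 0) \<and> \<phi> 1 = 1 \<and> filterlim \<phi> at_top at_top}"

definition class_G_I :: "(real \<Rightarrow> 'a::euclidean_space \<Rightarrow> real) set" where
  "class_G_I = {G. continuous_on ({0<..} \<times> sphere 0 1) (\<lambda>(t, u). G t u) \<and>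
     (\<forall>t>0. \<forall>u\<in>sphere 0 1. G t u > 0) \<and>
     (\<forall>u\<in>sphere 0 1. strict_mono_on {0<..} (\<lambda>t. G t u) \<and>
        ((\<lambda>t. G t u) \<longlongrightarrow> 0) (at_right 0) \<and> filterlim (\<lambda>t. G t u) at_top at_top)}"

definition orlicz_norm ::
  "'a::euclidean_space measure \<Rightarrow> (real \<Rightarrow> real) \<Rightarrow> ('a \<Rightarrow> real) \<Rightarrow> real" where
  "orlicz_norm \<mu> \<phi> h =
     Inf {r. r > 0 \<and> (1 / measure \<mu> (sphere 0 1)) * (\<integral>u. \<phi> (h u / r) \<partial>\<mu>) \<le> 1}"

definition dual_volume :: "(real \<Rightarrow> 'a::euclidean_space \<Rightarrow> real) \<Rightarrow> 'a set \<Rightarrow> real" where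
  "dual_volume G K = (\<integral>u. G (radial_fun K u) u \<partial>spherical_measure)"

definition hom_dual_volume :: "(real \<Rightarrow> 'a::euclidean_space \<Rightarrow> real) \<Rightarrow> 'a set \<Rightarrow> real" where
  "hom_dual_volume G K =
     Inf {\<eta>. \<eta> > 0 \<and> (\<integral>u. G (radial_fun K u / \<eta>) u \<partial>spherical_measure) \<le> 1}"

definition B_tilde :: "(real \<Rightarrow> 'a::euclidean_space \<Rightarrow> real) \<Rightarrow> 'a set set" where
  "B_tilde G = {Q \<in> convex_bodies_o. dual_volume G (polar_body Q) = dual_volume G (cball 0 1)}"

definition B_hat :: "(real \<Rightarrow> 'a::euclidean_space \<Rightarrow> real) \<Rightarrow> 'a set set" where
  "B_hat G =
     {Q \<in> convex_bodies_o. hom_dual_volume G (polar_body Q) = hom_dual_volume G (cball 0 1)}"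

definition solves_min_problem ::
  "'a::euclidean_space measure \<Rightarrow> (real \<Rightarrow> real) \<Rightarrow> 'a set set \<Rightarrow> 'a set \<Rightarrow> bool" where
  "solves_min_problem \<nu> \<phi> \<B> M \<longleftrightarrow>
     M \<in> \<B> \<and> orlicz_norm \<nu> \<phi> (support_fun M) = (INF Q\<in>\<B>. orlicz_norm \<nu> \<phi> (support_fun Q))"

end

theory Submission
  imports Defs "HOL-Complex_Analysis.Great_Picard"
begin

text \<open>
  In terms of support functions the constraint reads
  \<open>\<integral> G (1 / h\<^sub>Q) = \<integral> G 1\<close>, and replacing \<open>G (t, u)\<close> by \<open>G (t / \<eta>, u)\<close> turns the homogeneous
  constraint into the non-homogeneous one, so only the latter has to be treated. Comparison with the
  unit ball bounds the norms of the minimizers by 1, which bounds the minimizers uniformly because no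
  \<open>\<mu>\<^sub>i\<close> with large \<open>i\<close> puts almost all its mass close to a closed hemisphere. By Arzela--Ascoli
  their support functions subconverge uniformly; the limit is positive since otherwise the growth of
  \<open>G\<close> would force the dual volumes to infinity, so it is the support function of a body
  satisfying the constraint, and this body is again a minimizer. Under the convexity assumptions the
  support function of a minimizer is unique. The measure theory needed about the spherical measure is that
  it is a finite Borel measure for which caps of radius \<open>r\<close> have mass at least \<open>c * r ^ (n - 1)\<close>.
\<close>

section \<open>Hausdorff measure and the sphere\<close>

text \<open>Weak convergence only tests continuous functions, while the hemisphere condition speaks
  of open half-spheres. It is therefore restated as positivity of the integral of
  \<open>max 0 (u \<bullet> v)\<close>, which is continuous in \<open>u\<close> and
  \<open>v\<close>, so that compactness makes it uniform in \<open>v\<close> and in late indices.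
  The norms are infima without a closed formula. As the integral defining them is continuous and
  strictly decreasing in \<open>r\<close>, each norm is the unique root of an equation, and
  comparing norms becomes comparing integrals. The measures may be discrete, so no strict inequality
  can be drawn from the norm. Uniqueness draws it from the constraint: the spherical measure charges
  every cap, so strictness in a single direction already shows in the integral. The Hausdorff
  measure is given by coverings only. Both facts about it come from comparison with Lebesgue volume:
  a packing of small balls in a thin shell bounds it from above, radially thickened covers of a cap
  bound it from below.\<close>

lemma hausdorff_premeasure_le:
  assumes "A \<subseteq> (\<Union>i. E i)" "\<And>i. bounded (E i)" "\<And>i. diameter (E i) \<le> \<delta>"
  shows "hausdorff_premeasure s \<delta> A \<le> (\<Sum>i. ennreal (unit_ball_vol s * (diameter (E i) / 2) powr s))"
  unfolding hausdorff_premeasure_def using assms by (intro INF_lower) auto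

lemma hausdorff_premeasure_geI:
  assumes "\<And>E. \<lbrakk>A \<subseteq> (\<Union>i. E i); \<And>i. bounded (E i); \<And>i. diameter (E i) \<le> \<delta>\<rbrakk>
             \<Longrightarrow> c \<le> (\<Sum>i. ennreal (unit_ball_vol s * (diameter (E i) / 2) powr s))"
  shows "c \<le> hausdorff_premeasure s \<delta> A"
  unfolding hausdorff_premeasure_def using assms by (intro INF_greatest) auto

lemma hausdorff_premeasure_mono:
  assumes "A \<subseteq> B" "\<delta>' \<le> \<delta>"
  shows "hausdorff_premeasure s \<delta> A \<le> hausdorff_premeasure s \<delta>' B"
  using assms by (intro hausdorff_premeasure_geI hausdorff_premeasure_le) (blast intro: order_trans)+

lemma hausdorff_premeasure_empty:
  assumes "0 \<le> \<delta>"
  shows "hausdorff_premeasure s \<delta> ({} :: 'a::metric_space set) = 0"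
proof -
  have "hausdorff_premeasure s \<delta> ({} :: 'a set)
      \<le> (\<Sum>i::nat. ennreal (unit_ball_vol s * (diameter ({} :: 'a set) / 2) powr s))"
    using assms by (intro hausdorff_premeasure_le) auto
  then show ?thesis by simp
qed

text \<open>Covers that are optimal up to \<open>e / 2 ^ (n + 1)\<close> are merged into one
  sequence through \<open>prod_decode\<close>; the size bound on the members is inherited.\<close>

lemma hausdorff_premeasure_countably_subadditive:
  "hausdorff_premeasure s \<delta> (\<Union>i. A i) \<le> (\<Sum>i. hausdorff_premeasure s \<delta> (A i))"
proof (rule ennreal_le_epsilon)
  let ?c = "\<lambda>E. ennreal (unit_ball_vol s * (diameter E / 2) powr s)"
  let ?O = "hausdorff_premeasure s \<delta>"
  fix e :: real assume e: "0 < e" "(\<Sum>n. ?O (A n)) < top"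
  \<comment> \<open>\<open>ennreal_le_epsilon\<close> allows the right-hand side to be assumed
    finite. So every term is finite and the inequality strict, which is what extracts a cover from
    the infimum.\<close>
  then have *: "\<And>n. ?O (A n) < ?O (A n) + e * (1/2)^Suc n"
    by (auto simp add: less_top dest!: ennreal_suminf_lessD)
  have "\<exists>B. \<forall>n. A n \<subseteq> (\<Union>i::nat. B n i) \<and> (\<forall>i. bounded (B n i) \<and> diameter (B n i) \<le> \<delta>) \<and>
      (\<Sum>i. ?c (B n i)) \<le> ?O (A n) + e * (1/2)^Suc n"
  proof (rule choice, rule allI)
    fix n
    from *[of n] obtain E where "E \<in> {E :: nat \<Rightarrow> 'a set. A n \<subseteq> (\<Union>i. E i) \<and>
        (\<forall>i. bounded (E i) \<and> diameter (E i) \<le> \<delta>)}"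
      and "(\<Sum>i. ?c (E i)) < ?O (A n) + e * (1/2)^Suc n"
      unfolding hausdorff_premeasure_def[of s \<delta> "A n"] INF_less_iff by blast
    then show "\<exists>E. A n \<subseteq> (\<Union>i::nat. E i) \<and> (\<forall>i. bounded (E i) \<and> diameter (E i) \<le> \<delta>) \<and>
        (\<Sum>i. ?c (E i)) \<le> ?O (A n) + e * (1/2)^Suc n"
      by (intro exI[of _ E]) auto
  qed
  then obtain B where B: "\<And>n. A n \<subseteq> (\<Union>i::nat. B n i)" "\<And>n i. bounded (B n i)"
      "\<And>n i. diameter (B n i) \<le> \<delta>"
      and Ble: "\<And>n. (\<Sum>i. ?c (B n i)) \<le> ?O (A n) + e * (1/2)^Suc n"
    by blast
  define C where "C = case_prod B o prod_decode"
  have "?O (\<Union>i. A i) \<le> (\<Sum>i. ?c (C i))"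
  proof (rule hausdorff_premeasure_le)
    show "\<Union> (range A) \<subseteq> (\<Union>i. C i)"
      using B(1) by (auto simp add: C_def subset_eq) (metis prod.case prod_encode_inverse)
  qed (auto simp: C_def B(2,3) split: prod.split)
  also have "\<dots> = (\<Sum>n. \<Sum>i. ?c (B n i))"
    unfolding C_def comp_def
    by (rule suminf_ennreal_2dimen[where f="\<lambda>p. ?c (case p of (x, y) \<Rightarrow> B x y)"]) auto
  also have "\<dots> \<le> (\<Sum>n. ?O (A n) + e * (1/2) ^ Suc n)"
    by (intro suminf_le allI Ble) auto
  also have "... = (\<Sum>n. ?O (A n)) + (\<Sum>n. ennreal e * ennreal ((1/2) ^ Suc n))"
    using \<open>0 < e\<close> by (subst suminf_add[symmetric])
                     (auto simp del: ennreal_suminf_cmult simp add: ennreal_mult[symmetric])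
  also have "\<dots> = (\<Sum>n. ?O (A n)) + e"
    unfolding ennreal_suminf_cmult
    by (subst suminf_ennreal_eq[OF zero_le_power power_half_series]) auto
  finally show "?O (\<Union>i. A i) \<le> (\<Sum>n. ?O (A n)) + e" .
qed

lemma hausdorff_premeasure_le_outer:
  "0 < \<delta> \<Longrightarrow> hausdorff_premeasure s \<delta> A \<le> hausdorff_outer s A"
  unfolding hausdorff_outer_def by (intro SUP_upper) auto

lemma hausdorff_outer_mono: "A \<subseteq> B \<Longrightarrow> hausdorff_outer s A \<le> hausdorff_outer s B"
  unfolding hausdorff_outer_def by (intro SUP_mono) (auto intro: hausdorff_premeasure_mono)

lemma hausdorff_outer_empty: "hausdorff_outer s {} = 0"
  unfolding hausdorff_outer_def
  by (subst SUP_cong[OF refl, of _ _ "\<lambda>_. 0"]) (auto simp: hausdorff_premeasure_empty)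

lemma hausdorff_outer_countably_subadditive:
  "hausdorff_outer s (\<Union>i. A i) \<le> (\<Sum>i. hausdorff_outer s (A i))"
  unfolding hausdorff_outer_def[of s "\<Union>i. A i"]
proof (rule SUP_least)
  fix \<delta> :: real assume "\<delta> \<in> {0<..}"
  then show "hausdorff_premeasure s \<delta> (\<Union>i. A i) \<le> (\<Sum>i. hausdorff_outer s (A i))"
    by (intro order_trans[OF hausdorff_premeasure_countably_subadditive] suminf_le)
       (auto intro: hausdorff_premeasure_le_outer)
qed

lemma outer_measure_space_hausdorff_outer: "outer_measure_space (Pow UNIV) (hausdorff_outer s)"
  unfolding outer_measure_space_def positive_def increasing_def countably_subadditive_def
  by (auto simp: hausdorff_outer_empty intro: hausdorff_outer_mono hausdorff_outer_countably_subadditive)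

lemma hausdorff_outer_Un_le:
  "hausdorff_outer s (A \<union> B) \<le> hausdorff_outer s A + hausdorff_outer s B"
proof -
  interpret sigma_algebra UNIV "Pow UNIV :: 'a set set" by (rule sigma_algebra_Pow)
  have "subadditive (Pow UNIV) (hausdorff_outer s :: 'a set \<Rightarrow> ennreal)"
    using outer_measure_space_hausdorff_outer[where 'a='a, of s]
    by (intro countably_subadditive_subadditive) (auto simp: outer_measure_space_def)
  then have "hausdorff_outer s (A \<union> (B - A)) \<le> hausdorff_outer s A + hausdorff_outer s (B - A)"
    by (intro subadditiveD) auto
  also have "\<dots> \<le> hausdorff_outer s A + hausdorff_outer s B"
    by (intro add_left_mono hausdorff_outer_mono) auto
  finally show ?thesis by simp
qed

text \<open>Once the mesh is below \<open>d\<close>, no member of a cover can meet both sets, so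
  every cover of the union splits into a cover of \<open>A\<close> and one of
  \<open>B\<close>.\<close>

lemma hausdorff_outer_Un_separated:
  assumes "0 < d" and sep: "\<And>x y. x \<in> A \<Longrightarrow> y \<in> B \<Longrightarrow> d \<le> dist x y"
  shows "hausdorff_outer s A + hausdorff_outer s B \<le> hausdorff_outer s (A \<union> B)"
proof -
  let ?c = "\<lambda>E. ennreal (unit_ball_vol s * (diameter E / 2) powr s)"
  have 1: "hausdorff_premeasure s \<delta> A + hausdorff_premeasure s \<delta> B \<le> hausdorff_outer s (A \<union> B)"
    if \<delta>: "0 < \<delta>" "\<delta> < d" for \<delta>
  proof -
    have "hausdorff_premeasure s \<delta> A + hausdorff_premeasure s \<delta> B \<le> hausdorff_premeasure s \<delta> (A \<union> B)"
    proof (rule hausdorff_premeasure_geI)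
      fix E :: "nat \<Rightarrow> 'a set"
      assume E: "A \<union> B \<subseteq> (\<Union>i. E i)" "\<And>i. bounded (E i)" "\<And>i. diameter (E i) \<le> \<delta>"
      have disj: "E i \<inter> A = {} \<or> E i \<inter> B = {}" for i
      proof (rule ccontr)
        assume "\<not> ?thesis"
        then obtain x y where "x \<in> E i" "x \<in> A" "y \<in> E i" "y \<in> B" by auto
        then show False
          using sep[of x y] diameter_bounded_bound[OF E(2), of x i y] E(3)[of i] \<delta> by simp
      qed
      \<comment> \<open>Members that miss the set are replaced by the empty set, which costs 0 since
        \<open>0 powr s = 0\<close>.\<close>
      define EA where "EA i = (if E i \<inter> A = {} then {} else E i)" for i
      define EB where "EB i = (if E i \<inter> B = {} then {} else E i)" for i
      have "hausdorff_premeasure s \<delta> A \<le> (\<Sum>i. ?c (EA i))"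
        using E \<delta> by (intro hausdorff_premeasure_le) (fastforce simp: EA_def)+
      moreover have "hausdorff_premeasure s \<delta> B \<le> (\<Sum>i. ?c (EB i))"
        using E \<delta> by (intro hausdorff_premeasure_le) (fastforce simp: EB_def)+
      ultimately have "hausdorff_premeasure s \<delta> A + hausdorff_premeasure s \<delta> B
          \<le> (\<Sum>i. ?c (EA i)) + (\<Sum>i. ?c (EB i))" by (rule add_mono)
      also have "\<dots> = (\<Sum>i. ?c (EA i) + ?c (EB i))" by (rule suminf_add) auto
      also have "\<dots> \<le> (\<Sum>i. ?c (E i))"
        using disj by (intro suminf_le) (auto simp: EA_def EB_def)
      finally show "hausdorff_premeasure s \<delta> A + hausdorff_premeasure s \<delta> B \<le> (\<Sum>i. ?c (E i))" .
    qed
    also have "\<dots> \<le> hausdorff_outer s (A \<union> B)"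
      using \<delta> by (intro hausdorff_premeasure_le_outer)
    finally show ?thesis .
  qed
  \<comment> \<open>Separate meshes for \<open>A\<close> and \<open>B\<close> let the two suprema be
    taken one after the other.\<close>
  have 2: "hausdorff_premeasure s \<delta>1 A + hausdorff_premeasure s \<delta>2 B \<le> hausdorff_outer s (A \<union> B)"
    if "0 < \<delta>1" "0 < \<delta>2" for \<delta>1 \<delta>2
  proof -
    define \<delta> where "\<delta> = min (min \<delta>1 \<delta>2) (d/2)"
    have "hausdorff_premeasure s \<delta>1 A + hausdorff_premeasure s \<delta>2 B
        \<le> hausdorff_premeasure s \<delta> A + hausdorff_premeasure s \<delta> B"
      by (intro add_mono hausdorff_premeasure_mono) (auto simp: \<delta>_def)
    also have "\<dots> \<le> hausdorff_outer s (A \<union> B)"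
      using that \<open>0 < d\<close> by (intro 1) (auto simp: \<delta>_def)
    finally show ?thesis .
  qed
  have 3: "hausdorff_outer s A + hausdorff_premeasure s \<delta>2 B \<le> hausdorff_outer s (A \<union> B)"
    if "0 < \<delta>2" for \<delta>2
    unfolding hausdorff_outer_def[of s A]
    by (subst ennreal_SUP_add_left[symmetric]) (auto intro!: SUP_least 2 that)
  show ?thesis
    unfolding hausdorff_outer_def[of s B] add.commute[of "hausdorff_outer s A"]
    by (subst ennreal_SUP_add_left[symmetric]) (auto intro!: SUP_least 3 simp: add.commute)
qed

text \<open>Caratheodory's criterion for metric outer measures. Points of \<open>X - C\<close> are
  sorted into layers \<open>D n\<close> by their distance to \<open>C\<close>. Layers of equal
  parity are separated by positive gaps, so their values add up to at most \<open>?H X\<close>;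
  hence the series over all layers converges, and the part of \<open>X - C\<close> very near to
  \<open>C\<close> becomes negligible.\<close>

lemma closed_in_lambda_system_hausdorff:
  fixes C :: "'a::metric_space set"
  assumes "closed C"
  shows "C \<in> lambda_system UNIV (Pow UNIV) (hausdorff_outer s)"
proof -
  let ?H = "hausdorff_outer s :: 'a set \<Rightarrow> ennreal"
  interpret sigma_algebra UNIV "Pow UNIV :: 'a set set" by (rule sigma_algebra_Pow)
  have main: "?H (X \<inter> C) + ?H (X - C) \<le> ?H X" if ne: "C \<noteq> {}" and fin: "?H X < top" for X
  proof -
    define r where "r n = inverse (real (Suc n))" for n
    have r0: "r n > 0" and rSuc: "r (Suc n) < r n" for n by (auto simp: r_def field_simps)
    have rmono: "m \<le> n \<Longrightarrow> r n \<le> r m" for m n by (auto simp: r_def field_simps)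
    define Y where "Y n = {x \<in> X. infdist x C \<ge> r n}" for n
    define D where "D n = {x \<in> X. r (Suc n) \<le> infdist x C \<and> infdist x C < r n}" for n
    have infd: "infdist x C \<le> infdist y C + dist x y" for x y
      by (rule infdist_triangle)
    \<comment> \<open>\<open>j\<close> is the parity offset. The layer skipped between two
      consecutive layers of the same parity provides the gap needed by
      \<open>hausdorff_outer_Un_separated\<close>.\<close>
    have alt: "(\<Sum>k<n. ?H (D (2 * k + j))) \<le> ?H (\<Union>k<n. D (2 * k + j))" for n j
    proof (induction n)
      case (Suc n)
      show ?case
      proof (cases n)
        case (Suc m)
        have "(\<Sum>k<Suc n. ?H (D (2 * k + j))) \<le> ?H (\<Union>k<n. D (2 * k + j)) + ?H (D (2 * n + j))"
          using Suc.IH by (simp add: add_right_mono)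
        also have "\<dots> \<le> ?H ((\<Union>k<n. D (2 * k + j)) \<union> D (2 * n + j))"
        proof (rule hausdorff_outer_Un_separated)
          show "0 < r (2 * m + 1 + j) - r (2 * n + j)" using rSuc[of "2 * m + 1 + j"] Suc by simp
          fix x y assume x: "x \<in> (\<Union>k<n. D (2 * k + j))" and y: "y \<in> D (2 * n + j)"
          then obtain k where k: "k < n" "r (Suc (2 * k + j)) \<le> infdist x C" by (auto simp: D_def)
          have "r (2 * m + 1 + j) \<le> r (Suc (2 * k + j))" using k Suc by (intro rmono) auto
          then show "r (2 * m + 1 + j) - r (2 * n + j) \<le> dist x y"
            using k y infd[of x y] by (auto simp: D_def)
        qed
        also have "(\<Union>k<n. D (2 * k + j)) \<union> D (2 * n + j) = (\<Union>k<Suc n. D (2 * k + j))"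
          by (auto simp: lessThan_Suc)
        finally show ?thesis .
      qed (simp add: lessThan_Suc)
    qed simp
    have split: "(\<Sum>k<2 * n. f k) = (\<Sum>k<n. f (2 * k + 0)) + (\<Sum>k<n. f (2 * k + 1))"
      for n and f :: "nat \<Rightarrow> ennreal"
      by (induction n) (simp_all add: ac_simps)
    have part: "(\<Sum>k<n. ?H (D k)) \<le> ?H X + ?H X" for n
    proof -
      have "(\<Sum>k<n. ?H (D k)) \<le> (\<Sum>k<2 * n. ?H (D k))"
        by (intro sum_mono2) auto
      also have "\<dots> \<le> ?H X + ?H X"
        unfolding split by (intro add_mono order_trans[OF alt] hausdorff_outer_mono) (auto simp: D_def)
      finally show ?thesis .
    qed
    define S where "S = (\<Sum>k. ?H (D k))"
    have "S \<le> ?H X + ?H X"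
      unfolding S_def suminf_eq_SUP by (intro SUP_least part)
    then have Sfin: "S < top" using fin by (simp add: order_le_less_trans)
    have bound: "?H (X \<inter> C) + ?H (X - C) \<le> ?H X + (\<Sum>k. ?H (D (k + n)))" for n
    proof -
      have sub: "X - C \<subseteq> Y n \<union> (\<Union>k. D (k + n))"
      proof
        fix x assume x: "x \<in> X - C"
        have pos: "infdist x C > 0"
          using x in_closed_iff_infdist_zero[OF assms ne, of x] infdist_nonneg[of x C] by auto
        then obtain m0 where "r m0 < infdist x C"
          unfolding r_def using reals_Archimedean by blast
        \<comment> \<open>The least index whose threshold is reached locates \<open>x\<close>: in
          \<open>Y n\<close> if \<open>m \<le> n\<close>, and in the layer \<open>D (m - 1)\<close>
          otherwise.\<close>
        define m where "m = (LEAST m. r m \<le> infdist x C)"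
        have m: "r m \<le> infdist x C"
          unfolding m_def by (rule LeastI[of _ m0]) (use \<open>r m0 < infdist x C\<close> in simp)
        show "x \<in> Y n \<union> (\<Union>k. D (k + n))"
        proof (cases "m \<le> n")
          case True
          then have "r n \<le> infdist x C" using m rmono order_trans by blast
          then show ?thesis using x by (simp add: Y_def)
        next
          case False
          then obtain k where k: "m = Suc (k + n)" using less_imp_Suc_add[of n m] by (auto simp: add.commute)
          have "\<not> r (k + n) \<le> infdist x C"
            using not_less_Least[of "k + n" "\<lambda>m. r m \<le> infdist x C"] k m_def by simp
          then have "x \<in> D (k + n)" using x m k by (simp add: D_def)
          then show ?thesis by blast
        qed
      qed
      have "?H (X - C) \<le> ?H (Y n) + ?H (\<Union>k. D (k + n))"
        using hausdorff_outer_mono[OF sub, of s] hausdorff_outer_Un_le order_trans by blast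
      also have "\<dots> \<le> ?H (Y n) + (\<Sum>k. ?H (D (k + n)))"
        by (intro add_left_mono hausdorff_outer_countably_subadditive)
      finally have "?H (X \<inter> C) + ?H (X - C) \<le> (?H (X \<inter> C) + ?H (Y n)) + (\<Sum>k. ?H (D (k + n)))"
        by (simp add: add.assoc add_left_mono)
      also have "?H (X \<inter> C) + ?H (Y n) \<le> ?H ((X \<inter> C) \<union> Y n)"
      proof (rule hausdorff_outer_Un_separated[OF r0[of n]])
        fix x y assume "x \<in> X \<inter> C" "y \<in> Y n"
        then show "r n \<le> dist x y"
          using infdist_le[of x C y] by (auto simp: Y_def dist_commute)
      qed
      also have "\<dots> \<le> ?H X" by (rule hausdorff_outer_mono) (auto simp: Y_def)
      finally show ?thesis by (simp add: add_right_mono)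
    qed
    show ?thesis
    proof (rule ennreal_le_epsilon)
      fix e :: real assume e: "0 < e"
      have "(\<lambda>n. (\<Sum>k<n. ?H (D k)) + ennreal e) \<longlonglongrightarrow> S + ennreal e"
        unfolding S_def by (intro tendsto_add summable_LIMSEQ tendsto_const) auto
      moreover have "S < S + ennreal e" using Sfin e by simp
      ultimately have "eventually (\<lambda>n. S < (\<Sum>k<n. ?H (D k)) + ennreal e) sequentially"
        by (rule order_tendstoD)
      then obtain n where n: "S < (\<Sum>k<n. ?H (D k)) + ennreal e"
        by (auto simp: eventually_sequentially)
      have "S = (\<Sum>k. ?H (D (k + n))) + (\<Sum>k<n. ?H (D k))"
        unfolding S_def by (rule suminf_offset) auto
      moreover have "(\<Sum>k<n. ?H (D k)) \<noteq> top"
        by (rule less_imp_neq[OF order_le_less_trans[OF part]]) (use fin in simp)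
      ultimately have "(\<Sum>k. ?H (D (k + n))) \<le> ennreal e"
        using n ennreal_add_left_cancel_le[of "\<Sum>k<n. ?H (D k)"] by (auto simp: add.commute)
      then show "?H (X \<inter> C) + ?H (X - C) \<le> ?H X + ennreal e"
        using bound[of n] by (meson add_left_mono order_trans)
    qed
  qed
  have "?H (X \<inter> C) + ?H (X - C) = ?H X" for X
  proof (rule antisym)
    show "?H X \<le> ?H (X \<inter> C) + ?H (X - C)"
      using hausdorff_outer_Un_le[of s "X \<inter> C" "X - C"] by (simp add: Int_Diff_Un)
    \<comment> \<open>For empty \<open>C\<close> the distance \<open>infdist\<close> carries no
      information, and for infinite \<open>?H X\<close> there is nothing to show.\<close>
    show "?H (X \<inter> C) + ?H (X - C) \<le> ?H X"
      using main[of X] by (cases "C = {} \<or> ?H X = top") (auto simp: hausdorff_outer_empty top.not_eq_extremum)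
  qed
  then show ?thesis by (subst lambda_system_eq) auto
qed

lemma measure_space_hausdorff_outer:
  "measure_space (UNIV :: 'a::metric_space set) (sets borel) (hausdorff_outer s)"
proof -
  let ?L = "lambda_system (UNIV :: 'a set) (Pow UNIV) (hausdorff_outer s)"
  interpret P: sigma_algebra UNIV "Pow UNIV :: 'a set set" by (rule sigma_algebra_Pow)
  have ms: "measure_space UNIV ?L (hausdorff_outer s)"
    by (rule P.caratheodory_lemma[OF outer_measure_space_hausdorff_outer])
  then have "sigma_algebra UNIV ?L" by (simp add: measure_space_def)
  then have "sigma_sets UNIV {C :: 'a set. closed C} \<subseteq> ?L"
    by (rule sigma_algebra.sigma_sets_subset) (use closed_in_lambda_system_hausdorff in blast)
  then have "sets (borel :: 'a measure) \<subseteq> ?L" by (simp add: borel_eq_closed)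
  then show ?thesis
    using measure_down[OF ms] sets.sigma_algebra_axioms[of "borel :: 'a measure"] by simp
qed

lemma sets_hausdorff_measure [simp]: "sets (hausdorff_measure s) = sets borel"
  and space_hausdorff_measure [simp]: "space (hausdorff_measure s) = UNIV"
  by (auto simp: hausdorff_measure_def space_measure_of_conv sets_measure_of_conv
        sigma_algebra.sigma_sets_eq[OF sets.sigma_algebra_axioms[of borel, simplified]])

lemma emeasure_hausdorff_measure:
  "A \<in> sets borel \<Longrightarrow> emeasure (hausdorff_measure s) A = hausdorff_outer s A"
  using measure_space_hausdorff_outer[of s] unfolding hausdorff_measure_def measure_space_def
  by (intro emeasure_measure_of_sigma) auto

section \<open>Finiteness of the spherical measure by a packing argument\<close>

text \<open>The first power lies below its chord on \<open>[0, 1]\<close>, the second above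
  Bernoulli's line. This bounds the volume of the shell between the radii \<open>1 - x\<close> and
  \<open>1 + x\<close> linearly in \<open>x\<close>.\<close>

lemma power_one_plus_minus_le:
  fixes x :: real
  assumes "0 \<le> x" "x \<le> 1"
  shows "(1 + x) ^ n \<le> (1 - x) ^ n + (2 ^ n + real n) * x"
proof -
  have "(1 + x) ^ n \<le> 1 + (2 ^ n - 1) * x"
  proof (induction n)
    case (Suc n)
    have "x * ((2 ^ n - 1) * x) \<le> 1 * ((2 ^ n - 1) * x)"
      using assms by (intro mult_right_mono) auto
    moreover have "(1 + x) ^ Suc n \<le> (1 + x) * (1 + (2 ^ n - 1) * x)"
      using Suc assms by (simp add: mult_left_mono)
    ultimately show ?case by (simp add: algebra_simps)
  qed simp
  moreover have "1 + real n * (- x) \<le> (1 + (- x)) ^ n"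
    using assms by (intro Bernoulli_inequality) auto
  ultimately show ?thesis using assms by (simp add: algebra_simps)
qed

text \<open>Volume packing: the balls of radius \<open>\<epsilon> / 2\<close> about \<open>T\<close>
  are disjoint and lie in a shell of thickness \<open>\<epsilon>\<close>, whose volume is of order
  \<open>\<epsilon>\<close>. So \<open>T\<close> has at most of order
  \<open>\<epsilon> powr (1 - real DIM('a))\<close> elements.\<close>

lemma separated_in_sphere_card_le:
  fixes T :: "'a::euclidean_space set"
  assumes T: "finite T" "T \<subseteq> sphere 0 1" and \<epsilon>: "0 < \<epsilon>" "\<epsilon> \<le> 1"
    and sep: "\<And>x y. x \<in> T \<Longrightarrow> y \<in> T \<Longrightarrow> x \<noteq> y \<Longrightarrow> \<epsilon> \<le> dist x y"
  shows "real (card T) * (\<epsilon> / 2) ^ DIM('a) \<le> (2 ^ DIM('a) + real DIM('a)) * (\<epsilon> / 2)"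
proof -
  let ?n = "DIM('a)"
  define x where "x = \<epsilon> / 2"
  have x: "0 < x" "x \<le> 1/2" using \<epsilon> by (auto simp: x_def)
  define w where "w = unit_ball_vol (real ?n)"
  have w: "w > 0" by (simp add: w_def)
  have disj: "disjoint_family_on (\<lambda>p. ball p x) T"
    unfolding disjoint_family_on_def
  proof (intro ballI impI)
    fix p q assume "p \<in> T" "q \<in> T" "p \<noteq> q"
    then show "ball p x \<inter> ball q x = {}"
      using sep[of p q] by (intro disjoint_ballI) (auto simp: x_def)
  qed
  \<comment> \<open>Keeping the inner ball as a further disjoint piece avoids subtracting
    volumes.\<close>
  have disj2: "(\<Union>p\<in>T. ball p x) \<inter> ball 0 (1 - x) = {}"
  proof (rule ccontr)
    assume "\<not> ?thesis"
    then obtain p y where *: "p \<in> T" "dist p y < x" "norm y < 1 - x" by auto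
    then have "norm p = 1" using T by auto
    then show False using * norm_triangle_ineq2[of p y] by (simp add: dist_norm)
  qed
  have "(\<Sum>p\<in>T. emeasure lborel (ball p x)) + emeasure lborel (ball (0::'a) (1 - x))
      = emeasure lborel (\<Union>p\<in>T. ball p x) + emeasure lborel (ball (0::'a) (1 - x))"
    using T disj by (subst sum_emeasure) auto
  also have "\<dots> = emeasure lborel ((\<Union>p\<in>T. ball p x) \<union> ball 0 (1 - x))"
    using disj2 T by (intro plus_emeasure) (auto intro!: borel_open)
  also have "\<dots> \<le> emeasure lborel (cball (0::'a) (1 + x))"
  proof (rule emeasure_mono)
    have "ball p x \<subseteq> cball 0 (1 + x)" if "p \<in> T" for p
    proof
      fix y assume "y \<in> ball p x"
      then show "y \<in> cball 0 (1 + x)"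
        using T that norm_triangle_ineq2[of y p] by (auto simp: dist_norm norm_minus_commute)
    qed
    then show "(\<Union>p\<in>T. ball p x) \<union> ball 0 (1 - x) \<subseteq> cball 0 (1 + x)"
      using x by auto
  qed auto
  finally have "ennreal (real (card T) * (w * x ^ ?n) + w * (1 - x) ^ ?n) \<le> ennreal (w * (1 + x) ^ ?n)"
    using x w by (simp add: emeasure_ball emeasure_cball w_def[symmetric] ennreal_plus
        ennreal_mult' ennreal_of_nat_eq_real_of_nat del: ennreal_plus[symmetric])
  then have "real (card T) * (w * x ^ ?n) + w * (1 - x) ^ ?n \<le> w * (1 + x) ^ ?n"
    using x w by (subst (asm) ennreal_le_iff) auto
  also have "\<dots> \<le> w * ((1 - x) ^ ?n + (2 ^ ?n + real ?n) * x)"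
    using x w power_one_plus_minus_le[of x ?n] by (intro mult_left_mono) auto
  finally have "w * (real (card T) * x ^ ?n) \<le> w * ((2 ^ ?n + real ?n) * x)"
    by (simp add: algebra_simps)
  then show ?thesis using w by (simp add: x_def)
qed

text \<open>A separated set of maximal cardinality is also a net, so the closed balls of radius
  \<open>\<epsilon>\<close> about it cover the sphere; by the packing bound their total cost stays
  bounded as the mesh shrinks.\<close>

lemma hausdorff_outer_sphere_finite:
  "hausdorff_outer (real DIM('a) - 1) (sphere (0::'a::euclidean_space) 1) < top"
proof -
  let ?n = "DIM('a)" and ?S = "sphere (0::'a) 1"
  let ?s = "real ?n - 1"
  \<comment> \<open>Read off from the packing bound after clearing the powers of
    \<open>\<epsilon> / 2\<close>.\<close>
  define K where "K = (2 ^ ?n + real ?n) * 2 ^ ?n / 2"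
  have small: "hausdorff_premeasure ?s \<delta> ?S \<le> ennreal (unit_ball_vol ?s * K)"
    if \<delta>: "0 < \<delta>" "\<delta> \<le> 1" for \<delta>
  proof -
    \<comment> \<open>Half the mesh, so that the covering balls have diameter exactly
      \<open>\<delta>\<close>.\<close>
    define \<epsilon> where "\<epsilon> = \<delta> / 2"
    have \<epsilon>: "0 < \<epsilon>" "\<epsilon> \<le> 1" using \<delta> by (auto simp: \<epsilon>_def)
    define P where "P T \<longleftrightarrow> finite T \<and> T \<subseteq> ?S \<and>
        (\<forall>x\<in>T. \<forall>y\<in>T. x \<noteq> y \<longrightarrow> \<epsilon> \<le> dist x y)" for T
    have card_bd: "real (card T) * \<epsilon> ^ ?n \<le> K * \<epsilon>" if "P T" for T
    proof -
      have "real (card T) * (\<epsilon> / 2) ^ ?n \<le> (2 ^ ?n + real ?n) * (\<epsilon> / 2)"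
        using that \<epsilon> by (intro separated_in_sphere_card_le) (auto simp: P_def)
      then show ?thesis by (simp add: K_def field_simps)
    qed
    have "\<exists>N. \<forall>T. P T \<longrightarrow> card T \<le> N"
    proof (intro exI allI impI)
      fix T assume "P T"
      then have "real (card T) \<le> K * \<epsilon> / \<epsilon> ^ ?n"
        using card_bd \<epsilon> by (simp add: field_simps)
      then show "card T \<le> nat \<lceil>K * \<epsilon> / \<epsilon> ^ ?n\<rceil>" by linarith
    qed
    then obtain N where "\<forall>T. P T \<longrightarrow> card T \<le> N" by blast
    moreover have "P {}" by (simp add: P_def)
    ultimately have "\<exists>T. P T \<and> (\<forall>T'. P T' \<longrightarrow> card T' \<le> card T)"
      by (intro ex_has_greatest_nat[of P "{}" card "Suc N"]) (simp_all add: less_Suc_eq_le)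
    then obtain T where T: "P T" and max: "\<And>T'. P T' \<Longrightarrow> card T' \<le> card T"
      by blast
    have cover: "\<exists>p\<in>T. x \<in> cball p \<epsilon>" if x: "x \<in> ?S" for x
    proof (rule ccontr)
      assume neg: "\<not> ?thesis"
      then have "x \<notin> T" using \<epsilon> by force
      have "P (insert x T)"
        using T x neg by (auto simp: P_def dist_commute not_le intro: less_imp_le)
      then show False using max[of "insert x T"] \<open>x \<notin> T\<close> T by (simp add: P_def)
    qed
    have "finite T" using T by (simp add: P_def)
    then obtain xs where xs: "set xs = T" "distinct xs"
      using finite_distinct_list[of T] by blast
    define E where "E i = (if i < length xs then cball (xs ! i) \<epsilon> else {})" for i
    have "hausdorff_premeasure ?s \<delta> ?S
        \<le> (\<Sum>i. ennreal (unit_ball_vol ?s * (diameter (E i) / 2) powr ?s))"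
    proof (rule hausdorff_premeasure_le)
      show "?S \<subseteq> (\<Union>i. E i)"
      proof
        fix x assume "x \<in> ?S"
        then obtain i where "i < length xs" "x \<in> cball (xs ! i) \<epsilon>"
          using cover xs by (metis in_set_conv_nth)
        then show "x \<in> (\<Union>i. E i)" by (auto simp: E_def)
      qed
    qed (use \<epsilon> in \<open>auto simp: E_def \<epsilon>_def diameter_cball\<close>)
    also have "\<dots> = (\<Sum>i<length xs. ennreal (unit_ball_vol ?s * (diameter (E i) / 2) powr ?s))"
      by (rule suminf_finite) (auto simp: E_def)
    also have "\<dots> = (\<Sum>i<length xs. ennreal (unit_ball_vol ?s * \<epsilon> powr ?s))"
      using \<epsilon> by (intro sum.cong) (auto simp: E_def diameter_cball)
    also have "\<dots> = ennreal (unit_ball_vol ?s * (real (card T) * \<epsilon> powr ?s))"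
    proof -
      have "length xs = card T" using xs distinct_card by fastforce
      then have "(\<Sum>i<length xs. ennreal (unit_ball_vol ?s * \<epsilon> powr ?s))
          = ennreal (real (card T)) * ennreal (unit_ball_vol ?s * \<epsilon> powr ?s)"
        by (simp only: sum_constant card_lessThan ennreal_of_nat_eq_real_of_nat)
      also have "\<dots> = ennreal (real (card T) * (unit_ball_vol ?s * \<epsilon> powr ?s))"
        by (rule ennreal_mult'[symmetric]) simp
      finally show ?thesis by (simp only: mult.left_commute)
    qed
    also have "\<dots> \<le> ennreal (unit_ball_vol ?s * K)"
    proof (intro ennreal_leI mult_left_mono)
      have "(real (card T) * \<epsilon> powr ?s) * \<epsilon> \<le> K * \<epsilon>"
        using card_bd[OF T] \<epsilon> by (simp add: powr_diff powr_realpow)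
      then show "real (card T) * \<epsilon> powr ?s \<le> K"
        by (rule mult_right_le_imp_le) (use \<epsilon> in simp)
    qed (simp add: Suc_leI)
    finally show ?thesis .
  qed
  have "hausdorff_outer ?s ?S \<le> ennreal (unit_ball_vol ?s * K)"
    unfolding hausdorff_outer_def
  proof (rule SUP_least)
    fix \<delta> :: real assume "\<delta> \<in> {0<..}"
    then have "hausdorff_premeasure ?s \<delta> ?S \<le> hausdorff_premeasure ?s (min \<delta> 1) ?S"
      by (intro hausdorff_premeasure_mono) auto
    also have "\<dots> \<le> ennreal (unit_ball_vol ?s * K)"
      using \<open>\<delta> \<in> {0<..}\<close> by (intro small) auto
    finally show "hausdorff_premeasure ?s \<delta> ?S \<le> ennreal (unit_ball_vol ?s * K)" .
  qed
  then show ?thesis by (simp add: order_le_less_trans)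
qed

section \<open>Lower bound for the spherical measure of caps\<close>

text \<open>The radial interval, of length \<open>r / 2\<close>, is cut into steps of length
  \<open>d\<close>; at most \<open>2 * r / d\<close> balls of radius \<open>3 * d\<close> centred on
  one ray cover the piece of the cone. The remaining exponent \<open>DIM('a) - 1\<close> of
  \<open>d\<close> is the one in the Hausdorff cost.\<close>

lemma emeasure_cone_shell_le:
  fixes E :: "'a::euclidean_space set"
  assumes E: "E \<subseteq> sphere 0 1" and d: "0 < d" "d \<le> r" "r \<le> 1" and diam: "diameter E \<le> d"
  shows "emeasure lborel ((\<lambda>(t, u). t *\<^sub>R u) ` ({1 - r/4..1 + r/4} \<times> E))
    \<le> ennreal (2 * unit_ball_vol (real DIM('a)) * 3 ^ DIM('a) * r * d ^ (DIM('a) - 1))"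
proof (cases "E = {}")
  case False
  then obtain p where p: "p \<in> E" by blast
  let ?n = "DIM('a)"
  define N where "N = nat \<lfloor>r / (2 * d)\<rfloor>"
  define \<tau> where "\<tau> j = 1 - r/4 + real j * d" for j
  have bdd: "bounded E" using E bounded_subset[OF bounded_sphere] by blast
  have "(\<lambda>(t, u). t *\<^sub>R u) ` ({1 - r/4..1 + r/4} \<times> E) \<subseteq> (\<Union>j\<in>{..N}. cball (\<tau> j *\<^sub>R p) (3 * d))"
  proof safe
    fix t u assume t: "t \<in> {1 - r/4..1 + r/4}" and u: "u \<in> E"
    define j where "j = nat \<lfloor>(t - (1 - r/4)) / d\<rfloor>"
    have "(t - (1 - r/4)) / d \<le> r / (2 * d)"
      using t d by (simp add: divide_simps)
    then have jN: "j \<le> N" unfolding j_def N_def by (intro nat_mono floor_mono)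
    have "0 \<le> (t - (1 - r/4)) / d" using t d by simp
    then have "real j \<le> (t - (1 - r/4)) / d" "(t - (1 - r/4)) / d \<le> real j + 1"
      unfolding j_def by linarith+
    then have j: "\<tau> j \<le> t" "t \<le> \<tau> j + d"
      using d unfolding \<tau>_def by (simp_all add: field_simps)
    have "0 \<le> real j * d" using d by simp
    then have \<tau>0: "0 \<le> \<tau> j" using d unfolding \<tau>_def by linarith
    have "\<tau> j \<le> 2" using j t d by simp
    have "norm u = 1" using u E by auto
    \<comment> \<open>Origin of the radius \<open>3 * d\<close>: the angular error is at most
      \<open>2 * d\<close>, since \<open>\<tau> j \<le> 2\<close>, and the radial rounding error at
      most \<open>d\<close>.\<close>
    have "dist (\<tau> j *\<^sub>R p) (t *\<^sub>R u) = norm (\<tau> j *\<^sub>R (p - u) + (\<tau> j - t) *\<^sub>R u)"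
      by (simp add: dist_norm algebra_simps)
    also have "\<dots> \<le> \<tau> j * norm (p - u) + \<bar>\<tau> j - t\<bar> * norm u"
      using norm_triangle_ineq[of "\<tau> j *\<^sub>R (p - u)" "(\<tau> j - t) *\<^sub>R u"] \<tau>0 by simp
    also have "\<dots> \<le> 2 * d + d * 1"
    proof (intro add_mono mult_mono)
      show "norm (p - u) \<le> d"
        using diameter_bounded_bound[OF bdd p u] diam by (simp add: dist_norm)
    qed (use j \<open>\<tau> j \<le> 2\<close> \<open>norm u = 1\<close> d in auto)
    finally show "t *\<^sub>R u \<in> (\<Union>j\<in>{..N}. cball (\<tau> j *\<^sub>R p) (3 * d))"
      using jN by auto
  qed
  then have "emeasure lborel ((\<lambda>(t, u). t *\<^sub>R u) ` ({1 - r/4..1 + r/4} \<times> E))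
      \<le> emeasure lborel (\<Union>j\<in>{..N}. cball (\<tau> j *\<^sub>R p) (3 * d))"
    by (rule emeasure_mono) auto
  also have "\<dots> \<le> (\<Sum>j\<in>{..N}. emeasure lborel (cball (\<tau> j *\<^sub>R p) (3 * d)))"
    by (rule emeasure_subadditive_finite) auto
  also have "\<dots> = ennreal (real (Suc N) * (unit_ball_vol ?n * (3 * d) ^ ?n))"
  proof -
    have "emeasure lborel (cball (\<tau> j *\<^sub>R p) (3 * d)) = ennreal (unit_ball_vol ?n * (3 * d) ^ ?n)" for j
      using d by (intro emeasure_cball) simp
    then show ?thesis
      by (simp only: sum_constant card_atMost ennreal_of_nat_eq_real_of_nat)
         (rule ennreal_mult'[symmetric], simp)
  qed
  also have "\<dots> \<le> ennreal ((2 * r / d) * (unit_ball_vol ?n * (3 * d) ^ ?n))"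
  proof (intro ennreal_leI mult_right_mono)
    have "real N \<le> r / (2 * d)" unfolding N_def using d by simp
    moreover have "1 \<le> r / d" using d by simp
    ultimately show "real (Suc N) \<le> 2 * r / d" by (simp add: field_simps)
  qed (use d in auto)
  also have "(2 * r / d) * (unit_ball_vol ?n * (3 * d) ^ ?n)
      = 2 * unit_ball_vol ?n * 3 ^ ?n * r * d ^ (?n - 1)"
    using d power_Suc[of d "?n - 1"] by (simp add: power_mult_distrib field_simps)
  finally show ?thesis .
qed simp


text \<open>Any cover of the cap, thickened radially, covers the Lebesgue ball
  \<open>ball w (r/4)\<close>. The volume of a thickened member is at most its Hausdorff cost times
  a factor proportional to \<open>r\<close>, so comparison with a volume of order
  \<open>r ^ DIM('a)\<close> leaves \<open>r ^ (DIM('a) - 1)\<close>.\<close>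

lemma hausdorff_outer_cap_ge:
  assumes n2: "DIM('a::euclidean_space) \<ge> 2"
  obtains c where "c > 0"
    and "\<And>(w::'a) r. \<lbrakk>norm w = 1; 0 < r; r \<le> 1\<rbrakk> \<Longrightarrow>
      ennreal (c * r ^ (DIM('a) - 1)) \<le> hausdorff_outer (real DIM('a) - 1) (sphere 0 1 \<inter> ball w r)"
proof -
  let ?n = "DIM('a)"
  let ?s = "real ?n - 1"
  define \<omega> where "\<omega> = unit_ball_vol (real ?n)"
  define \<omega>' where "\<omega>' = unit_ball_vol ?s"
  have pos: "\<omega> > 0" "\<omega>' > 0" using n2 by (auto simp: \<omega>_def \<omega>'_def)
  \<comment> \<open>Chosen so that the volume of \<open>ball w (r/4)\<close> divided by
    \<open>\<kappa>\<close> is exactly \<open>c * r ^ (DIM('a) - 1)\<close>.\<close>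
  define c where "c = \<omega>' / (2 * 3 ^ ?n * 2 ^ (?n - 1) * 4 ^ ?n)"
  show ?thesis
  proof (rule that[of c])
    show "c > 0" using pos by (simp add: c_def)
    fix w :: 'a and r :: real
    assume w: "norm w = 1" and r: "0 < r" "r \<le> 1"
    let ?A = "sphere 0 1 \<inter> ball w r"
    \<comment> \<open>Ratio between the volume bound for a thickened member and its Hausdorff
      cost.\<close>
    define \<kappa> where "\<kappa> = 2 * \<omega> * 3 ^ ?n * r * 2 ^ (?n - 1) / \<omega>'"
    have \<kappa>: "\<kappa> > 0" using pos r by (simp add: \<kappa>_def)
    \<comment> \<open>The single mesh \<open>r\<close> suffices, since the outer measure is a
      supremum over meshes; it guarantees \<open>d \<le> r\<close> in
      \<open>emeasure_cone_shell_le\<close>.\<close>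
    have "ennreal (c * r ^ (?n - 1)) \<le> hausdorff_premeasure ?s r ?A"
    proof (rule hausdorff_premeasure_geI)
      fix E :: "nat \<Rightarrow> 'a set"
      assume E: "?A \<subseteq> (\<Union>i. E i)" "\<And>i. bounded (E i)" "\<And>i. diameter (E i) \<le> r"
      \<comment> \<open>Passing to the closure makes the thickening compact, hence measurable, and
        does not enlarge the diameter.\<close>
      define F where "F i = closure (E i) \<inter> sphere 0 1" for i
      define C where "C i = (\<lambda>(t, u). t *\<^sub>R u) ` ({1 - r/4..1 + r/4} \<times> F i)" for i
      have "compact (F i)" for i
        unfolding F_def using E(2) by (intro closed_Int_compact) auto
      then have "compact (C i)" for i
        unfolding C_def
        by (intro compact_continuous_image compact_Times) (auto intro!: continuous_intros simp: case_prod_unfold)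
      then have Cb: "C i \<in> sets lborel" for i by (simp add: borel_compact)
      have diamF: "diameter (F i) \<le> diameter (E i)" for i
        using diameter_subset[of "F i" "closure (E i)"] E(2)[of i] diameter_closure[OF E(2)[of i]]
        by (auto simp: F_def)
      have Cle: "emeasure lborel (C i) \<le> ennreal (2 * \<omega> * 3 ^ ?n * r * diameter (E i) ^ (?n - 1))" for i
      proof (cases "diameter (E i) = 0")
        case False
        then have "diameter (E i) > 0" using diameter_ge_0[OF E(2)[of i]] by simp
        then show ?thesis
          unfolding C_def \<omega>_def using E(3) r diamF
          by (intro emeasure_cone_shell_le) (auto simp: F_def)
      next
        \<comment> \<open>The volume estimate requires a positive \<open>d\<close>. Members of
          diameter 0 are treated by letting \<open>d\<close> tend to 0, where
          \<open>DIM('a) \<ge> 2\<close> makes the power vanish.\<close>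
        case True
        have "emeasure lborel (C i) \<le> ennreal e" if "0 < e" for e
        proof -
          have "((\<lambda>d. 2 * \<omega> * 3 ^ ?n * r * d ^ (?n - 1)) \<longlongrightarrow> 2 * \<omega> * 3 ^ ?n * r * 0 ^ (?n - 1)) (at_right 0)"
            by (intro tendsto_intros)
          moreover have "2 * \<omega> * 3 ^ ?n * r * 0 ^ (?n - 1) < e"
            using n2 that by (simp add: zero_power)
          ultimately have "eventually (\<lambda>d. 2 * \<omega> * 3 ^ ?n * r * d ^ (?n - 1) < e) (at_right 0)"
            by (rule order_tendstoD)
          then obtain b where b: "b > 0" "\<And>d. 0 < d \<Longrightarrow> d < b \<Longrightarrow> 2 * \<omega> * 3 ^ ?n * r * d ^ (?n - 1) < e"
            by (auto simp: eventually_at_right_field)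
          define d where "d = min (b / 2) r"
          have d: "0 < d" "d < b" "d \<le> r" using b r by (auto simp: d_def)
          have "emeasure lborel (C i) \<le> ennreal (2 * \<omega> * 3 ^ ?n * r * d ^ (?n - 1))"
            unfolding C_def \<omega>_def using d r diamF[of i] True
            by (intro emeasure_cone_shell_le) (auto simp: F_def)
          also have "\<dots> \<le> ennreal e" using b(2)[of d] d by (intro ennreal_leI) simp
          finally show ?thesis .
        qed
        then have "emeasure lborel (C i) \<le> 0"
          by (metis add_0 ennreal_le_epsilon)
        then show ?thesis by simp
      qed
      have sub: "ball w (r/4) \<subseteq> (\<Union>i. C i)"
      proof
        fix x assume x: "x \<in> ball w (r/4)"
        have nx: "\<bar>norm x - 1\<bar> < r/4"
          using x w norm_triangle_ineq3[of x w] by (simp add: dist_norm norm_minus_commute)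
        then have "norm x > 0" using r by linarith
        \<comment> \<open>The radial projection moves \<open>x\<close> by less than
          \<open>r / 4\<close>, so its image stays inside the cap.\<close>
        define u where "u = x /\<^sub>R norm x"
        have u: "norm u = 1" "x = norm x *\<^sub>R u" using \<open>norm x > 0\<close> by (auto simp: u_def)
        have "u - x = (1 - norm x) *\<^sub>R u" using u(2) by (simp add: scaleR_diff_left)
        then have "norm (u - x) = \<bar>1 - norm x\<bar>" using u by simp
        then have "norm (w - u) < r"
          using x nx r norm_triangle_ineq[of "w - x" "x - u"]
          by (simp add: dist_norm norm_minus_commute abs_minus_commute[of 1])
        then have "u \<in> ?A" using u by (simp add: dist_norm)
        then obtain i where "u \<in> E i" using E(1) by blast
        then have "u \<in> F i" using closure_subset u(1) by (auto simp: F_def)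
        moreover have "norm x \<in> {1 - r/4..1 + r/4}" using nx unfolding abs_less_iff by simp
        ultimately have "x \<in> C i"
          unfolding C_def using u(2) by (intro image_eqI[of _ _ "(norm x, u)"]) auto
        then show "x \<in> (\<Union>i. C i)" by blast
      qed
      have "ennreal (\<omega> * (r/4) ^ ?n) = emeasure lborel (ball w (r/4))"
        using r by (simp add: emeasure_ball \<omega>_def)
      also have "\<dots> \<le> emeasure lborel (\<Union>i. C i)"
        using sub Cb by (intro emeasure_mono) auto
      also have "\<dots> \<le> (\<Sum>i. emeasure lborel (C i))"
        using Cb by (intro emeasure_subadditive_countably) auto
      also have "\<dots> \<le> (\<Sum>i. ennreal \<kappa> * ennreal (unit_ball_vol ?s * (diameter (E i) / 2) powr ?s))"
      proof (intro suminf_le allI)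
        fix i
        define d where "d = diameter (E i)"
        have d0: "d \<ge> 0" unfolding d_def using E(2) by (rule diameter_ge_0)
        have s: "?s = real (?n - 1)" using n2 by simp
        have "(d / 2) powr ?s = (d / 2) ^ (?n - 1)"
        proof (cases "d = 0")
          case False
          then show ?thesis unfolding s using d0 by (intro powr_realpow) simp
        qed (use n2 in simp)
        then have "\<kappa> * (\<omega>' * (d / 2) powr ?s) = 2 * \<omega> * 3 ^ ?n * r * d ^ (?n - 1)"
          using pos unfolding \<kappa>_def power_divide by simp
        then show "emeasure lborel (C i) \<le> ennreal \<kappa> * ennreal (unit_ball_vol ?s * (diameter (E i) / 2) powr ?s)"
          using Cle[of i] \<kappa> by (simp add: ennreal_mult'[symmetric] \<omega>'_def d_def)
      qed auto
      also have "\<dots> = ennreal \<kappa> * (\<Sum>i. ennreal (unit_ball_vol ?s * (diameter (E i) / 2) powr ?s))"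
        by (rule ennreal_suminf_cmult)
      finally have *: "ennreal (1 / \<kappa>) * ennreal (\<omega> * (r/4) ^ ?n)
          \<le> ennreal (1 / \<kappa>) * (ennreal \<kappa> * (\<Sum>i. ennreal (unit_ball_vol ?s * (diameter (E i) / 2) powr ?s)))"
        by (rule mult_left_mono) simp
      have "r ^ ?n = r * r ^ (?n - 1)" by (simp add: power_eq_if)
      then have "1 / \<kappa> * (\<omega> * (r/4) ^ ?n) = c * r ^ (?n - 1)"
        using pos r unfolding \<kappa>_def c_def power_divide by (simp add: divide_simps)
      then have "ennreal (1 / \<kappa>) * ennreal (\<omega> * (r/4) ^ ?n) = ennreal (c * r ^ (?n - 1))"
        using \<kappa> by (simp add: ennreal_mult'[symmetric])
      moreover have "ennreal (1 / \<kappa>) * ennreal \<kappa> = 1"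
        using \<kappa> by (subst ennreal_mult'[symmetric]) auto
      then have "ennreal (1 / \<kappa>) * (ennreal \<kappa> * X) = X" for X
        by (simp only: mult.assoc[symmetric] mult_1_left)
      ultimately show "ennreal (c * r ^ (?n - 1))
          \<le> (\<Sum>i. ennreal (unit_ball_vol ?s * (diameter (E i) / 2) powr ?s))"
        using * by simp
    qed
    also have "\<dots> \<le> hausdorff_outer ?s ?A" using r by (intro hausdorff_premeasure_le_outer)
    finally show "ennreal (c * r ^ (?n - 1)) \<le> hausdorff_outer ?s ?A" .
  qed
qed

lemma emeasure_spherical_measure:
  "A \<in> sets borel \<Longrightarrow> A \<subseteq> sphere 0 1 \<Longrightarrow>
    emeasure (spherical_measure :: 'a::euclidean_space measure) A = hausdorff_outer (real DIM('a) - 1) A"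
  unfolding spherical_measure_def
  by (subst emeasure_restrict_space) (auto simp: emeasure_hausdorff_measure borel_closed)

lemma finite_borel_on_sphere_spherical_measure:
  "finite_borel_on_sphere (spherical_measure :: 'a::euclidean_space measure)"
proof -
  have space: "space (spherical_measure :: 'a measure) = sphere 0 1"
    by (simp add: spherical_measure_def space_restrict_space)
  have "sets (spherical_measure :: 'a measure) = sets (restrict_space borel (sphere 0 1))"
    unfolding spherical_measure_def by (rule sets_restrict_space_cong) simp
  then show ?thesis
    unfolding finite_borel_on_sphere_def using space hausdorff_outer_sphere_finite[where 'a='a]
    by (auto intro!: finite_measureI simp: emeasure_spherical_measure borel_closed)
qed

lemma spherical_measure_cap_ge:
  assumes "DIM('a::euclidean_space) \<ge> 2"
  obtains c where "c > 0"
    and "\<And>(w::'a) r. \<lbrakk>norm w = 1; 0 < r; r \<le> 1\<rbrakk> \<Longrightarrow>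
      c * r ^ (DIM('a) - 1) \<le> measure spherical_measure (sphere 0 1 \<inter> ball w r)"
proof -
  interpret finite_measure "spherical_measure :: 'a measure"
    using finite_borel_on_sphere_spherical_measure by (auto simp: finite_borel_on_sphere_def)
  obtain c where c: "c > 0" "\<And>(w::'a) r. \<lbrakk>norm w = 1; 0 < r; r \<le> 1\<rbrakk> \<Longrightarrow>
      ennreal (c * r ^ (DIM('a) - 1)) \<le> hausdorff_outer (real DIM('a) - 1) (sphere 0 1 \<inter> ball w r)"
    using hausdorff_outer_cap_ge[OF assms] by blast
  show ?thesis
  proof (rule that[OF c(1)])
    fix w :: 'a and r :: real assume *: "norm w = 1" "0 < r" "r \<le> 1"
    have "ennreal (c * r ^ (DIM('a) - 1)) \<le> emeasure spherical_measure (sphere 0 1 \<inter> ball w r)"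
      using c(2)[OF *] by (subst emeasure_spherical_measure) (auto intro!: sets.Int borel_closed borel_open)
    then show "c * r ^ (DIM('a) - 1) \<le> measure spherical_measure (sphere 0 1 \<inter> ball w r)"
      by (simp add: emeasure_eq_measure)
  qed
qed

section \<open>Integrals over the sphere and level values\<close>

abbreviation (input) unit_sphere :: "'a::euclidean_space set" where "unit_sphere \<equiv> sphere 0 1"

lemma space_finite_borel_on_sphere: "finite_borel_on_sphere \<nu> \<Longrightarrow> space \<nu> = unit_sphere"
  using sets_eq_imp_space_eq[of \<nu> "restrict_space borel unit_sphere"]
  by (simp add: finite_borel_on_sphere_def space_restrict_space)

lemma integrable_continuous_on_sphere:
  fixes f :: "'a::euclidean_space \<Rightarrow> real"
  assumes \<nu>: "finite_borel_on_sphere \<nu>" and f: "continuous_on unit_sphere f"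
  shows "integrable \<nu> f"
proof -
  interpret finite_measure \<nu> using \<nu> by (simp add: finite_borel_on_sphere_def)
  have "compact (f ` unit_sphere)" using f by (intro compact_continuous_image) auto
  then have "bounded (f ` unit_sphere)" by (rule compact_imp_bounded)
  then obtain B where B: "\<And>u. u \<in> unit_sphere \<Longrightarrow> norm (f u) \<le> B"
    unfolding bounded_iff by (metis image_eqI)
  have "f \<in> borel_measurable \<nu>"
    using borel_measurable_continuous_on_restrict[OF f] \<nu>
    by (simp add: finite_borel_on_sphere_def cong: measurable_cong_sets)
  then show ?thesis
    using B space_finite_borel_on_sphere[OF \<nu>] by (intro integrable_const_bound[of _ B]) auto
qed

lemma integral_mono_sphere:
  fixes f g :: "'a::euclidean_space \<Rightarrow> real"
  assumes \<nu>: "finite_borel_on_sphere \<nu>" and f: "continuous_on unit_sphere f" "continuous_on unit_sphere g"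
    and le: "\<And>u. u \<in> unit_sphere \<Longrightarrow> f u \<le> g u"
  shows "(\<integral>u. f u \<partial>\<nu>) \<le> (\<integral>u. g u \<partial>\<nu>)"
  using le by (intro integral_mono integrable_continuous_on_sphere \<nu> f)
    (simp add: space_finite_borel_on_sphere[OF \<nu>])

lemma integral_cong_sphere:
  assumes "finite_borel_on_sphere \<nu>" "\<And>u. u \<in> unit_sphere \<Longrightarrow> f u = g u"
  shows "(\<integral>u. f u \<partial>\<nu>) = (\<integral>u. g u \<partial>\<nu>)"
  using assms by (intro Bochner_Integration.integral_cong) (auto simp: space_finite_borel_on_sphere)

lemma integral_const_sphere:
  fixes c :: real
  assumes "finite_borel_on_sphere \<nu>"
  shows "(\<integral>u. c \<partial>\<nu>) = c * measure \<nu> unit_sphere"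
  using assms by (simp add: space_finite_borel_on_sphere)

lemma integral_less_sphere:
  fixes f g :: "'a::euclidean_space \<Rightarrow> real"
  assumes \<nu>: "finite_borel_on_sphere \<nu>" "measure \<nu> unit_sphere > 0"
    and f: "continuous_on unit_sphere f" "continuous_on unit_sphere g"
    and less: "\<And>u. u \<in> unit_sphere \<Longrightarrow> f u < g u"
  shows "(\<integral>u. f u \<partial>\<nu>) < (\<integral>u. g u \<partial>\<nu>)"
proof -
  interpret finite_measure \<nu> using \<nu> by (simp add: finite_borel_on_sphere_def)
  show ?thesis
  proof (rule integral_less_AE_space)
    show "AE u in \<nu>. f u < g u"
      using less space_finite_borel_on_sphere[OF \<nu>(1)] by (intro AE_I2) auto
    show "emeasure \<nu> (space \<nu>) \<noteq> 0"
      using \<nu>(2) by (simp add: space_finite_borel_on_sphere[OF \<nu>(1)] emeasure_eq_measure)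
  qed (intro integrable_continuous_on_sphere \<nu> f)+
qed

lemma weakly_converges_const: "weakly_converges_on_sphere (\<lambda>_. \<nu>) \<nu>"
  by (simp add: weakly_converges_on_sphere_def)

lemma weakly_converges_filterlim:
  assumes "weakly_converges_on_sphere \<nu>s \<nu>" "filterlim r at_top sequentially"
  shows "weakly_converges_on_sphere (\<lambda>i. \<nu>s (r i)) \<nu>"
  using assms unfolding weakly_converges_on_sphere_def by (auto intro: filterlim_compose)

lemma weakly_converges_mass:
  assumes "weakly_converges_on_sphere \<nu>s \<nu>" "\<And>i. finite_borel_on_sphere (\<nu>s i)" "finite_borel_on_sphere \<nu>"
  shows "(\<lambda>i. measure (\<nu>s i) unit_sphere) \<longlonglongrightarrow> measure \<nu> unit_sphere"
proof -
  have "(\<lambda>i. \<integral>u. (1::real) \<partial>\<nu>s i) \<longlonglongrightarrow> (\<integral>u. 1 \<partial>\<nu>)"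
    using assms(1)[unfolded weakly_converges_on_sphere_def, rule_format, of "\<lambda>_. 1"] by simp
  then show ?thesis by (simp only: integral_const_sphere[OF assms(2)] integral_const_sphere[OF assms(3)] mult_1_left)
qed

text \<open>Integrands and measures vary together. The masses converge, hence are bounded, so the
  uniform error of the integrands times the mass vanishes; weak convergence handles the fixed
  integrand \<open>f\<close>.\<close>

lemma tendsto_integral_weak_uniform:
  fixes f :: "'a::euclidean_space \<Rightarrow> real"
  assumes w: "weakly_converges_on_sphere \<nu>s \<nu>"
    and \<nu>: "\<And>i. finite_borel_on_sphere (\<nu>s i)" "finite_borel_on_sphere \<nu>"
    and f: "continuous_on unit_sphere f" "\<And>i. continuous_on unit_sphere (fs i)"
    and unif: "uniform_limit unit_sphere fs f sequentially"
  shows "(\<lambda>i. \<integral>u. fs i u \<partial>\<nu>s i) \<longlonglongrightarrow> (\<integral>u. f u \<partial>\<nu>)"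
proof -
  let ?m = "measure \<nu> unit_sphere"
  have "(\<lambda>i. (\<integral>u. fs i u \<partial>\<nu>s i) - (\<integral>u. f u \<partial>\<nu>s i)) \<longlonglongrightarrow> 0"
  proof (rule tendstoI)
    fix e :: real assume e: "e > 0"
    define m where "m = ?m + 1"
    define e' where "e' = e / (2 * m)"
    have m: "m > 0" by (simp add: m_def add_nonneg_pos)
    have e': "e' > 0" using e m by (simp add: e'_def)
    have "eventually (\<lambda>i. measure (\<nu>s i) unit_sphere < m) sequentially"
      by (rule order_tendstoD(2)[OF weakly_converges_mass[OF w \<nu>]]) (simp add: m_def)
    moreover have "eventually (\<lambda>i. \<forall>u\<in>unit_sphere. dist (fs i u) (f u) < e') sequentially"
      by (rule uniform_limitD[OF unif e'])
    ultimately show "eventually (\<lambda>i. dist ((\<integral>u. fs i u \<partial>\<nu>s i) - (\<integral>u. f u \<partial>\<nu>s i)) 0 < e) sequentially"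
    proof eventually_elim
      case (elim i)
      have int: "integrable (\<nu>s i) (fs i)" "integrable (\<nu>s i) f"
        using f \<nu> by (auto intro: integrable_continuous_on_sphere)
      have "\<bar>\<integral>u. fs i u - f u \<partial>\<nu>s i\<bar> \<le> (\<integral>u. e' \<partial>\<nu>s i)"
        using elim(2) int \<nu>(1)[of i]
        by (intro integral_abs_bound_integral)
           (auto simp: space_finite_borel_on_sphere dist_real_def less_imp_le
              intro!: integrable_continuous_on_sphere)
      also have "\<dots> = e' * measure (\<nu>s i) unit_sphere" by (rule integral_const_sphere[OF \<nu>(1)])
      also have "\<dots> \<le> e' * m" using elim(1) e' by (intro mult_left_mono) auto
      also have "\<dots> < e" using e m by (simp add: e'_def)
      finally show ?case using int by (simp add: Bochner_Integration.integral_diff)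
    qed
  qed
  moreover have "(\<lambda>i. \<integral>u. f u \<partial>\<nu>s i) \<longlonglongrightarrow> (\<integral>u. f u \<partial>\<nu>)"
    using w f unfolding weakly_converges_on_sphere_def by blast
  ultimately have "(\<lambda>i. ((\<integral>u. fs i u \<partial>\<nu>s i) - (\<integral>u. f u \<partial>\<nu>s i)) + (\<integral>u. f u \<partial>\<nu>s i))
      \<longlonglongrightarrow> 0 + (\<integral>u. f u \<partial>\<nu>)" by (rule tendsto_add)
  then show ?thesis by simp
qed

lemma positive_on_sphere_lower_bound:
  fixes f :: "'a::euclidean_space \<Rightarrow> real"
  assumes "continuous_on unit_sphere f" "\<And>u. u \<in> unit_sphere \<Longrightarrow> f u > 0"
  obtains m where "m > 0" "\<And>u. u \<in> unit_sphere \<Longrightarrow> m \<le> f u"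
proof -
  have "unit_sphere \<noteq> ({} :: 'a set)" by simp
  then obtain u0 :: 'a where "u0 \<in> unit_sphere" "\<forall>u\<in>unit_sphere. f u0 \<le> f u"
    using continuous_attains_inf[OF compact_sphere _ assms(1)] by blast
  then show ?thesis using assms(2) that by blast
qed

lemma continuous_on_sphere_upper_bound:
  fixes f :: "'a::euclidean_space \<Rightarrow> real"
  assumes "continuous_on unit_sphere f"
  obtains M where "M > 0" "\<And>u. u \<in> unit_sphere \<Longrightarrow> f u \<le> M"
proof -
  have "compact (f ` unit_sphere)" using assms by (intro compact_continuous_image) auto
  then have "bounded (f ` unit_sphere)" by (rule compact_imp_bounded)
  then obtain B where B: "B > 0" "\<And>u. u \<in> unit_sphere \<Longrightarrow> norm (f u) \<le> B"
    unfolding bounded_pos by auto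
  then show ?thesis using that[of B] by (force simp: abs_le_iff)
qed

lemma class_G_I_D:
  assumes "G \<in> class_G_I"
  shows "continuous_on ({0<..} \<times> unit_sphere) (\<lambda>(t, u). G t u)"
    and "\<And>t u. t > 0 \<Longrightarrow> u \<in> unit_sphere \<Longrightarrow> G t u > 0"
    and "\<And>s t u. 0 < s \<Longrightarrow> s < t \<Longrightarrow> u \<in> unit_sphere \<Longrightarrow> G s u < G t u"
    and "\<And>s t u. 0 < s \<Longrightarrow> s \<le> t \<Longrightarrow> u \<in> unit_sphere \<Longrightarrow> G s u \<le> G t u"
    and "\<And>u. u \<in> unit_sphere \<Longrightarrow> ((\<lambda>t. G t u) \<longlongrightarrow> 0) (at_right 0)"
    and "\<And>u. u \<in> unit_sphere \<Longrightarrow> filterlim (\<lambda>t. G t u) at_top at_top"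
  using assms by (auto simp: class_G_I_def strict_mono_on_def order_le_less)

lemma continuous_on_class_G_I:
  assumes G: "G \<in> class_G_I" and f: "continuous_on unit_sphere f" "\<And>u. u \<in> unit_sphere \<Longrightarrow> f u > 0"
  shows "continuous_on unit_sphere (\<lambda>u. G (f u) u)"
proof -
  have "continuous_on unit_sphere (\<lambda>u. (\<lambda>(t, u). G t u) (f u, u))"
    using f by (intro continuous_on_compose2[OF class_G_I_D(1)[OF G]] continuous_intros) auto
  then show ?thesis by simp
qed

text \<open>By compactness \<open>f\<close> takes values in some \<open>[m, M]\<close> inside the
  half-line; late \<open>fs i\<close> stay in \<open>[m/2, M + 1]\<close>, where \<open>G\<close> is
  uniformly continuous.\<close>

lemma uniform_limit_class_G_I:
  assumes G: "G \<in> class_G_I"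
    and f: "continuous_on unit_sphere f" "\<And>u. u \<in> unit_sphere \<Longrightarrow> f u > 0"
    and unif: "uniform_limit unit_sphere fs f sequentially"
  shows "uniform_limit unit_sphere (\<lambda>i u. G (fs i u) u) (\<lambda>u. G (f u) u) sequentially"
proof (rule uniform_limitI)
  fix e :: real assume e: "e > 0"
  obtain m where m: "m > 0" "\<And>u. u \<in> unit_sphere \<Longrightarrow> m \<le> f u"
    using positive_on_sphere_lower_bound[OF f] by blast
  obtain M where M: "M > 0" "\<And>u. u \<in> unit_sphere \<Longrightarrow> f u \<le> M"
    using continuous_on_sphere_upper_bound[OF f(1)] by blast
  let ?K = "{m/2..M + 1} \<times> unit_sphere"
  have "continuous_on ?K (\<lambda>(t, u). G t u)"
    by (rule continuous_on_subset[OF class_G_I_D(1)[OF G]]) (use m in auto)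
  then have "uniformly_continuous_on ?K (\<lambda>(t, u). G t u)"
    by (rule compact_uniformly_continuous) (auto intro: compact_Times)
  then obtain d where d: "d > 0"
    "\<And>x x'. x \<in> ?K \<Longrightarrow> x' \<in> ?K \<Longrightarrow> dist x' x < d \<Longrightarrow> dist (case x' of (t, u) \<Rightarrow> G t u) (case x of (t, u) \<Rightarrow> G t u) < e"
    using e unfolding uniformly_continuous_on_def by metis
  have "eventually (\<lambda>i. \<forall>u\<in>unit_sphere. dist (fs i u) (f u) < min (min (m/2) 1) d) sequentially"
    by (rule uniform_limitD[OF unif]) (use m d in auto)
  then show "eventually (\<lambda>i. \<forall>u\<in>unit_sphere. dist (G (fs i u) u) (G (f u) u) < e) sequentially"
  proof eventually_elim
    case (elim i)
    show ?case
    proof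
      fix u :: 'a assume u: "u \<in> unit_sphere"
      have c: "dist (fs i u) (f u) < m/2" "dist (fs i u) (f u) < 1" "dist (fs i u) (f u) < d"
        using elim u by auto
      have "f u \<in> {m/2..M + 1}" "fs i u \<in> {m/2..M + 1}"
        using c(1,2)[unfolded dist_real_def abs_less_iff] m(1) m(2)[OF u] M(2)[OF u] by auto
      then show "dist (G (fs i u) u) (G (f u) u) < e"
        using d(2)[of "(f u, u)" "(fs i u, u)"] c(3) u by (simp add: dist_Pair_Pair)
    qed
  qed
qed

lemma tendsto_integral_class_G_I:
  assumes G: "G \<in> class_G_I"
    and w: "weakly_converges_on_sphere \<nu>s \<nu>"
    and \<nu>: "\<And>i. finite_borel_on_sphere (\<nu>s i)" "finite_borel_on_sphere \<nu>"
    and f: "continuous_on unit_sphere f" "\<And>u. u \<in> unit_sphere \<Longrightarrow> f u > 0"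
    and fs: "\<And>i. continuous_on unit_sphere (fs i)" "\<And>i u. u \<in> unit_sphere \<Longrightarrow> fs i u > 0"
    and unif: "uniform_limit unit_sphere fs f sequentially"
  shows "(\<lambda>i. \<integral>u. G (fs i u) u \<partial>\<nu>s i) \<longlonglongrightarrow> (\<integral>u. G (f u) u \<partial>\<nu>)"
proof (rule tendsto_integral_weak_uniform[OF w \<nu>])
  show "continuous_on unit_sphere (\<lambda>u. G (f u) u)"
    using G f by (rule continuous_on_class_G_I)
  show "continuous_on unit_sphere (\<lambda>u. G (fs i u) u)" for i
    using G fs by (rule continuous_on_class_G_I)
  show "uniform_limit unit_sphere (\<lambda>i u. G (fs i u) u) (\<lambda>u. G (f u) u) sequentially"
    using G f unif by (rule uniform_limit_class_G_I)
qed

text \<open>The limit of \<open>G t u\<close> is assumed for each \<open>u\<close> separately.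
  Monotonicity in \<open>t\<close> and compactness of the sphere make it uniform, as in Dini's
  theorem: offending directions would accumulate at one that violates the pointwise limit.\<close>

lemma class_G_I_large:
  fixes G :: "real \<Rightarrow> 'a::euclidean_space \<Rightarrow> real"
  assumes G: "G \<in> class_G_I"
  obtains t0 where "t0 > 0" "\<And>t u. t \<ge> t0 \<Longrightarrow> u \<in> unit_sphere \<Longrightarrow> T < G t u"
proof -
  have "\<exists>t0>0. \<forall>t\<ge>t0. \<forall>u\<in>unit_sphere. T < G t u"
  proof (rule ccontr)
    assume neg: "\<not> ?thesis"
    have "\<exists>u. u \<in> unit_sphere \<and> G (real (Suc n)) u \<le> T" for n
    proof -
      obtain t u where "t \<ge> real (Suc n)" "u \<in> unit_sphere" "G t u \<le> T"
        using neg[simplified not_ex not_all, rule_format, of "real (Suc n)"] by (auto simp: not_less)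
      then show ?thesis
        using class_G_I_D(4)[OF G, of "real (Suc n)" t u] by force
    qed
    then obtain v where v: "\<And>n. v n \<in> unit_sphere" "\<And>n. G (real (Suc n)) (v n) \<le> T" by metis
    obtain u r where u: "u \<in> unit_sphere" and r: "strict_mono (r :: nat \<Rightarrow> nat)" and lim: "(v \<circ> r) \<longlonglongrightarrow> u"
      using compact_sphere[of "0::'a" 1] v(1) unfolding compact_def by blast
    have "eventually (\<lambda>t. T < G t u) at_top"
      using class_G_I_D(6)[OF G u] by (simp add: filterlim_at_top_dense)
    then have "eventually (\<lambda>t. T < G t u \<and> t > 0) at_top"
      using eventually_gt_at_top[of 0] by eventually_elim auto
    then obtain t where t: "T < G t u" "t > 0" by (auto dest: eventually_happens)
    have "continuous_on unit_sphere (\<lambda>u. G t u)"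
      using continuous_on_class_G_I[OF G, of "\<lambda>_. t"] t by auto
    then have "(\<lambda>n. G t ((v \<circ> r) n)) \<longlonglongrightarrow> G t u"
      by (rule continuous_on_tendsto_compose) (use lim u v in \<open>auto simp: comp_def\<close>)
    then have "eventually (\<lambda>n. T < G t ((v \<circ> r) n)) sequentially"
      using t by (intro order_tendstoD)
    moreover have "eventually (\<lambda>n. t \<le> real n) sequentially"
      by (rule eventually_ge_at_top[THEN filterlim_real_sequentially[unfolded filterlim_iff, rule_format]])
    ultimately have "eventually (\<lambda>n. T < G t ((v \<circ> r) n) \<and> t \<le> real n) sequentially"
      by (rule eventually_conj)
    then obtain n where n: "T < G t (v (r n))" "t \<le> real n"
      by (auto dest!: eventually_happens)
    have "t \<le> real (Suc (r n))" using n(2) seq_suble[OF r, of n] by simp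
    then have "G t (v (r n)) \<le> G (real (Suc (r n))) (v (r n))"
      using t v(1) by (intro class_G_I_D(4)[OF G]) auto
    then show False using v(2)[of "r n"] n(1) by simp
  qed
  then show ?thesis using that by blast
qed

text \<open>The compactness argument of \<open>class_G_I_large\<close> at the other end of the
  half-line.\<close>

lemma class_G_I_small:
  fixes G :: "real \<Rightarrow> 'a::euclidean_space \<Rightarrow> real"
  assumes G: "G \<in> class_G_I" and e: "e > 0"
  obtains t0 where "t0 > 0" "\<And>t u. 0 < t \<Longrightarrow> t \<le> t0 \<Longrightarrow> u \<in> unit_sphere \<Longrightarrow> G t u < e"
proof -
  have "\<exists>t0>0. \<forall>t. 0 < t \<and> t \<le> t0 \<longrightarrow> (\<forall>u\<in>unit_sphere. G t u < e)"
  proof (rule ccontr)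
    assume neg: "\<not> ?thesis"
    have "\<exists>u. u \<in> unit_sphere \<and> e \<le> G (inverse (real (Suc n))) u" for n
    proof -
      have "inverse (real (Suc n)) > 0" by simp
      then obtain t u where "0 < t" "t \<le> inverse (real (Suc n))" "u \<in> unit_sphere" "e \<le> G t u"
        using neg by (meson not_less)
      then show ?thesis
        using class_G_I_D(4)[OF G, of t "inverse (real (Suc n))" u] by force
    qed
    then obtain v where v: "\<And>n. v n \<in> unit_sphere" "\<And>n. e \<le> G (inverse (real (Suc n))) (v n)" by metis
    obtain u r where u: "u \<in> unit_sphere" and r: "strict_mono (r :: nat \<Rightarrow> nat)" and lim: "(v \<circ> r) \<longlonglongrightarrow> u"
      using compact_sphere[of "0::'a" 1] v(1) unfolding compact_def by blast
    have "eventually (\<lambda>t. G t u < e) (at_right 0)"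
      using class_G_I_D(5)[OF G u] e by (intro order_tendstoD)
    then obtain b where b: "b > 0" "\<And>t. 0 < t \<Longrightarrow> t < b \<Longrightarrow> G t u < e"
      by (auto simp: eventually_at_right_field)
    define t where "t = b / 2"
    have t: "G t u < e" "t > 0" using b by (auto simp: t_def)
    have "continuous_on unit_sphere (\<lambda>u. G t u)"
      using continuous_on_class_G_I[OF G, of "\<lambda>_. t"] t by auto
    then have "(\<lambda>n. G t ((v \<circ> r) n)) \<longlonglongrightarrow> G t u"
      by (rule continuous_on_tendsto_compose) (use lim u v in \<open>auto simp: comp_def\<close>)
    then have "eventually (\<lambda>n. G t ((v \<circ> r) n) < e) sequentially"
      using t by (intro order_tendstoD)
    moreover have "eventually (\<lambda>n. inverse (real (Suc n)) < t) sequentially"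
      using t by (intro order_tendstoD(2)[OF LIMSEQ_inverse_real_of_nat])
    ultimately have "eventually (\<lambda>n. G t ((v \<circ> r) n) < e \<and> inverse (real (Suc n)) < t) sequentially"
      by (rule eventually_conj)
    then obtain n where n: "G t (v (r n)) < e" "inverse (real (Suc n)) < t"
      by (auto dest!: eventually_happens)
    have "inverse (real (Suc (r n))) \<le> inverse (real (Suc n))"
      using seq_suble[OF r, of n] by (intro le_imp_inverse_le) auto
    then have "inverse (real (Suc (r n))) \<le> t" using n(2) by linarith
    then have "G (inverse (real (Suc (r n)))) (v (r n)) \<le> G t (v (r n))"
      using v(1) by (intro class_G_I_D(4)[OF G]) simp_all
    then show False using v(2)[of "r n"] n(1) by simp
  qed
  then show ?thesis using that by blast
qed

section \<open>Levels: attainment and continuity\<close>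

text \<open>
  Common generalisation of the Orlicz norm (\<open>G t u = \<phi> t\<close>, \<open>c\<close> the total mass) and of the homogeneous
  dual volume (\<open>\<nu>\<close> the spherical measure, \<open>c = 1\<close>).
\<close>

definition level :: "'a::euclidean_space measure \<Rightarrow> (real \<Rightarrow> 'a \<Rightarrow> real) \<Rightarrow> real \<Rightarrow> ('a \<Rightarrow> real) \<Rightarrow> real" where
  "level \<nu> G c f = Inf {r. r > 0 \<and> (\<integral>u. G (f u / r) u \<partial>\<nu>) \<le> c}"

locale level_setting =
  fixes \<nu> :: "'a::euclidean_space measure" and G :: "real \<Rightarrow> 'a \<Rightarrow> real" and c :: real
    and f :: "'a \<Rightarrow> real"
  assumes \<nu>: "finite_borel_on_sphere \<nu>" "measure \<nu> unit_sphere > 0"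
    and G: "G \<in> class_G_I" and c: "c > 0"
    and f: "continuous_on unit_sphere f" "\<And>u. u \<in> unit_sphere \<Longrightarrow> f u > 0"
begin

lemma continuous_integrand: "r > 0 \<Longrightarrow> continuous_on unit_sphere (\<lambda>u. G (f u / r) u)"
  using f by (intro continuous_on_class_G_I[OF G]) (auto intro!: continuous_intros)

lemma integral_strict_antimono:
  assumes "0 < r" "r < s"
  shows "(\<integral>u. G (f u / s) u \<partial>\<nu>) < (\<integral>u. G (f u / r) u \<partial>\<nu>)"
  using assms f(2)
  by (intro integral_less_sphere[OF \<nu>] continuous_integrand class_G_I_D(3)[OF G])
     (auto intro!: divide_strict_left_mono)

text \<open>\<open>f u / r\<close> varies uniformly in \<open>u\<close> with \<open>r\<close>, so
  the convergence theorem for weakly convergent measures applies with a constant sequence of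
  measures.\<close>

lemma continuous_on_level_integral: "continuous_on {0<..} (\<lambda>r. \<integral>u. G (f u / r) u \<partial>\<nu>)"
  unfolding continuous_on_sequentially
proof (intro allI ballI impI)
  fix x :: "nat \<Rightarrow> real" and a assume a: "a \<in> {0<..}" and x: "(\<forall>n. x n \<in> {0<..}) \<and> x \<longlonglongrightarrow> a"
  obtain M where M: "M > 0" "\<And>u. u \<in> unit_sphere \<Longrightarrow> f u \<le> M"
    using continuous_on_sphere_upper_bound[OF f(1)] by blast
  have lim: "(\<lambda>n. inverse (x n)) \<longlonglongrightarrow> inverse a" using x a by (intro tendsto_inverse) auto
  have "uniform_limit unit_sphere (\<lambda>n u. f u / x n) (\<lambda>u. f u / a) sequentially"
  proof (rule uniform_limitI)
    fix e :: real assume e: "e > 0"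
    then have "eventually (\<lambda>n. dist (inverse (x n)) (inverse a) < e / M) sequentially"
      using M by (intro tendstoD[OF lim]) simp
    then show "eventually (\<lambda>n. \<forall>u\<in>unit_sphere. dist (f u / x n) (f u / a) < e) sequentially"
    proof eventually_elim
      case (elim n)
      show ?case
      proof
        fix u :: 'a assume u: "u \<in> unit_sphere"
        have "dist (f u / x n) (f u / a) = f u * dist (inverse (x n)) (inverse a)"
          using f(2)[OF u] by (simp add: dist_real_def divide_inverse abs_mult flip: right_diff_distrib)
        also have "\<dots> \<le> M * dist (inverse (x n)) (inverse a)"
          using M(2)[OF u] by (intro mult_right_mono) auto
        also have "\<dots> < e" using elim M by (simp add: field_simps)
        finally show "dist (f u / x n) (f u / a) < e" .
      qed
    qed
  qed
  moreover have "x n \<noteq> 0" for n using x by (metis greaterThan_iff less_irrefl)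
  ultimately show "((\<lambda>r. \<integral>u. G (f u / r) u \<partial>\<nu>) \<circ> x) \<longlonglongrightarrow> (\<integral>u. G (f u / a) u \<partial>\<nu>)"
    unfolding comp_def using x a f
    by (intro tendsto_integral_class_G_I[OF G weakly_converges_const \<nu>(1) \<nu>(1)])
       (auto intro!: continuous_intros)
qed

lemma ex_level: "\<exists>r>0. (\<integral>u. G (f u / r) u \<partial>\<nu>) = c"
proof -
  let ?m = "measure \<nu> unit_sphere"
  let ?J = "\<lambda>r. \<integral>u. G (f u / r) u \<partial>\<nu>"
  obtain m where m: "m > 0" "\<And>u. u \<in> unit_sphere \<Longrightarrow> m \<le> f u"
    using positive_on_sphere_lower_bound[OF f] by blast
  obtain M where M: "M > 0" "\<And>u. u \<in> unit_sphere \<Longrightarrow> f u \<le> M"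
    using continuous_on_sphere_upper_bound[OF f(1)] by blast
  obtain t1 where t1: "t1 > 0" "\<And>t u. t \<ge> t1 \<Longrightarrow> u \<in> unit_sphere \<Longrightarrow> c / ?m < G t u"
    using class_G_I_large[OF G] by blast
  obtain t0 where t0: "t0 > 0" "\<And>t u. 0 < t \<Longrightarrow> t \<le> t0 \<Longrightarrow> u \<in> unit_sphere \<Longrightarrow> G t u < c / ?m"
    using class_G_I_small[OF G, of "c / ?m"] c \<nu>(2) by auto
  \<comment> \<open>At \<open>r = m / t1\<close> every argument \<open>f u / r\<close> is at least
    \<open>t1\<close>, and at \<open>r = M / t0\<close> at most \<open>t0\<close>. So the integral
    is at least \<open>c\<close> at the first value and at most \<open>c\<close> at the
    second.\<close>
  have a: "c \<le> ?J (m / t1)"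
  proof -
    have "c = (\<integral>u. c / ?m \<partial>\<nu>)" using \<nu>(2) unfolding integral_const_sphere[OF \<nu>(1)] by simp
    also have "\<dots> \<le> ?J (m / t1)"
    proof (intro integral_mono_sphere[OF \<nu>(1)] continuous_integrand)
      fix u :: 'a assume u: "u \<in> unit_sphere"
      have "t1 \<le> f u / (m / t1)" using m(1) m(2)[OF u] t1(1) by (simp add: field_simps)
      then show "c / ?m \<le> G (f u / (m / t1)) u" using t1(2) u by (simp add: less_imp_le)
    qed (use m t1 in auto)
    finally show ?thesis .
  qed
  have b: "?J (M / t0) \<le> c"
  proof -
    have "?J (M / t0) \<le> (\<integral>u. c / ?m \<partial>\<nu>)"
    proof (intro integral_mono_sphere[OF \<nu>(1)] continuous_integrand)
      fix u :: 'a assume u: "u \<in> unit_sphere"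
      have "f u / (M / t0) \<le> t0" "0 < f u / (M / t0)"
        using M(1) M(2)[OF u] t0(1) f(2)[OF u] by (simp_all add: field_simps)
      then show "G (f u / (M / t0)) u \<le> c / ?m" using t0(2) u by (simp add: less_imp_le)
    qed (use M t0 in auto)
    also have "\<dots> = c" using \<nu>(2) unfolding integral_const_sphere[OF \<nu>(1)] by simp
    finally show ?thesis .
  qed
  have pos: "0 < m / t1" "0 < M / t0" using m t1 M t0 by auto
  have "m / t1 \<le> M / t0"
    using integral_strict_antimono[of "M / t0" "m / t1"] a b pos by (meson leD le_less_trans not_le)
  then have "\<exists>r. m / t1 \<le> r \<and> r \<le> M / t0 \<and> ?J r = c"
    using a b pos
    by (intro IVT2' continuous_on_subset[OF continuous_on_level_integral]) auto
  then show ?thesis using pos less_le_trans by blast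
qed

lemma integral_le_iff:
  assumes "r > 0" "s > 0"
  shows "(\<integral>u. G (f u / s) u \<partial>\<nu>) \<le> (\<integral>u. G (f u / r) u \<partial>\<nu>) \<longleftrightarrow> r \<le> s"
  using integral_strict_antimono[of r s] integral_strict_antimono[of s r] assms
  by (cases r s rule: linorder_cases) auto

text \<open>Strict monotonicity turns the set under \<open>Inf\<close> into the ray
  \<open>{r..}\<close>; from here on the infimum is replaced by an equation.\<close>

lemma level_eqI:
  assumes "r > 0" "(\<integral>u. G (f u / r) u \<partial>\<nu>) = c"
  shows "level \<nu> G c f = r"
proof -
  have "{s. s > 0 \<and> (\<integral>u. G (f u / s) u \<partial>\<nu>) \<le> c} = {r..}"
    using assms(1) integral_le_iff[of r] unfolding assms(2)[symmetric] by auto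
  then show ?thesis by (simp add: level_def)
qed

lemma level_pos: "level \<nu> G c f > 0"
  and integral_level: "(\<integral>u. G (f u / level \<nu> G c f) u \<partial>\<nu>) = c"
  using ex_level level_eqI by auto

text \<open>The negations of this and of \<open>level_ge_iff\<close> translate strict inequalities
  between levels and test values into strict inequalities between integrals, the form that survives
  small perturbations.\<close>

lemma level_le_iff: "r > 0 \<Longrightarrow> level \<nu> G c f \<le> r \<longleftrightarrow> (\<integral>u. G (f u / r) u \<partial>\<nu>) \<le> c"
  using integral_le_iff[OF level_pos, of r] integral_level by simp

lemma level_ge_iff: "r > 0 \<Longrightarrow> r \<le> level \<nu> G c f \<longleftrightarrow> c \<le> (\<integral>u. G (f u / r) u \<partial>\<nu>)"
  using integral_le_iff[OF _ level_pos, of r] integral_level by simp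

end

text \<open>A test value \<open>a\<close> lies below the level exactly when the integral at
  \<open>a\<close> exceeds \<open>c\<close>, and above it exactly when the integral falls short of
  \<open>c\<close>. Such strict inequalities between limits are inherited by late indices.\<close>

lemma tendsto_level:
  assumes G: "G \<in> class_G_I"
    and w: "weakly_converges_on_sphere \<nu>s \<nu>"
    and \<nu>: "\<And>i. finite_borel_on_sphere (\<nu>s i)" "finite_borel_on_sphere \<nu>"
    and mass: "\<And>i. measure (\<nu>s i) unit_sphere > 0" "measure \<nu> unit_sphere > 0"
    and c: "\<And>i. cs i > 0" "c > 0" "cs \<longlonglongrightarrow> c"
    and f: "continuous_on unit_sphere f" "\<And>u. u \<in> unit_sphere \<Longrightarrow> f u > 0"
    and fs: "\<And>i. continuous_on unit_sphere (fs i)" "\<And>i u. u \<in> unit_sphere \<Longrightarrow> fs i u > 0"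
    and unif: "uniform_limit unit_sphere fs f sequentially"
  shows "(\<lambda>i. level (\<nu>s i) G (cs i) (fs i)) \<longlonglongrightarrow> level \<nu> G c f"
proof -
  interpret L: level_setting \<nu> G c f
    by unfold_locales (use \<nu> mass G c f in auto)
  interpret Ls: level_setting "\<nu>s i" G "cs i" "fs i" for i
    by unfold_locales (use \<nu> mass G c fs in auto)
  have J: "(\<lambda>i. (\<integral>u. G (fs i u / r) u \<partial>\<nu>s i) - cs i) \<longlonglongrightarrow> (\<integral>u. G (f u / r) u \<partial>\<nu>) - c" if "r > 0" for r
  proof (intro tendsto_diff c tendsto_integral_class_G_I[OF G w \<nu>])
    show "uniform_limit unit_sphere (\<lambda>i u. fs i u / r) (\<lambda>u. f u / r) sequentially"
      using bounded_linear.uniform_limit[OF bounded_linear_divide[of r] unif] .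
  qed (use f fs that in \<open>auto intro!: continuous_intros\<close>)
  show ?thesis
  proof (rule order_tendstoI)
    fix a assume a: "a < level \<nu> G c f"
    show "eventually (\<lambda>i. a < level (\<nu>s i) G (cs i) (fs i)) sequentially"
    proof (cases "a > 0")
      case True
      then have "0 < (\<integral>u. G (f u / a) u \<partial>\<nu>) - c" using a L.level_le_iff[of a] by simp
      from order_tendstoD(1)[OF J[OF True] this] show ?thesis
        by eventually_elim (use Ls.level_le_iff[OF True] in \<open>simp add: not_le[symmetric]\<close>)
    next
      case False
      then show ?thesis using Ls.level_pos by (intro always_eventually) (meson le_less_trans not_le)
    qed
  next
    fix a assume a: "level \<nu> G c f < a"
    then have a0: "a > 0" using L.level_pos by simp
    have "(\<integral>u. G (f u / a) u \<partial>\<nu>) - c < 0" using a L.level_ge_iff[OF a0] by simp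
    from order_tendstoD(2)[OF J[OF a0] this] show "eventually (\<lambda>i. level (\<nu>s i) G (cs i) (fs i) < a) sequentially"
      by eventually_elim (use Ls.level_ge_iff[OF a0] in \<open>simp add: not_le[symmetric]\<close>)
  qed
qed

section \<open>Support functions of convex bodies\<close>

lemma convex_bodies_oD:
  assumes "Q \<in> convex_bodies_o"
  shows "compact Q" "convex Q" "0 \<in> Q" "Q \<noteq> {}" "bounded Q"
  using assms interior_subset[of Q] by (auto simp: convex_bodies_o_def compact_imp_bounded)

lemma convex_bodies_o_cball:
  assumes "Q \<in> convex_bodies_o"
  obtains m where "m > 0" "cball 0 m \<subseteq> Q"
  using assms by (auto simp: convex_bodies_o_def mem_interior_cball)

lemma support_fun_ge:
  assumes "bounded K" "x \<in> K"
  shows "x \<bullet> u \<le> support_fun K u"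
proof -
  have "bounded ((\<lambda>x. x \<bullet> u) ` K)"
    using assms(1) by (intro bounded_linear_image bounded_linear_inner_left)
  then show ?thesis unfolding support_fun_def
    using assms(2) by (intro cSUP_upper bounded_imp_bdd_above)
qed

lemma support_fun_le:
  assumes "K \<noteq> {}" "\<And>x. x \<in> K \<Longrightarrow> x \<bullet> u \<le> c"
  shows "support_fun K u \<le> c"
  unfolding support_fun_def using assms by (intro cSUP_least)

lemma support_fun_eqI:
  assumes "bounded K" "x \<in> K" "\<And>y. y \<in> K \<Longrightarrow> y \<bullet> u \<le> x \<bullet> u"
  shows "support_fun K u = x \<bullet> u"
  using support_fun_ge[OF assms(1,2)] support_fun_le[of K u "x \<bullet> u"] assms by (auto intro: antisym)

lemma support_fun_attained:
  assumes "compact K" "K \<noteq> {}"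
  obtains x where "x \<in> K" "support_fun K u = x \<bullet> u"
proof -
  have "continuous_on K (\<lambda>x. x \<bullet> u)" by (intro continuous_intros)
  then obtain x where "x \<in> K" "\<forall>y\<in>K. y \<bullet> u \<le> x \<bullet> u"
    using continuous_attains_sup[OF assms] by blast
  then show ?thesis using that support_fun_eqI[of K x u] assms(1) by (auto simp: compact_imp_bounded)
qed

lemma support_fun_lower:
  assumes "Q \<in> convex_bodies_o" "cball 0 m \<subseteq> Q" "0 \<le> m" "u \<in> unit_sphere"
  shows "m \<le> support_fun Q u"
proof -
  have "m *\<^sub>R u \<in> Q" using assms by auto
  then have "(m *\<^sub>R u) \<bullet> u \<le> support_fun Q u"
    by (rule support_fun_ge[OF convex_bodies_oD(5)[OF assms(1)]])
  then show ?thesis using assms(4) by (simp add: dot_square_norm)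
qed

lemma support_fun_pos:
  assumes "Q \<in> convex_bodies_o" "u \<in> unit_sphere"
  shows "support_fun Q u > 0"
proof -
  obtain m where "m > 0" "cball 0 m \<subseteq> Q" using convex_bodies_o_cball[OF assms(1)] .
  then show ?thesis using support_fun_lower[of Q m u] assms by simp
qed

lemma support_fun_upper:
  assumes "K \<noteq> {}" "K \<subseteq> cball 0 R" "u \<in> unit_sphere"
  shows "support_fun K u \<le> R"
proof (rule support_fun_le[OF assms(1)])
  fix x assume "x \<in> K"
  then show "x \<bullet> u \<le> R" using assms norm_cauchy_schwarz[of x u] by auto
qed

text \<open>One Lipschitz constant serves all bodies in \<open>cball 0 R\<close>. It gives the
  equicontinuity for Arzela-Ascoli and the linear upper bound around a near-zero that
  \<open>dual_volume_blowup\<close> asks for.\<close>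

lemma support_fun_lipschitz:
  assumes "K \<noteq> {}" "K \<subseteq> cball 0 R"
  shows "support_fun K u \<le> support_fun K v + R * norm (u - v)"
proof (rule support_fun_le[OF assms(1)])
  fix x assume x: "x \<in> K"
  have bdd: "bounded K" using assms(2) bounded_subset bounded_cball by blast
  have "x \<bullet> u = x \<bullet> v + x \<bullet> (u - v)" by (simp add: inner_diff_right)
  also have "x \<bullet> (u - v) \<le> norm x * norm (u - v)" by (rule norm_cauchy_schwarz)
  also have "\<dots> \<le> R * norm (u - v)" using x assms(2) by (intro mult_right_mono) auto
  finally show "x \<bullet> u \<le> support_fun K v + R * norm (u - v)"
    using support_fun_ge[OF bdd x, of v] by simp
qed

lemma support_fun_abs_diff_le:
  assumes "K \<noteq> {}" "K \<subseteq> cball 0 R"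
  shows "\<bar>support_fun K u - support_fun K v\<bar> \<le> R * norm (u - v)"
  using support_fun_lipschitz[OF assms, of u v] support_fun_lipschitz[OF assms, of v u]
  by (simp add: norm_minus_commute abs_le_iff)

lemma continuous_on_support_fun:
  assumes "Q \<in> convex_bodies_o"
  shows "continuous_on A (support_fun Q)"
proof -
  obtain R where R: "R > 0" "Q \<subseteq> cball 0 R"
    using convex_bodies_oD(5)[OF assms] unfolding bounded_pos by (metis mem_cball_0 subsetI)
  have "R-lipschitz_on A (support_fun Q)"
    using R support_fun_abs_diff_le[OF convex_bodies_oD(4)[OF assms] R(2)]
    by (intro lipschitz_onI) (auto simp: dist_real_def dist_norm)
  then show ?thesis by (rule lipschitz_on_continuous_on)
qed

text \<open>Along the ray of \<open>u\<close> the defining inequalities of the polar body are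
  tightest at the point of \<open>Q\<close> attaining the support value.\<close>

lemma radial_fun_polar_body:
  assumes "Q \<in> convex_bodies_o" "u \<in> unit_sphere"
  shows "radial_fun (polar_body Q) u = 1 / support_fun Q u"
proof -
  let ?h = "support_fun Q u"
  have h: "?h > 0" by (rule support_fun_pos[OF assms])
  obtain x where x: "x \<in> Q" "?h = x \<bullet> u"
    using support_fun_attained convex_bodies_oD[OF assms(1)] by metis
  have "t *\<^sub>R u \<in> polar_body Q \<longleftrightarrow> t * ?h \<le> 1" if t: "0 \<le> t" for t
  proof
    assume "t *\<^sub>R u \<in> polar_body Q"
    then show "t * ?h \<le> 1" using x by (auto simp: polar_body_def inner_commute)
  next
    assume le: "t * ?h \<le> 1"
    have "(t *\<^sub>R u) \<bullet> y \<le> 1" if "y \<in> Q" for y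
      using mult_left_mono[OF support_fun_ge[OF convex_bodies_oD(5)[OF assms(1)] that, of u] t] le
      by (simp add: inner_commute)
    then show "t *\<^sub>R u \<in> polar_body Q" by (simp add: polar_body_def)
  qed
  then have "{t. 0 \<le> t \<and> t *\<^sub>R u \<in> polar_body Q} = {0..1 / ?h}"
    using h by (auto simp: field_simps)
  then show ?thesis using h by (simp add: radial_fun_def)
qed

lemma cball_in_convex_bodies_o: "cball 0 1 \<in> convex_bodies_o"
  by (simp add: convex_bodies_o_def interior_cball)

lemma support_fun_cball:
  assumes "u \<in> unit_sphere"
  shows "support_fun (cball 0 1) u = 1"
  using support_fun_lower[OF cball_in_convex_bodies_o, of 1 u] support_fun_upper[of "cball 0 1" 1 u] assms
  by (auto intro: antisym)

lemma radial_fun_cball: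
  assumes "u \<in> unit_sphere"
  shows "radial_fun (cball 0 1) u = 1"
proof -
  have "{t. 0 \<le> t \<and> t *\<^sub>R u \<in> cball 0 1} = {0..1}" using assms by auto
  then show ?thesis by (simp add: radial_fun_def)
qed

lemma scale_convex_bodies_o:
  assumes Q: "Q \<in> convex_bodies_o" and t: "t > 0"
  shows "(\<lambda>x. t *\<^sub>R x) ` Q \<in> convex_bodies_o"
    and "support_fun ((\<lambda>x. t *\<^sub>R x) ` Q) u = t * support_fun Q u"
proof -
  note D = convex_bodies_oD[OF Q]
  obtain m where m: "m > 0" "cball 0 m \<subseteq> Q" using convex_bodies_o_cball[OF Q] .
  have "cball 0 (t * m) \<subseteq> (\<lambda>x. t *\<^sub>R x) ` Q"
  proof
    fix x :: 'a assume "x \<in> cball 0 (t * m)"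
    then have "x /\<^sub>R t \<in> Q" using t m(2) by (auto simp: field_simps)
    then show "x \<in> (\<lambda>x. t *\<^sub>R x) ` Q" using t by (intro image_eqI[of _ _ "x /\<^sub>R t"]) auto
  qed
  then have "0 \<in> interior ((\<lambda>x. t *\<^sub>R x) ` Q)"
    using t m(1) unfolding mem_interior_cball by (intro exI[of _ "t * m"]) simp
  then show "(\<lambda>x. t *\<^sub>R x) ` Q \<in> convex_bodies_o"
    using D by (simp add: convex_bodies_o_def compact_scaling convex_scaling)
  obtain x where x: "x \<in> Q" "support_fun Q u = x \<bullet> u"
    using support_fun_attained D by metis
  have "support_fun ((\<lambda>x. t *\<^sub>R x) ` Q) u = (t *\<^sub>R x) \<bullet> u"
  proof (rule support_fun_eqI)
    fix y assume "y \<in> (\<lambda>x. t *\<^sub>R x) ` Q"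
    then show "y \<bullet> u \<le> (t *\<^sub>R x) \<bullet> u"
      using support_fun_ge[OF D(5), of _ u] x t by auto
  qed (use x D in \<open>auto simp: bounded_scaling\<close>)
  then show "support_fun ((\<lambda>x. t *\<^sub>R x) ` Q) u = t * support_fun Q u" using x by simp
qed

lemma midpoint_convex_bodies_o:
  assumes P: "P \<in> convex_bodies_o" and Q: "Q \<in> convex_bodies_o"
  defines "M \<equiv> (\<lambda>(x, y). (1/2) *\<^sub>R (x + y)) ` (P \<times> Q)"
  shows "M \<in> convex_bodies_o"
    and "support_fun M u = (support_fun P u + support_fun Q u) / 2"
proof -
  note DP = convex_bodies_oD[OF P] and DQ = convex_bodies_oD[OF Q]
  have lin: "linear (\<lambda>(x, y :: 'a). (1/2) *\<^sub>R (x + y))"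
    by (auto simp: linear_iff algebra_simps)
  have comp: "compact M"
    unfolding M_def using DP DQ
    by (intro compact_continuous_image compact_Times linear_continuous_on linear_conv_bounded_linear[THEN iffD1] lin)
  obtain m1 m2 where "m1 > 0" "cball 0 m1 \<subseteq> P" "m2 > 0" "cball 0 m2 \<subseteq> Q"
    using convex_bodies_o_cball P Q by metis
  have "cball 0 (min m1 m2) \<subseteq> M"
  proof
    fix x :: 'a assume "x \<in> cball 0 (min m1 m2)"
    then have "x \<in> P" "x \<in> Q" using \<open>cball 0 m1 \<subseteq> P\<close> \<open>cball 0 m2 \<subseteq> Q\<close> by auto
    then show "x \<in> M" unfolding M_def
      by (intro image_eqI[of _ _ "(x, x)"]) (auto simp: scaleR_2[symmetric])
  qed
  then have "0 \<in> interior M" using \<open>m1 > 0\<close> \<open>m2 > 0\<close> by (auto simp: mem_interior_cball intro!: exI[of _ "min m1 m2"])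
  moreover have "convex M"
    unfolding M_def using DP DQ lin by (intro convex_linear_image convex_Times)
  ultimately show "M \<in> convex_bodies_o" using comp by (simp add: convex_bodies_o_def)
  obtain x where x: "x \<in> P" "support_fun P u = x \<bullet> u"
    using support_fun_attained DP by metis
  obtain y where y: "y \<in> Q" "support_fun Q u = y \<bullet> u"
    using support_fun_attained DQ by metis
  have "support_fun M u = ((1/2) *\<^sub>R (x + y)) \<bullet> u"
  proof (rule support_fun_eqI)
    show "(1/2) *\<^sub>R (x + y) \<in> M" using x y unfolding M_def by force
    fix z assume "z \<in> M"
    then obtain a b where "a \<in> P" "b \<in> Q" "z = (1/2) *\<^sub>R (a + b)" unfolding M_def by auto
    then show "z \<bullet> u \<le> ((1/2) *\<^sub>R (x + y)) \<bullet> u"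
      using support_fun_ge[OF DP(5), of a u] support_fun_ge[OF DQ(5), of b u] x y
      by (simp add: inner_add_left)
  qed (use comp in \<open>auto simp: compact_imp_bounded\<close>)
  then show "support_fun M u = (support_fun P u + support_fun Q u) / 2"
    using x y by (simp add: inner_add_left)
qed

section \<open>Norms and constraint sets in terms of levels and integrals\<close>

lemma measure_pos_of_not_concentrated:
  fixes \<mu> :: "'a::euclidean_space measure"
  assumes "finite_borel_on_sphere \<mu>" "not_concentrated_on_closed_hemisphere \<mu>"
  shows "measure \<mu> unit_sphere > 0"
proof -
  interpret finite_measure \<mu> using assms by (simp add: finite_borel_on_sphere_def)
  obtain v :: 'a where v: "v \<in> unit_sphere" by (metis all_not_in_conv sphere_eq_empty zero_le_one not_less)
  have "unit_sphere \<in> sets \<mu>" using sets.top[of \<mu>] by (simp add: space_finite_borel_on_sphere[OF assms(1)])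
  then have "measure \<mu> {u \<in> unit_sphere. u \<bullet> v > 0} \<le> measure \<mu> unit_sphere"
    by (intro finite_measure_mono) auto
  then show ?thesis
    using assms(2) v unfolding not_concentrated_on_closed_hemisphere_def by force
qed

lemma class_I_class_G_I: "\<phi> \<in> class_I \<Longrightarrow> (\<lambda>t u. \<phi> t) \<in> class_G_I"
  unfolding class_I_def class_G_I_def
  by (auto simp: case_prod_unfold intro!: continuous_on_compose2[of _ \<phi> _ fst] continuous_intros)

text \<open>The normalising factor moves to the other side as the bound of the level. It varies with
  the measure, which is why \<open>tendsto_level\<close> allows a sequence of bounds.\<close>

lemma orlicz_norm_eq_level:
  assumes "measure \<mu> unit_sphere > 0"
  shows "orlicz_norm \<mu> \<phi> h = level \<mu> (\<lambda>t u. \<phi> t) (measure \<mu> unit_sphere) h"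
  unfolding orlicz_norm_def level_def using assms by (simp add: divide_simps)

abbreviation (input) \<sigma> :: "'a::euclidean_space measure" where "\<sigma> \<equiv> spherical_measure"

lemma spherical_measure_pos:
  assumes "DIM('a) \<ge> 2"
  shows "measure (\<sigma> :: 'a::euclidean_space measure) unit_sphere > 0"
proof -
  interpret finite_measure "\<sigma> :: 'a measure" using finite_borel_on_sphere_spherical_measure by (auto simp: finite_borel_on_sphere_def)
  obtain c where c: "c > 0" "\<And>(w::'a) r. \<lbrakk>norm w = 1; 0 < r; r \<le> 1\<rbrakk> \<Longrightarrow>
      c * r ^ (DIM('a) - 1) \<le> measure \<sigma> (unit_sphere \<inter> ball w r)"
    using spherical_measure_cap_ge[OF assms] by blast
  obtain w :: 'a where w: "norm w = 1" using vector_choose_size[of 1] by auto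
  have "c \<le> measure \<sigma> (unit_sphere \<inter> ball w 1)" using c(2)[OF w, of 1] by simp
  also have "\<dots> \<le> measure \<sigma> (space (\<sigma> :: 'a measure))" by (rule bounded_measure)
  finally show ?thesis using c(1) by (simp add: space_finite_borel_on_sphere[OF finite_borel_on_sphere_spherical_measure])
qed

lemma B_tilde_iff:
  "Q \<in> B_tilde G \<longleftrightarrow> Q \<in> convex_bodies_o \<and>
     (\<integral>u. G (1 / support_fun Q u) u \<partial>\<sigma>) = (\<integral>u. G 1 u \<partial>\<sigma>)"
proof -
  have "dual_volume G (polar_body Q) = (\<integral>u. G (1 / support_fun Q u) u \<partial>\<sigma>)" if "Q \<in> convex_bodies_o"
    unfolding dual_volume_def
    by (rule integral_cong_sphere[OF finite_borel_on_sphere_spherical_measure]) (simp only: radial_fun_polar_body[OF that])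
  moreover have "dual_volume G (cball 0 1) = (\<integral>u. G 1 u \<partial>\<sigma>)"
    unfolding dual_volume_def by (rule integral_cong_sphere[OF finite_borel_on_sphere_spherical_measure]) (simp only: radial_fun_cball)
  ultimately show ?thesis by (auto simp: B_tilde_def)
qed

lemma class_G_I_rescale:
  assumes G: "G \<in> class_G_I" and \<eta>: "\<eta> > 0"
  shows "(\<lambda>t u. G (t / \<eta>) u) \<in> class_G_I"
proof -
  have "continuous_on ({0<..} \<times> unit_sphere) (\<lambda>x. (\<lambda>(t, u). G t u) (fst x / \<eta>, snd x))"
    using \<eta> by (intro continuous_on_compose2[OF class_G_I_D(1)[OF G]]) (auto intro!: continuous_intros)
  moreover have "((\<lambda>t. G (t / \<eta>) u) \<longlongrightarrow> 0) (at_right 0)" if "u \<in> unit_sphere" for u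
  proof (rule filterlim_compose[OF class_G_I_D(5)[OF G that]])
    have "((\<lambda>t. t / \<eta>) \<longlongrightarrow> 0 / \<eta>) (at_right 0)" using \<eta> by (intro tendsto_intros) auto
    then show "filterlim (\<lambda>t. t / \<eta>) (at_right 0) (at_right 0)"
      using \<eta> by (auto simp: filterlim_at eventually_at_right_field intro!: exI[of _ 1])
  qed
  moreover have "filterlim (\<lambda>t. G (t / \<eta>) u) at_top at_top" if "u \<in> unit_sphere" for u
  proof (rule filterlim_compose[OF class_G_I_D(6)[OF G that]])
    have "filterlim (\<lambda>t. inverse \<eta> * t) at_top at_top"
      using \<eta> by (intro filterlim_tendsto_pos_mult_at_top[OF tendsto_const]) (auto simp: filterlim_ident)
    then show "filterlim (\<lambda>t. t / \<eta>) at_top at_top" by (simp add: field_simps)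
  qed
  moreover have "strict_mono_on {0<..} (\<lambda>t. G (t / \<eta>) u)" if "u \<in> unit_sphere" for u
    using \<eta> that by (auto simp: strict_mono_on_def divide_strict_right_mono intro!: class_G_I_D(3)[OF G])
  ultimately show ?thesis
    using \<eta> class_G_I_D(2)[OF G] by (auto simp: class_G_I_def case_prod_unfold)
qed

text \<open>\<open>\<eta>\<close> is the homogeneous dual volume of the unit ball. A polar body
  shares this value iff its radial function divided by \<open>\<eta>\<close> gives the integral 1,
  and the constant radial function of the ball gives 1 as well; so the constraint equates two
  integrals of the rescaled \<open>G\<close>.\<close>

lemma B_hat_eq_B_tilde:
  fixes G :: "real \<Rightarrow> 'a::euclidean_space \<Rightarrow> real"
  assumes dim: "DIM('a) \<ge> 2" and G: "G \<in> class_G_I"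
  obtains \<eta> where "\<eta> > 0" "B_hat G = B_tilde (\<lambda>t u. G (t / \<eta>) u)"
proof -
  note mass = spherical_measure_pos[OF dim]
  interpret B: level_setting \<sigma> G 1 "\<lambda>_. 1"
    by unfold_locales (use finite_borel_on_sphere_spherical_measure mass G in auto)
  define \<eta> where "\<eta> = level \<sigma> G 1 (\<lambda>_. 1)"
  have \<eta>: "\<eta> > 0" unfolding \<eta>_def by (rule B.level_pos)
  have ball: "hom_dual_volume G (cball 0 1) = \<eta>"
    unfolding hom_dual_volume_def \<eta>_def level_def
    by (intro arg_cong[of _ _ Inf] Collect_cong conj_cong refl arg_cong[of _ _ "\<lambda>x. x \<le> 1"]
        integral_cong_sphere[OF finite_borel_on_sphere_spherical_measure]) (simp only: radial_fun_cball)
  have "Q \<in> B_hat G \<longleftrightarrow> Q \<in> B_tilde (\<lambda>t u. G (t / \<eta>) u)" for Q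
  proof (cases "Q \<in> convex_bodies_o")
    case True
    interpret Q: level_setting \<sigma> G 1 "\<lambda>u. 1 / support_fun Q u"
      by unfold_locales
        (use finite_borel_on_sphere_spherical_measure mass G True support_fun_pos[OF True] continuous_on_support_fun[OF True] in
          \<open>auto intro!: continuous_intros simp: less_imp_neq[symmetric]\<close>)
    have "hom_dual_volume G (polar_body Q) = level \<sigma> G 1 (\<lambda>u. 1 / support_fun Q u)"
      unfolding hom_dual_volume_def level_def
      by (intro arg_cong[of _ _ Inf] Collect_cong conj_cong refl arg_cong[of _ _ "\<lambda>x. x \<le> 1"]
        integral_cong_sphere[OF finite_borel_on_sphere_spherical_measure]) (simp only: radial_fun_polar_body[OF True])
    moreover have "level \<sigma> G 1 (\<lambda>u. 1 / support_fun Q u) = \<eta>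
        \<longleftrightarrow> (\<integral>u. G (1 / support_fun Q u / \<eta>) u \<partial>\<sigma>) = 1"
      using Q.integral_level Q.level_eqI[OF \<eta>] by blast
    moreover have "(\<integral>u. G (1 / \<eta>) u \<partial>\<sigma>) = 1" using B.integral_level by (simp add: \<eta>_def)
    ultimately show ?thesis using True ball by (simp add: B_hat_def B_tilde_iff)
  next
    case False
    then show ?thesis by (simp add: B_hat_def B_tilde_iff)
  qed
  then show ?thesis using that[OF \<eta>] by blast
qed

section \<open>Compactness of minimizers\<close>

text \<open>The simple function with value \<open>b i\<close> on the cap of index \<open>i\<close>
  lies below \<open>f\<close>. A single cap serves for strict monotonicity, dyadic caps for the
  blow-up of the dual volume.\<close>

lemma integral_ge_disjoint_caps:
  fixes f :: "'a::euclidean_space \<Rightarrow> real"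
  assumes \<nu>: "finite_borel_on_sphere \<nu>" and f: "continuous_on unit_sphere f" "\<And>u. u \<in> unit_sphere \<Longrightarrow> 0 \<le> f u"
    and I: "finite I" "disjoint_family_on (\<lambda>i. unit_sphere \<inter> ball (w i) (r i)) I"
    and b: "\<And>i u. i \<in> I \<Longrightarrow> u \<in> unit_sphere \<inter> ball (w i) (r i) \<Longrightarrow> b i \<le> f u"
  shows "(\<Sum>i\<in>I. b i * measure \<nu> (unit_sphere \<inter> ball (w i) (r i))) \<le> (\<integral>u. f u \<partial>\<nu>)"
proof -
  interpret finite_measure \<nu> using \<nu> by (simp add: finite_borel_on_sphere_def)
  let ?A = "\<lambda>i. unit_sphere \<inter> ball (w i) (r i)"
  have A: "?A i \<in> sets \<nu>" for i
    using \<nu> by (auto simp: finite_borel_on_sphere_def sets_restrict_space intro!: image_eqI[of _ _ "ball (w i) (r i)"])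
  have int: "integrable \<nu> (\<lambda>u. b i * indicator (?A i) u)" for i
    using A by (intro integrable_mult_right integrable_real_indicator) (auto simp: emeasure_finite less_top[symmetric])
  have "(\<Sum>i\<in>I. b i * measure \<nu> (?A i)) = (\<Sum>i\<in>I. \<integral>u. b i * indicator (?A i) u \<partial>\<nu>)"
    by (intro sum.cong refl)
       (simp add: space_finite_borel_on_sphere[OF \<nu>] Int_absorb2 inf.commute inf.left_commute)
  also have "\<dots> = (\<integral>u. (\<Sum>i\<in>I. b i * indicator (?A i) u) \<partial>\<nu>)"
    using int by (intro Bochner_Integration.integral_sum[symmetric])
  also have "\<dots> \<le> (\<integral>u. f u \<partial>\<nu>)"
  proof (rule integral_mono)
    show "integrable \<nu> (\<lambda>u. \<Sum>i\<in>I. b i * indicator (?A i) u)"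
      using int by (intro Bochner_Integration.integrable_sum)
    show "integrable \<nu> f" using \<nu> f(1) by (rule integrable_continuous_on_sphere)
    fix u assume "u \<in> space \<nu>"
    then have u: "u \<in> unit_sphere" by (simp add: space_finite_borel_on_sphere[OF \<nu>])
    show "(\<Sum>i\<in>I. b i * indicator (?A i) u) \<le> f u"
    proof (cases "\<exists>i\<in>I. u \<in> ?A i")
      case True
      then obtain i where i: "i \<in> I" "u \<in> ?A i" by blast
      have "u \<notin> ?A j" if "j \<in> I - {i}" for j
        using I(2) i that unfolding disjoint_family_on_def by blast
      then have "(\<Sum>j\<in>I. b j * indicator (?A j) u) = (\<Sum>j\<in>I. if j = i then b i else 0)"
        using i by (intro sum.cong refl) auto
      also have "\<dots> = b i" using I(1) i by simp
      also have "\<dots> \<le> f u" using b i by blast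
      finally show ?thesis .
    next
      case False
      then have "(\<Sum>j\<in>I. b j * indicator (?A j) u) = 0" by (intro sum.neutral) auto
      then show ?thesis using f(2)[OF u] by simp
    qed
  qed
  finally show ?thesis .
qed

text \<open>In contrast to \<open>integral_less_sphere\<close>, strictness at one point suffices:
  continuity spreads it to a cap, and the spherical measure of every cap is positive.\<close>

lemma integral_strict_mono_spherical:
  fixes f g :: "'a::euclidean_space \<Rightarrow> real"
  assumes dim: "DIM('a) \<ge> 2"
    and fg: "continuous_on unit_sphere f" "continuous_on unit_sphere g"
    and le: "\<And>u. u \<in> unit_sphere \<Longrightarrow> f u \<le> g u" and u0: "u0 \<in> unit_sphere" "f u0 < g u0"
  shows "(\<integral>u. f u \<partial>\<sigma>) < (\<integral>u. g u \<partial>\<sigma>)"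
proof -
  define d where "d = g u0 - f u0"
  have d: "d > 0" using u0 by (simp add: d_def)
  have cont: "continuous_on unit_sphere (\<lambda>u. g u - f u)" using fg by (intro continuous_intros)
  then obtain r0 where r0: "r0 > 0" "\<And>u. u \<in> unit_sphere \<Longrightarrow> dist u u0 < r0 \<Longrightarrow> dist (g u - f u) (g u0 - f u0) < d / 2"
    using u0(1) d unfolding continuous_on_iff by (metis half_gt_zero)
  define r where "r = min r0 1"
  have r: "0 < r" "r \<le> 1" "r \<le> r0" using r0(1) by (auto simp: r_def)
  obtain c where c: "c > 0" "\<And>(w::'a) r. \<lbrakk>norm w = 1; 0 < r; r \<le> 1\<rbrakk> \<Longrightarrow>
      c * r ^ (DIM('a) - 1) \<le> measure \<sigma> (unit_sphere \<inter> ball w r)"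
    using spherical_measure_cap_ge[OF dim] by blast
  have "0 < c * r ^ (DIM('a) - 1)" using c(1) r by simp
  also have "\<dots> \<le> measure \<sigma> (unit_sphere \<inter> ball u0 r)" using u0(1) r by (intro c(2)) auto
  finally have "0 < d / 2 * measure \<sigma> (unit_sphere \<inter> ball u0 r)" using d by simp
  also have "\<dots> = (\<Sum>i\<in>{()}. d / 2 * measure \<sigma> (unit_sphere \<inter> ball u0 r))" by simp
  also have "\<dots> \<le> (\<integral>u. g u - f u \<partial>\<sigma>)"
  proof (rule integral_ge_disjoint_caps[OF finite_borel_on_sphere_spherical_measure cont])
    fix i u assume "u \<in> unit_sphere \<inter> ball u0 r"
    then have "dist (g u - f u) d < d / 2" using r0(2)[of u] r by (simp add: dist_commute d_def)
    then show "d / 2 \<le> g u - f u" unfolding dist_real_def by linarith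
  qed (use le in \<open>auto simp: disjoint_family_on_def\<close>)
  also have "\<dots> = (\<integral>u. g u \<partial>\<sigma>) - (\<integral>u. f u \<partial>\<sigma>)"
    using fg finite_borel_on_sphere_spherical_measure by (intro Bochner_Integration.integral_diff integrable_continuous_on_sphere)
  finally show ?thesis by simp
qed

section \<open>Uniform bounds from the hemisphere condition\<close>

lemma continuous_on_positive_part_inner:
  "continuous_on A (\<lambda>u. max 0 (u \<bullet> v) :: real)"
  by (intro continuous_intros)

lemma integral_positive_part_pos:
  fixes \<mu> :: "'a::euclidean_space measure"
  assumes \<mu>: "finite_borel_on_sphere \<mu>" "not_concentrated_on_closed_hemisphere \<mu>" and v: "v \<in> unit_sphere"
  shows "0 < (\<integral>u. max 0 (u \<bullet> v) \<partial>\<mu>)"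
proof -
  interpret finite_measure \<mu> using \<mu> by (simp add: finite_borel_on_sphere_def)
  have int: "integrable \<mu> (\<lambda>u. max 0 (u \<bullet> v))"
    by (intro integrable_continuous_on_sphere \<mu> continuous_on_positive_part_inner)
  have "(\<integral>u. max 0 (u \<bullet> v) \<partial>\<mu>) \<noteq> 0"
  proof
    assume "(\<integral>u. max 0 (u \<bullet> v) \<partial>\<mu>) = 0"
    then have "AE u in \<mu>. max 0 (u \<bullet> v) = 0"
      using integral_nonneg_eq_0_iff_AE[OF int] by simp
    then have "AE u in \<mu>. \<not> (u \<bullet> v > 0)" by eventually_elim (auto simp: max_def split: if_splits)
    then have "emeasure \<mu> {u \<in> space \<mu>. u \<bullet> v > 0} = 0" by (rule emeasure_eq_0_AE)
    then have "measure \<mu> {u \<in> unit_sphere. u \<bullet> v > 0} = 0"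
      by (simp add: measure_def space_finite_borel_on_sphere[OF \<mu>(1)])
    then show False using \<mu>(2) v unfolding not_concentrated_on_closed_hemisphere_def by force
  qed
  moreover have "0 \<le> (\<integral>u. max 0 (u \<bullet> v) \<partial>\<mu>)" by (rule integral_nonneg_AE) simp
  ultimately show ?thesis by (simp only: less_le) simp
qed

text \<open>Otherwise there are indices \<open>k n \<ge> n\<close> and directions \<open>v n\<close>
  whose integrals tend to 0. A limit direction \<open>v0\<close> then has vanishing integral with
  respect to \<open>\<mu>\<close>, since the integrands converge uniformly while the measures
  converge weakly.\<close>

lemma integral_positive_part_uniform:
  fixes \<mu> :: "'a::euclidean_space measure"
  assumes w: "weakly_converges_on_sphere \<mu>s \<mu>"
    and \<mu>: "\<And>i. finite_borel_on_sphere (\<mu>s i)" "finite_borel_on_sphere \<mu>"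
      "not_concentrated_on_closed_hemisphere \<mu>"
  obtains b where "b > 0" "eventually (\<lambda>i. \<forall>v\<in>unit_sphere. b \<le> (\<integral>u. max 0 (u \<bullet> v) \<partial>\<mu>s i)) sequentially"
proof -
  let ?F = "\<lambda>i v. \<integral>u. max 0 (u \<bullet> v) \<partial>\<mu>s i"
  have "\<exists>b>0. eventually (\<lambda>i. \<forall>v\<in>unit_sphere. b \<le> ?F i v) sequentially"
  proof (rule ccontr)
    assume neg: "\<not> ?thesis"
    have "\<exists>i v. i \<ge> n \<and> v \<in> unit_sphere \<and> ?F i v < inverse (real (Suc n))" for n
    proof -
      have "inverse (real (Suc n)) > 0" by simp
      then have "\<not> eventually (\<lambda>i. \<forall>v\<in>unit_sphere. inverse (real (Suc n)) \<le> ?F i v) sequentially"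
        using neg by blast
      then show ?thesis unfolding eventually_sequentially not_all not_ex by (simp only: not_le bex_simps ball_simps not_all not_imp Ball_def) blast
    qed
    then obtain k v where k: "\<And>n. k n \<ge> n" and v: "\<And>n. v n \<in> unit_sphere"
      and less: "\<And>n. ?F (k n) (v n) < inverse (real (Suc n))" by metis
    obtain v0 r where v0: "v0 \<in> unit_sphere" and r: "strict_mono (r :: nat \<Rightarrow> nat)" and lim: "(v \<circ> r) \<longlonglongrightarrow> v0"
      using compact_sphere[of "0::'a" 1] v unfolding compact_def by blast
    have kr: "filterlim (\<lambda>n. k (r n)) at_top sequentially"
      unfolding filterlim_at_top
    proof (intro allI, unfold eventually_sequentially, intro exI allI impI)
      fix Z n :: nat assume "Z \<le> n"
      then show "Z \<le> k (r n)" using seq_suble[OF r, of n] k[of "r n"] by linarith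
    qed
    have unif: "uniform_limit unit_sphere (\<lambda>n u. max 0 (u \<bullet> v (r n))) (\<lambda>u. max 0 (u \<bullet> v0)) sequentially"
    proof (rule uniform_limitI)
      fix e :: real assume "e > 0"
      from tendstoD[OF lim this]
      show "eventually (\<lambda>n. \<forall>u\<in>unit_sphere. dist (max 0 (u \<bullet> v (r n))) (max 0 (u \<bullet> v0)) < e) sequentially"
      proof eventually_elim
        case (elim n)
        show ?case
        proof
          fix u :: 'a assume u: "u \<in> unit_sphere"
          have "dist (max 0 (u \<bullet> v (r n))) (max 0 (u \<bullet> v0)) \<le> \<bar>u \<bullet> (v (r n) - v0)\<bar>"
            by (auto simp: dist_real_def inner_diff_right max_def abs_le_iff)
          also have "\<dots> \<le> norm u * norm (v (r n) - v0)" by (rule Cauchy_Schwarz_ineq2)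
          also have "\<dots> < e" using elim u by (simp add: dist_norm)
          finally show "dist (max 0 (u \<bullet> v (r n))) (max 0 (u \<bullet> v0)) < e" .
        qed
      qed
    qed
    have "(\<lambda>n. ?F (k (r n)) (v (r n))) \<longlonglongrightarrow> (\<integral>u. max 0 (u \<bullet> v0) \<partial>\<mu>)"
      by (rule tendsto_integral_weak_uniform[OF weakly_converges_filterlim[OF w kr] \<mu>(1,2)
            continuous_on_positive_part_inner continuous_on_positive_part_inner unif])
    moreover have "(\<lambda>n. inverse (real (Suc (r n)))) \<longlonglongrightarrow> 0"
      using LIMSEQ_subseq_LIMSEQ[OF LIMSEQ_inverse_real_of_nat r] by (simp add: comp_def)
    ultimately have "(\<integral>u. max 0 (u \<bullet> v0) \<partial>\<mu>) \<le> 0"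
      by (rule LIMSEQ_le) (use less in \<open>auto intro: less_imp_le\<close>)
    then show False using integral_positive_part_pos[OF \<mu>(2,3) v0] by simp
  qed
  then show ?thesis using that by blast
qed

text \<open>A point \<open>s *\<^sub>R v\<close> of \<open>Q i\<close> forces the support function
  to be at least \<open>s * a\<close> where \<open>u \<bullet> v > a\<close>. The continuous
  function \<open>max 0 (u \<bullet> v) - a\<close> lies below the indicator of that set, and its
  integral is at least \<open>b / 2\<close> for late \<open>i\<close>; for large \<open>s\<close>
  the value \<open>\<phi> (s * a)\<close> then exceeds what \<open>le\<close> permits.\<close>

lemma bodies_uniformly_bounded:
  fixes \<mu> :: "'a::euclidean_space measure"
  assumes w: "weakly_converges_on_sphere \<mu>s \<mu>"
    and \<mu>: "\<And>i. finite_borel_on_sphere (\<mu>s i)" "finite_borel_on_sphere \<mu>"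
      "not_concentrated_on_closed_hemisphere \<mu>"
    and \<phi>: "\<phi> \<in> class_I"
    and Q: "\<And>i. Q i \<in> convex_bodies_o"
    and le: "\<And>i. (\<integral>u. \<phi> (support_fun (Q i) u) \<partial>\<mu>s i) \<le> measure (\<mu>s i) unit_sphere"
  obtains R where "R > 0" "\<And>i. Q i \<subseteq> cball 0 R"
proof -
  note \<Phi> = class_I_class_G_I[OF \<phi>, where 'a='a]
  note \<phi>D = class_G_I_D[OF \<Phi>]
  obtain e where e: "e \<in> (unit_sphere :: 'a set)" by (metis all_not_in_conv sphere_eq_empty zero_le_one not_less)
  obtain b where b: "b > 0" "eventually (\<lambda>i. \<forall>v\<in>unit_sphere. b \<le> (\<integral>u. max 0 (u \<bullet> v) \<partial>\<mu>s i)) sequentially"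
    using integral_positive_part_uniform[OF w \<mu>] by blast
  define m where "m = measure \<mu> unit_sphere + 1"
  have m: "m > 0" by (simp add: m_def add_nonneg_pos)
  \<comment> \<open>Subtracting the threshold \<open>a\<close> costs at most \<open>a * m\<close> in
    the integral, half of the available \<open>b\<close>.\<close>
  define a where "a = b / (2 * m)"
  have a: "a > 0" "a * m = b / 2" using b m by (auto simp: a_def)
  \<comment> \<open>\<open>t0\<close> makes \<open>\<phi> (s * a) * (b / 2)\<close> exceed the mass
    bound \<open>m\<close> once \<open>s * a \<ge> t0\<close>.\<close>
  obtain t0 where t0: "t0 > 0" "\<And>t. t \<ge> t0 \<Longrightarrow> 2 * m / b < \<phi> t"
    using class_G_I_large[OF \<Phi>] e by metis
  have "eventually (\<lambda>i. measure (\<mu>s i) unit_sphere < m) sequentially"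
    by (rule order_tendstoD(2)[OF weakly_converges_mass[OF w \<mu>(1,2)]]) (simp add: m_def)
  then have "eventually (\<lambda>i. Q i \<subseteq> cball 0 (t0 / a)) sequentially"
    using b(2)
  proof eventually_elim
    case (elim i)
    show ?case
    proof (rule ccontr)
      assume "\<not> ?thesis"
      then obtain x where x: "x \<in> Q i" "norm x > t0 / a" by (auto simp: subset_iff not_le)
      define s where "s = norm x"
      have s: "s > 0" "s * a \<ge> t0" using x(2) t0(1) a(1) by (auto simp: s_def field_simps intro: less_trans[of 0 "t0/a"])
      define v where "v = x /\<^sub>R s"
      have v: "v \<in> unit_sphere" "x = s *\<^sub>R v" using s by (auto simp: v_def s_def)
      have \<phi>a: "2 * m / b < \<phi> (s * a)" using t0(2) s by simp
      have "\<phi> (s * a) * (b / 2) \<le> \<phi> (s * a) * ((\<integral>u. max 0 (u \<bullet> v) \<partial>\<mu>s i) - a * measure (\<mu>s i) unit_sphere)"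
      proof (rule mult_left_mono)
        have "a * measure (\<mu>s i) unit_sphere \<le> a * m" using elim(1) a(1) by (intro mult_left_mono) auto
        then show "b / 2 \<le> (\<integral>u. max 0 (u \<bullet> v) \<partial>\<mu>s i) - a * measure (\<mu>s i) unit_sphere"
          using elim(2) v a(2) by fastforce
        show "0 \<le> \<phi> (s * a)" using \<phi>D(2)[of "s * a" e] e s a by (simp add: less_imp_le)
      qed
      also have "\<dots> = (\<integral>u. \<phi> (s * a) * (max 0 (u \<bullet> v) - a) \<partial>\<mu>s i)"
      proof -
        have int: "integrable (\<mu>s i) (\<lambda>u. max 0 (u \<bullet> v))" "integrable (\<mu>s i) (\<lambda>u. a)"
          by (intro integrable_continuous_on_sphere \<mu> continuous_on_positive_part_inner continuous_on_const)+
        show ?thesis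
          by (subst integral_mult_right_zero, subst Bochner_Integration.integral_diff[OF int])
             (simp only: integral_const_sphere[OF \<mu>(1)])
      qed
      also have "\<dots> \<le> (\<integral>u. \<phi> (support_fun (Q i) u) \<partial>\<mu>s i)"
      proof (rule integral_mono_sphere[OF \<mu>(1)])
        show "continuous_on unit_sphere (\<lambda>u. \<phi> (s * a) * (max 0 (u \<bullet> v) - a))"
          by (intro continuous_intros)
        show "continuous_on unit_sphere (\<lambda>u. \<phi> (support_fun (Q i) u))"
          using \<Phi> continuous_on_support_fun[OF Q] support_fun_pos[OF Q] by (rule continuous_on_class_G_I)
        fix u :: 'a assume u: "u \<in> unit_sphere"
        have h: "support_fun (Q i) u > 0" by (rule support_fun_pos[OF Q u])
        have pos: "\<phi> (support_fun (Q i) u) > 0" "\<phi> (s * a) > 0" using \<phi>D(2) h u s a by auto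
        show "\<phi> (s * a) * (max 0 (u \<bullet> v) - a) \<le> \<phi> (support_fun (Q i) u)"
        proof (cases "u \<bullet> v \<le> a")
          case True
          then have "\<phi> (s * a) * (max 0 (u \<bullet> v) - a) \<le> 0" using pos a(1) by (intro mult_nonneg_nonpos) auto
          then show ?thesis using pos by simp
        next
          case False
          have "s * a \<le> s * (u \<bullet> v)" using False s by (intro mult_left_mono) auto
          also have "\<dots> = x \<bullet> u" using v(2) by (simp add: inner_commute)
          also have "\<dots> \<le> support_fun (Q i) u" by (rule support_fun_ge[OF convex_bodies_oD(5)[OF Q] x(1)])
          finally have "\<phi> (s * a) \<le> \<phi> (support_fun (Q i) u)" using \<phi>D(4) s a u by simp
          moreover have "max 0 (u \<bullet> v) - a \<le> 1"
            using norm_cauchy_schwarz[of u v] u v a(1) by simp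
          then have "\<phi> (s * a) * (max 0 (u \<bullet> v) - a) \<le> \<phi> (s * a) * 1"
            using pos by (intro mult_left_mono) auto
          ultimately show ?thesis by simp
        qed
      qed
      also have "\<dots> \<le> measure (\<mu>s i) unit_sphere" by (rule le)
      also have "\<dots> < m" by (rule elim(1))
      finally have "\<phi> (s * a) * (b / 2) < m" .
      moreover have "m < \<phi> (s * a) * (b / 2)" using \<phi>a b(1) by (simp add: field_simps)
      ultimately show False by simp
    qed
  qed
  then obtain N where N: "\<And>i. i \<ge> N \<Longrightarrow> Q i \<subseteq> cball 0 (t0 / a)" by (auto simp: eventually_sequentially)
  \<comment> \<open>The bound so far holds for late indices only; the finitely many remaining bodies
    are bounded individually.\<close>
  have "bounded (\<Union>i<N. Q i)" using convex_bodies_oD(5)[OF Q] by auto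
  then obtain R where R: "R > 0" "\<And>x. x \<in> (\<Union>i<N. Q i) \<Longrightarrow> norm x \<le> R" unfolding bounded_pos by blast
  show ?thesis
  proof (rule that[of "max R (t0 / a)"])
    show "max R (t0 / a) > 0" using R(1) by simp
    fix i
    show "Q i \<subseteq> cball 0 (max R (t0 / a))"
    proof (cases "i < N")
      case True
      then show ?thesis using R(2) by (force simp: le_max_iff_disj)
    next
      case False
      then have "Q i \<subseteq> cball 0 (t0 / a)" by (intro N) simp
      then show ?thesis by (rule order_trans) auto
    qed
  qed
qed

section \<open>Blow-up of the dual volume and existence of limit bodies\<close>

text \<open>
  The hypothesis that \<open>q\<close> is at least \<open>n - 1\<close> enters here: the caps of radius comparable to
  their distance \<open>1 / 2 ^ k\<close> from \<open>v\<close> all contribute comparably to the integral of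
  \<open>norm (u - v) powr (1 - n)\<close>, which therefore diverges.
\<close>

lemma dual_volume_blowup:
  fixes G :: "real \<Rightarrow> 'a::euclidean_space \<Rightarrow> real"
  assumes dim: "DIM('a) \<ge> 2" and G: "G \<in> class_G_I"
    and growth: "c > 0" "\<And>t u. t \<ge> 1 \<Longrightarrow> u \<in> unit_sphere \<Longrightarrow> c * t ^ (DIM('a) - 1) \<le> G t u"
    and R: "R > 0"
  shows "\<exists>\<epsilon>>0. \<forall>f. \<forall>v\<in>unit_sphere. continuous_on unit_sphere f \<and>
    (\<forall>u\<in>unit_sphere. 0 < f u \<and> f u \<le> \<epsilon> + R * norm (u - v)) \<longrightarrow> T < (\<integral>u. G (1 / f u) u \<partial>\<sigma>)"
proof -
  let ?p = "DIM('a) - 1"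
  obtain c' where c': "c' > 0" "\<And>(w::'a) r. \<lbrakk>norm w = 1; 0 < r; r \<le> 1\<rbrakk> \<Longrightarrow>
      c' * r ^ ?p \<le> measure \<sigma> (unit_sphere \<inter> ball w r)"
    using spherical_measure_cap_ge[OF dim] by blast
  \<comment> \<open>Lower bound for the contribution of one cap: the powers of
    \<open>\<rho> k\<close> in the integrand and in the measure of the cap cancel.\<close>
  define \<gamma> where "\<gamma> = c * c' / (12 * R) ^ ?p"
  have p12: "(12::real) ^ ?p = 3 ^ ?p * 4 ^ ?p" by (simp flip: power_mult_distrib)
  have \<gamma>: "\<gamma> > 0" using growth(1) c'(1) R by (simp add: \<gamma>_def)
  obtain N where N: "T < real N * \<gamma>" using reals_Archimedean3[OF \<gamma>] by blast
  \<comment> \<open>Starting at \<open>k0\<close> ensures \<open>3 * R * \<rho> k \<le> 1\<close>,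
    so that \<open>1 / f u \<ge> 1\<close> on the caps and the growth bound applies.\<close>
  obtain k0 where k0: "3 * R < 2 ^ k0" using real_arch_pow[of 2 "3 * R"] by auto
  define \<rho> where "\<rho> k = 1 / (2::real) ^ k" for k :: nat
  have \<rho>: "\<rho> k > 0" "\<rho> k \<le> 1" for k by (auto simp: \<rho>_def)
  have \<rho>mono: "j \<le> k \<Longrightarrow> \<rho> k \<le> \<rho> j" for j k
    by (simp add: \<rho>_def frac_le power_increasing)
  have \<rho>half: "\<rho> k \<le> \<rho> j / 2" if "j < k" for j k
    using \<rho>mono[of "Suc j" k] that by (simp add: \<rho>_def)
  let ?I = "{k0..<k0 + N}"
  show ?thesis
  \<comment> \<open>This \<open>\<epsilon>\<close> is at most \<open>R * \<rho> k\<close> for every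
    \<open>k\<close> in \<open>?I\<close>, so on all caps in play \<open>f\<close> stays below
    \<open>3 * R * \<rho> k\<close>.\<close>
  proof (intro exI[of _ "R * \<rho> (k0 + N)"] conjI allI ballI impI)
    show "R * \<rho> (k0 + N) > 0" using R \<rho> by simp
    fix f and v :: 'a
    assume v: "v \<in> unit_sphere" and *: "continuous_on unit_sphere f \<and>
      (\<forall>u\<in>unit_sphere. 0 < f u \<and> f u \<le> R * \<rho> (k0 + N) + R * norm (u - v))"
    have f: "continuous_on unit_sphere f" "\<And>u. u \<in> unit_sphere \<Longrightarrow> f u > 0"
      and bd: "\<And>u. u \<in> unit_sphere \<Longrightarrow> f u \<le> R * \<rho> (k0 + N) + R * norm (u - v)"
      using * by blast+
    \<comment> \<open>The distance to \<open>v\<close> takes all values in \<open>[0, 2]\<close>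
      between \<open>v\<close> and \<open>- v\<close>, the sphere being connected in dimension at
      least 2.\<close>
    have "\<exists>w\<in>unit_sphere. norm (w - v) = \<rho> k" for k
    proof -
      have "connected (unit_sphere :: 'a set)" using dim by (intro connected_sphere) auto
      then have conn: "connected ((\<lambda>w. norm (w - v)) ` unit_sphere)"
        by (intro connected_continuous_image continuous_intros)
      have "0 \<in> (\<lambda>w. norm (w - v)) ` unit_sphere" using v by (intro image_eqI[of _ _ v]) auto
      moreover have "2 \<in> (\<lambda>w. norm (w - v)) ` unit_sphere"
        using v norm_scaleR[of "-2" v] by (intro image_eqI[of _ _ "- v"]) (auto simp: scaleR_2)
      moreover have "\<rho> k \<in> {0..2}" using \<rho>[of k] by simp
      ultimately have "\<rho> k \<in> (\<lambda>w. norm (w - v)) ` unit_sphere"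
        using connected_contains_Icc[OF conn] by blast
      then show ?thesis by auto
    qed
    then obtain w where w: "\<And>k. w k \<in> unit_sphere" "\<And>k. norm (w k - v) = \<rho> k" by metis
    have cap: "3/4 * \<rho> k < norm (u - v)" "norm (u - v) < 5/4 * \<rho> k"
      if "u \<in> unit_sphere \<inter> ball (w k) (\<rho> k / 4)" for u k
    proof -
      have "norm (w k - u) < \<rho> k / 4" using that by (simp add: dist_norm)
      then show "3/4 * \<rho> k < norm (u - v)" "norm (u - v) < 5/4 * \<rho> k"
        using w(2)[of k] norm_triangle_ineq[of "w k - u" "u - v"] norm_triangle_ineq[of "u - w k" "w k - v"]
        by (auto simp: norm_minus_commute)
    qed
    \<comment> \<open>The distance to \<open>v\<close> tells the caps apart:
      \<open>5/4 * \<rho> k \<le> 5/8 * \<rho> j < 3/4 * \<rho> j\<close>.\<close>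
    have disj: "(unit_sphere \<inter> ball (w j) (\<rho> j / 4)) \<inter> (unit_sphere \<inter> ball (w k) (\<rho> k / 4)) = {}"
      if "j < k" for j k
      using cap[of _ j] cap[of _ k] \<rho>half[OF that] \<rho>(1)[of j] by fastforce
    have "real N * \<gamma> = (\<Sum>k\<in>?I. \<gamma>)" by simp
    also have "\<dots> \<le> (\<Sum>k\<in>?I. c * (1 / (3 * R * \<rho> k)) ^ ?p * measure \<sigma> (unit_sphere \<inter> ball (w k) (\<rho> k / 4)))"
    proof (rule sum_mono)
      fix k
      have "\<gamma> = c * (1 / (3 * R * \<rho> k)) ^ ?p * (c' * (\<rho> k / 4) ^ ?p)"
        using \<rho>(1)[of k] R by (simp add: \<gamma>_def power_divide power_mult_distrib p12[simplified])
      also have "\<dots> \<le> c * (1 / (3 * R * \<rho> k)) ^ ?p * measure \<sigma> (unit_sphere \<inter> ball (w k) (\<rho> k / 4))"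
        using w(1)[of k] \<rho>[of k] R growth(1) by (intro mult_left_mono c'(2)) auto
      finally show "\<gamma> \<le> c * (1 / (3 * R * \<rho> k)) ^ ?p * measure \<sigma> (unit_sphere \<inter> ball (w k) (\<rho> k / 4))" .
    qed
    also have "\<dots> \<le> (\<integral>u. G (1 / f u) u \<partial>\<sigma>)"
    proof (rule integral_ge_disjoint_caps[OF finite_borel_on_sphere_spherical_measure])
      show "continuous_on unit_sphere (\<lambda>u. G (1 / f u) u)"
        by (rule continuous_on_class_G_I[OF G])
          (use f in \<open>auto intro!: continuous_intros simp: less_imp_neq[symmetric]\<close>)
      show "0 \<le> G (1 / f u) u" if "u \<in> unit_sphere" for u
        using class_G_I_D(2)[OF G] f(2) that by (simp add: less_imp_le)
      show "disjoint_family_on (\<lambda>k. unit_sphere \<inter> ball (w k) (\<rho> k / 4)) ?I"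
        unfolding disjoint_family_on_def
      proof (intro ballI impI)
        fix j k :: nat assume "j \<noteq> k"
        then consider "j < k" | "k < j" by linarith
        then show "(unit_sphere \<inter> ball (w j) (\<rho> j / 4)) \<inter> (unit_sphere \<inter> ball (w k) (\<rho> k / 4)) = {}"
          by cases (use disj[of j k] disj[of k j] in blast)+
      qed
      fix k u assume k: "k \<in> ?I" and u: "u \<in> unit_sphere \<inter> ball (w k) (\<rho> k / 4)"
      have "f u \<le> R * \<rho> (k0 + N) + R * norm (u - v)" using bd u by blast
      also have "\<dots> \<le> R * \<rho> k + R * (5/4 * \<rho> k)"
        using cap(2)[OF u] \<rho>mono[of k "k0 + N"] k R by (intro add_mono mult_left_mono) auto
      also have "\<dots> \<le> 3 * R * \<rho> k" using R \<rho>(1)[of k] by simp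
      finally have fu: "f u \<le> 3 * R * \<rho> k" .
      have f0: "f u > 0" using f(2) u by blast
      have "3 * R * \<rho> k \<le> 3 * R * \<rho> k0" using k R by (intro mult_left_mono \<rho>mono) auto
      also have "\<dots> \<le> 1" using k0 by (simp add: \<rho>_def)
      finally have one: "3 * R * \<rho> k \<le> 1" .
      have "c * (1 / (3 * R * \<rho> k)) ^ ?p \<le> c * (1 / f u) ^ ?p"
        using fu f0 growth(1) R \<rho>(1)[of k] by (intro mult_left_mono power_mono frac_le) auto
      also have "\<dots> \<le> G (1 / f u) u" using fu one f0 u by (intro growth(2)) auto
      finally show "c * (1 / (3 * R * \<rho> k)) ^ ?p \<le> G (1 / f u) u" .
    qed simp
    finally show "T < (\<integral>u. G (1 / f u) u \<partial>\<sigma>)" using N by simp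
  qed
qed

text \<open>A form of Blaschke's selection theorem. The limit \<open>g\<close> may vanish somewhere
  and then belongs to no body with the origin inside; so a limit body is asserted under positivity
  only, which \<open>limit_in_B_tilde\<close> supplies from the constraint.\<close>

lemma support_fun_convergent_subseq:
  fixes Q :: "nat \<Rightarrow> 'a::euclidean_space set"
  assumes Q: "\<And>i. Q i \<in> convex_bodies_o" and R: "\<And>i. Q i \<subseteq> cball 0 R"
  obtains k g where "strict_mono k" "uniform_limit unit_sphere (\<lambda>n. support_fun (Q (k n))) g sequentially"
    "\<forall>u\<in>unit_sphere. 0 \<le> g u"
    "(\<forall>u\<in>unit_sphere. 0 < g u) \<longrightarrow> (\<exists>K\<in>convex_bodies_o. \<forall>u\<in>unit_sphere. support_fun K u = g u)"
proof -
  note DQ = convex_bodies_oD[OF Q]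
  note le_R = support_fun_upper[OF DQ(4) R]
  have R0: "R \<ge> 0" using DQ(3) R by fastforce
  obtain g k where g: "continuous_on (unit_sphere :: 'a set) g" and k: "strict_mono (k :: nat \<Rightarrow> nat)"
    and conv: "\<And>e. 0 < e \<Longrightarrow> \<exists>N. \<forall>n x. n \<ge> N \<and> x \<in> unit_sphere \<longrightarrow> norm (support_fun (Q (k n)) x - g x) < e"
  proof (rule Arzela_Ascoli[of "unit_sphere :: 'a set" "\<lambda>i. support_fun (Q i)" R])
    show "norm (support_fun (Q n) x) \<le> R" if "x \<in> unit_sphere" for n x
      using le_R[OF that] support_fun_pos[OF Q that] by (simp add: abs_le_iff less_imp_le order_trans[of _ 0])
    show "\<exists>d>0. \<forall>n y. y \<in> unit_sphere \<and> norm (x - y) < d \<longrightarrow> norm (support_fun (Q n) x - support_fun (Q n) y) < e"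
      if "e > 0" for x :: 'a and e :: real
    proof (intro exI[of _ "e / (R + 1)"] conjI allI impI)
      show "e / (R + 1) > 0" using that R0 by simp
      fix n y assume y: "y \<in> unit_sphere \<and> norm (x - y) < e / (R + 1)"
      have "norm (support_fun (Q n) x - support_fun (Q n) y) \<le> R * norm (x - y)"
        using support_fun_abs_diff_le[OF DQ(4) R] by simp
      also have "\<dots> \<le> (R + 1) * norm (x - y)" by (intro mult_right_mono) auto
      also have "\<dots> < e" using y R0 by (simp add: pos_less_divide_eq mult.commute)
      finally show "norm (support_fun (Q n) x - support_fun (Q n) y) < e" .
    qed
  qed auto
  have unif: "uniform_limit unit_sphere (\<lambda>n. support_fun (Q (k n))) g sequentially"
    unfolding uniform_limit_sequentially_iff dist_norm using conv by blast
  have pt: "(\<lambda>n. support_fun (Q (k n)) u) \<longlonglongrightarrow> g u" if "u \<in> unit_sphere" for u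
    using tendsto_uniform_limitI[OF unif that] .
  have g0: "0 \<le> g u" if "u \<in> unit_sphere" for u
    by (rule LIMSEQ_le_const[OF pt[OF that]]) (use support_fun_pos[OF Q that] in \<open>auto intro: less_imp_le\<close>)
  have gR: "g u \<le> R" if "u \<in> unit_sphere" for u
    by (rule LIMSEQ_le_const2[OF pt[OF that]]) (use le_R[OF that] in auto)
  have "\<exists>K\<in>convex_bodies_o. \<forall>u\<in>unit_sphere. support_fun K u = g u"
    if pos: "\<And>u. u \<in> unit_sphere \<Longrightarrow> 0 < g u"
  proof
    \<comment> \<open>The Wulff shape of \<open>g\<close>. Its support function is at most
      \<open>g\<close> on the sphere by construction, so equality is what remains.\<close>
    define K where "K = (\<Inter>u\<in>unit_sphere. {x. u \<bullet> x \<le> g u})"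
    have "closed K" unfolding K_def by (intro closed_INT ballI closed_halfspace_le)
    have "convex K" unfolding K_def by (intro convex_INT convex_halfspace_le)
    have KR: "K \<subseteq> cball 0 R"
    proof
      fix x assume x: "x \<in> K"
      show "x \<in> cball 0 R"
      proof (cases "x = 0")
        case False
        then have "x /\<^sub>R norm x \<in> unit_sphere" by simp
        then have "(x /\<^sub>R norm x) \<bullet> x \<le> R" using x gR unfolding K_def by (blast intro: order_trans)
        then show ?thesis using False by (simp add: dot_square_norm power2_eq_square field_simps)
      qed (use R0 in simp)
    qed
    have "compact K" using \<open>closed K\<close> KR by (meson bounded_cball bounded_subset compact_eq_bounded_closed)
    obtain m where m: "m > 0" "\<And>u. u \<in> unit_sphere \<Longrightarrow> m \<le> g u"
      using positive_on_sphere_lower_bound[OF g pos] by blast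
    have "cball 0 m \<subseteq> K"
    proof (clarsimp simp: K_def)
      fix x u :: 'a assume *: "norm x \<le> m" "norm u = 1"
      then show "u \<bullet> x \<le> g u" using norm_cauchy_schwarz[of u x] m(2)[of u] by simp
    qed
    then have "0 \<in> interior K" using m(1) mem_interior_cball by blast
    then show "K \<in> convex_bodies_o" using \<open>compact K\<close> \<open>convex K\<close> by (simp add: convex_bodies_o_def)
    show "\<forall>u\<in>unit_sphere. support_fun K u = g u"
    proof
      fix u :: 'a assume u: "u \<in> unit_sphere"
      \<comment> \<open>Points attaining the support values at \<open>u\<close> accumulate at a
        point of \<open>K\<close> where the half-space constraint for \<open>u\<close> is
        tight.\<close>
      have "\<exists>x. x \<in> Q (k n) \<and> support_fun (Q (k n)) u = x \<bullet> u" for n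
        using support_fun_attained[OF DQ(1,4)] by metis
      then obtain x where x: "\<And>n. x n \<in> Q (k n)" "\<And>n. support_fun (Q (k n)) u = x n \<bullet> u" by metis
      have "\<And>n. x n \<in> cball 0 R" using x(1) R by blast
      then obtain y r where r: "strict_mono (r :: nat \<Rightarrow> nat)" and lim: "(x \<circ> r) \<longlonglongrightarrow> y"
        using compact_cball[of "0::'a" R] unfolding compact_def by blast
      have lim': "(\<lambda>n. x (r n) \<bullet> z) \<longlonglongrightarrow> y \<bullet> z" for z
        using lim by (intro tendsto_intros) (simp add: comp_def)
      have pt': "(\<lambda>n. support_fun (Q (k (r n))) z) \<longlonglongrightarrow> g z" if "z \<in> unit_sphere" for z
        using LIMSEQ_subseq_LIMSEQ[OF pt[OF that] r] by (simp add: comp_def)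
      have "y \<bullet> z \<le> g z" if "z \<in> unit_sphere" for z
        by (rule LIMSEQ_le[OF lim' pt'[OF that]]) (use support_fun_ge[OF DQ(5) x(1)] in auto)
      then have yK: "y \<in> K" by (simp add: K_def inner_commute)
      have "y \<bullet> u = g u"
        using LIMSEQ_unique[OF lim'[of u]] pt'[OF u] x(2) by simp
      moreover have "support_fun K u = y \<bullet> u"
      proof (rule support_fun_eqI[OF _ yK])
        show "bounded K" using \<open>compact K\<close> by (rule compact_imp_bounded)
        show "z \<bullet> u \<le> y \<bullet> u" if "z \<in> K" for z
          using that u \<open>y \<bullet> u = g u\<close> by (simp add: K_def inner_commute)
      qed
      ultimately show "support_fun K u = g u" by simp
    qed
  qed
  then show ?thesis using that[OF k unif] g0 by blast
qed

lemma uniform_limit_inverse_support: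
  assumes unif: "uniform_limit unit_sphere (\<lambda>n. support_fun (Q n)) (support_fun K) sequentially"
    and K: "K \<in> convex_bodies_o"
  shows "uniform_limit unit_sphere (\<lambda>n u. 1 / support_fun (Q n) u) (\<lambda>u. 1 / support_fun K u) sequentially"
proof -
  obtain m where "m > 0" "\<And>u. u \<in> unit_sphere \<Longrightarrow> m \<le> support_fun K u"
    using positive_on_sphere_lower_bound[OF continuous_on_support_fun[OF K] support_fun_pos[OF K]] by blast
  then show ?thesis
    by (intro uniform_lim_divide[OF uniform_limit_const unif, where b=m])
       (auto intro: order_trans[OF _ abs_ge_self] finite_imp_bounded finite_subset[of _ "{1}"])
qed

lemma continuous_on_inverse_support_fun:
  assumes "K \<in> convex_bodies_o"
  shows "continuous_on unit_sphere (\<lambda>u. 1 / support_fun K u)"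
  using continuous_on_support_fun[OF assms] support_fun_pos[OF assms]
  by (intro continuous_on_divide continuous_on_const) (auto simp: less_imp_neq[symmetric])

text \<open>Positivity of the limit has to come first: only then do the reciprocals of the support
  functions converge uniformly, and with them the constraint passes to the limit.\<close>

lemma limit_in_B_tilde:
  fixes G :: "real \<Rightarrow> 'a::euclidean_space \<Rightarrow> real"
  assumes dim: "DIM('a) \<ge> 2" and G: "G \<in> class_G_I"
    and growth: "c > 0" "\<And>t u. t \<ge> 1 \<Longrightarrow> u \<in> unit_sphere \<Longrightarrow> c * t ^ (DIM('a) - 1) \<le> G t u"
    and Q: "\<And>i. Q i \<in> B_tilde G" and R: "R > 0" "\<And>i. Q i \<subseteq> cball 0 R"
  obtains k K where "strict_mono (k :: nat \<Rightarrow> nat)" "K \<in> B_tilde G"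
    "uniform_limit unit_sphere (\<lambda>n. support_fun (Q (k n))) (support_fun K) sequentially"
proof -
  have QK: "Q i \<in> convex_bodies_o" for i using Q by (simp add: B_tilde_iff)
  have QV: "(\<integral>u. G (1 / support_fun (Q i) u) u \<partial>\<sigma>) = (\<integral>u. G 1 u \<partial>\<sigma>)" for i
    using Q by (simp add: B_tilde_iff)
  obtain k g where k: "strict_mono (k :: nat \<Rightarrow> nat)"
    and unif: "uniform_limit unit_sphere (\<lambda>n. support_fun (Q (k n))) g sequentially"
    and g: "\<forall>u\<in>unit_sphere. 0 \<le> g u"
    and ex: "(\<forall>u\<in>unit_sphere. 0 < g u) \<longrightarrow> (\<exists>K\<in>convex_bodies_o. \<forall>u\<in>unit_sphere. support_fun K u = g u)"
    by (rule support_fun_convergent_subseq[OF QK R(2)]) (rule that)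
  have "0 < g v" if v: "v \<in> unit_sphere" for v
  proof (rule ccontr)
    assume "\<not> 0 < g v"
    then have gv: "g v = 0" using g v by force
    have "\<exists>\<epsilon>>0. \<forall>f. \<forall>v\<in>unit_sphere. continuous_on unit_sphere f \<and>
        (\<forall>u\<in>unit_sphere. 0 < f u \<and> f u \<le> \<epsilon> + R * norm (u - v)) \<longrightarrow>
        (\<integral>u. G 1 u \<partial>\<sigma>) < (\<integral>u. G (1 / f u) u \<partial>\<sigma>)"
      using dim G growth R(1) by (rule dual_volume_blowup)
    then obtain \<epsilon> where \<epsilon>: "\<epsilon> > 0" and blow: "\<forall>f. \<forall>v\<in>unit_sphere. continuous_on unit_sphere f \<and>
        (\<forall>u\<in>unit_sphere. 0 < f u \<and> f u \<le> \<epsilon> + R * norm (u - v)) \<longrightarrow>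
        (\<integral>u. G 1 u \<partial>\<sigma>) < (\<integral>u. G (1 / f u) u \<partial>\<sigma>)" by (elim exE conjE)
    have "(\<lambda>n. support_fun (Q (k n)) v) \<longlonglongrightarrow> 0"
      using tendsto_uniform_limitI[OF unif v] gv by simp
    then have "eventually (\<lambda>n. support_fun (Q (k n)) v < \<epsilon>) sequentially"
      using \<epsilon> by (intro order_tendstoD)
    then obtain n where n: "support_fun (Q (k n)) v < \<epsilon>" by (auto dest: eventually_happens)
    \<comment> \<open>A value below \<open>\<epsilon>\<close> at \<open>v\<close> puts the whole
      support function below \<open>\<epsilon> + R * norm (u - v)\<close> by the Lipschitz
      bound.\<close>
    have "(\<integral>u. G 1 u \<partial>\<sigma>) < (\<integral>u. G (1 / support_fun (Q (k n)) u) u \<partial>\<sigma>)"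
    proof (rule blow[rule_format, OF v], intro conjI ballI)
      show "continuous_on unit_sphere (support_fun (Q (k n)))" by (rule continuous_on_support_fun[OF QK])
      fix u :: 'a assume "u \<in> unit_sphere"
      then show "0 < support_fun (Q (k n)) u" by (rule support_fun_pos[OF QK])
      show "support_fun (Q (k n)) u \<le> \<epsilon> + R * norm (u - v)"
        using support_fun_lipschitz[OF convex_bodies_oD(4)[OF QK] R(2), of "k n" u v] n by simp
    qed
    then show False using QV by simp
  qed
  then obtain K where K: "K \<in> convex_bodies_o" "\<And>u. u \<in> unit_sphere \<Longrightarrow> support_fun K u = g u"
    using ex by blast
  have unif': "uniform_limit unit_sphere (\<lambda>n. support_fun (Q (k n))) (support_fun K) sequentially"
    using unif K(2) unfolding uniform_limit_iff by simp
  have "(\<lambda>n. \<integral>u. G (1 / support_fun (Q (k n)) u) u \<partial>\<sigma>) \<longlonglongrightarrow> (\<integral>u. G (1 / support_fun K u) u \<partial>\<sigma>)"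
    using support_fun_pos K(1) QK
    by (intro tendsto_integral_class_G_I[OF G weakly_converges_const finite_borel_on_sphere_spherical_measure finite_borel_on_sphere_spherical_measure]
        uniform_limit_inverse_support unif' continuous_on_inverse_support_fun) auto
  then have "(\<integral>u. G (1 / support_fun K u) u \<partial>\<sigma>) = (\<integral>u. G 1 u \<partial>\<sigma>)"
    unfolding QV by (simp add: LIMSEQ_const_iff)
  then have "K \<in> B_tilde G" using K(1) by (simp add: B_tilde_iff)
  then show ?thesis using that k unif' by blast
qed

section \<open>Properties of the Orlicz norm and uniqueness of minimizers\<close>

context
  fixes \<mu> :: "'a::euclidean_space measure" and \<phi> :: "real \<Rightarrow> real"
  assumes \<mu>: "finite_borel_on_sphere \<mu>" "measure \<mu> unit_sphere > 0" and \<phi>: "\<phi> \<in> class_I"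
begin

lemma level_setting_support_fun:
  "Q \<in> convex_bodies_o \<Longrightarrow> level_setting \<mu> (\<lambda>t u. \<phi> t) (measure \<mu> unit_sphere) (support_fun Q)"
  by unfold_locales
    (use \<mu> class_I_class_G_I[OF \<phi>] continuous_on_support_fun support_fun_pos in auto)

lemma orlicz_norm_pos: "Q \<in> convex_bodies_o \<Longrightarrow> 0 < orlicz_norm \<mu> \<phi> (support_fun Q)"
  using level_setting.level_pos[OF level_setting_support_fun] by (simp add: orlicz_norm_eq_level[OF \<mu>(2)])

lemma orlicz_norm_le_iff:
  "Q \<in> convex_bodies_o \<Longrightarrow> r > 0 \<Longrightarrow> orlicz_norm \<mu> \<phi> (support_fun Q) \<le> r
    \<longleftrightarrow> (\<integral>u. \<phi> (support_fun Q u / r) \<partial>\<mu>) \<le> measure \<mu> unit_sphere"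
  using level_setting.level_le_iff[OF level_setting_support_fun] by (simp add: orlicz_norm_eq_level[OF \<mu>(2)])

lemma orlicz_norm_integral:
  "Q \<in> convex_bodies_o \<Longrightarrow>
    (\<integral>u. \<phi> (support_fun Q u / orlicz_norm \<mu> \<phi> (support_fun Q)) \<partial>\<mu>) = measure \<mu> unit_sphere"
  using level_setting.integral_level[OF level_setting_support_fun] by (simp add: orlicz_norm_eq_level[OF \<mu>(2)])

text \<open>The normalisation \<open>\<phi> 1 = 1\<close> makes \<open>r = 1\<close> admissible for
  the unit ball.\<close>

lemma orlicz_norm_cball_le: "orlicz_norm \<mu> \<phi> (support_fun (cball 0 1)) \<le> 1"
proof -
  have "(\<integral>u. \<phi> (support_fun (cball 0 1) u / 1) \<partial>\<mu>) = (\<integral>u. 1 \<partial>\<mu>)"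
    using \<phi> by (intro integral_cong_sphere[OF \<mu>(1)]) (simp only: support_fun_cball class_I_def, simp)
  then show ?thesis
    using orlicz_norm_le_iff[OF cball_in_convex_bodies_o, of 1] by (simp only: integral_const_sphere[OF \<mu>(1)])
qed

lemma solves_min_problemD:
  assumes "solves_min_problem \<mu> \<phi> (B_tilde G) M"
  shows "M \<in> B_tilde G" and "\<And>Q. Q \<in> B_tilde G \<Longrightarrow> orlicz_norm \<mu> \<phi> (support_fun M) \<le> orlicz_norm \<mu> \<phi> (support_fun Q)"
proof -
  show "M \<in> B_tilde G" using assms by (simp add: solves_min_problem_def)
  fix Q assume "Q \<in> B_tilde G"
  \<comment> \<open>A real \<open>INF\<close> is a lower bound only over a set bounded below;
    positivity of the norms provides the bound 0.\<close>
  moreover have "bdd_below ((\<lambda>Q. orlicz_norm \<mu> \<phi> (support_fun Q)) ` B_tilde G)"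
    using orlicz_norm_pos by (intro bdd_belowI[of _ 0]) (auto simp: B_tilde_iff less_imp_le)
  ultimately show "orlicz_norm \<mu> \<phi> (support_fun M) \<le> orlicz_norm \<mu> \<phi> (support_fun Q)"
    using assms by (auto simp: solves_min_problem_def intro: cINF_lower)
qed

text \<open>
  The midpoint body has strictly smaller dual volume of its polar, by strict convexity of
  \<open>s \<mapsto> 1/s\<close>, hence it can be shrunk into the constraint set, which strictly decreases the norm.
\<close>

lemma minimizers_support_fun_eq:
  fixes G :: "real \<Rightarrow> 'a \<Rightarrow> real"
  assumes dim: "DIM('a) \<ge> 2" and G: "G \<in> class_G_I"
    and cvx: "convex_on {0<..} \<phi>" "\<And>u. u \<in> unit_sphere \<Longrightarrow> convex_on {0<..} (\<lambda>t. G t u)"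
    and P: "P \<in> B_tilde G" "orlicz_norm \<mu> \<phi> (support_fun P) = r"
    and Q: "Q \<in> B_tilde G" "orlicz_norm \<mu> \<phi> (support_fun Q) = r"
    and min: "\<And>X. X \<in> B_tilde G \<Longrightarrow> r \<le> orlicz_norm \<mu> \<phi> (support_fun X)"
    and u0: "u0 \<in> unit_sphere"
  shows "support_fun P u0 = support_fun Q u0"
proof (rule ccontr)
  assume neq: "support_fun P u0 \<noteq> support_fun Q u0"
  let ?p = "support_fun P" and ?q = "support_fun Q" and ?T = "\<integral>u. G 1 u \<partial>\<sigma>"
  have PK: "P \<in> convex_bodies_o" and QK: "Q \<in> convex_bodies_o"
    using P(1) Q(1) by (auto simp: B_tilde_iff)
  define Z where "Z = (\<lambda>(x, y). (1/2) *\<^sub>R (x + y)) ` (P \<times> Q)"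
  have ZK: "Z \<in> convex_bodies_o" and Z: "\<And>u. support_fun Z u = (?p u + ?q u) / 2"
    unfolding Z_def by (rule midpoint_convex_bodies_o[OF PK QK])+
  have r: "r > 0" using orlicz_norm_pos[OF PK] P(2) by simp
  have mid: "f ((x + y) / 2) \<le> (f x + f y) / 2" if "convex_on {0<..} f" "x > 0" "y > 0" for f :: "real \<Rightarrow> real" and x y
    using convex_onD[OF that(1), of "1/2" x y] that(2,3) by (simp add: field_simps)
  have harm: "1 / ((x + y) / 2) \<le> (1 / x + 1 / y) / 2" if "x > 0" "y > 0" for x y :: real
  proof -
    have "(1 / x + 1 / y) / 2 - 1 / ((x + y) / 2) = (x - y)\<^sup>2 / (2 * x * y * (x + y))"
      using that by (simp add: field_simps power2_eq_square)
    moreover have "(x - y)\<^sup>2 / (2 * x * y * (x + y)) \<ge> 0" using that by simp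
    ultimately show ?thesis by linarith
  qed
  have harm_strict: "1 / ((x + y) / 2) < (1 / x + 1 / y) / 2" if "x > 0" "y > 0" "x \<noteq> y" for x y :: real
  proof -
    have "(1 / x + 1 / y) / 2 - 1 / ((x + y) / 2) = (x - y)\<^sup>2 / (2 * x * y * (x + y))"
      using that by (simp add: field_simps power2_eq_square)
    moreover have "(x - y)\<^sup>2 / (2 * x * y * (x + y)) > 0" using that by simp
    ultimately show ?thesis by linarith
  qed
  let ?g = "\<lambda>u. (G (1 / ?p u) u + G (1 / ?q u) u) / 2"
  have conv_G: "G ((1 / ?p u + 1 / ?q u) / 2) u \<le> ?g u" if "u \<in> unit_sphere" for u
    using mid[OF cvx(2)[OF that], of "1 / ?p u" "1 / ?q u"] support_fun_pos[OF PK that] support_fun_pos[OF QK that]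
    by simp
  have contG: "continuous_on unit_sphere (\<lambda>u. G (1 / support_fun X u) u)" if "X \<in> convex_bodies_o" for X
    by (rule continuous_on_class_G_I[OF G continuous_on_inverse_support_fun[OF that]])
       (use support_fun_pos[OF that] in auto)
  \<comment> \<open>Strictness at \<open>u0\<close> comes from the inequality of harmonic and
    arithmetic mean and strict monotonicity of \<open>G\<close>; convexity of \<open>G\<close> then
    passes to the average.\<close>
  have "(\<integral>u. G (1 / support_fun Z u) u \<partial>\<sigma>) < (\<integral>u. ?g u \<partial>\<sigma>)"
  proof (rule integral_strict_mono_spherical[OF dim contG[OF ZK]])
    show "continuous_on unit_sphere ?g" using contG[OF PK] contG[OF QK] by (intro continuous_intros) auto
    show "G (1 / support_fun Z u) u \<le> ?g u" if u: "u \<in> unit_sphere" for u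
    proof -
      note pq = support_fun_pos[OF PK u] support_fun_pos[OF QK u]
      have "G (1 / support_fun Z u) u \<le> G ((1 / ?p u + 1 / ?q u) / 2) u"
        unfolding Z using harm[OF pq] pq u by (intro class_G_I_D(4)[OF G]) auto
      then show ?thesis using conv_G[OF u] by simp
    qed
    note pq = support_fun_pos[OF PK u0] support_fun_pos[OF QK u0]
    have "G (1 / support_fun Z u0) u0 < G ((1 / ?p u0 + 1 / ?q u0) / 2) u0"
      unfolding Z using harm_strict[OF pq neq] pq u0 by (intro class_G_I_D(3)[OF G]) auto
    then show "G (1 / support_fun Z u0) u0 < ?g u0" using conv_G[OF u0] by simp
  qed (rule u0)
  also have "\<dots> = ?T"
  proof -
    have "(\<integral>u. ?g u \<partial>\<sigma>) = ((\<integral>u. G (1 / ?p u) u \<partial>\<sigma>) + (\<integral>u. G (1 / ?q u) u \<partial>\<sigma>)) / 2"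
      using integrable_continuous_on_sphere[OF finite_borel_on_sphere_spherical_measure contG] PK QK by simp
    then show ?thesis using P(1) Q(1) by (simp add: B_tilde_iff)
  qed
  finally have less: "(\<integral>u. G (1 / support_fun Z u) u \<partial>\<sigma>) < ?T" .
  have "0 = (\<integral>u. (0::real) \<partial>(\<sigma> :: 'a measure))" by simp
  also have "\<dots> < ?T"
    using class_G_I_D(2)[OF G] continuous_on_class_G_I[OF G, of "\<lambda>_. 1"]
    by (intro integral_less_sphere[OF finite_borel_on_sphere_spherical_measure spherical_measure_pos[OF dim]]) auto
  finally have T: "?T > 0" .
  interpret Z: level_setting \<sigma> G ?T "\<lambda>u. 1 / support_fun Z u"
    by unfold_locales
      (use finite_borel_on_sphere_spherical_measure spherical_measure_pos[OF dim] G T continuous_on_inverse_support_fun[OF ZK] support_fun_pos[OF ZK] in auto)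
  \<comment> \<open>The factor by which \<open>Z\<close> has to be scaled to satisfy the constraint
    with equality; the deficit \<open>less\<close> puts it below 1.\<close>
  define t where "t = level \<sigma> G ?T (\<lambda>u. 1 / support_fun Z u)"
  have t0: "t > 0" unfolding t_def by (rule Z.level_pos)
  have t1: "t < 1" using Z.level_ge_iff[of 1] less by (simp add: t_def)
  let ?Y = "(\<lambda>x. t *\<^sub>R x) ` Z"
  have YK: "?Y \<in> convex_bodies_o" and Y: "\<And>u. support_fun ?Y u = t * support_fun Z u"
    by (rule scale_convex_bodies_o[OF ZK t0])+
  have "(\<integral>u. G (1 / support_fun ?Y u) u \<partial>\<sigma>) = (\<integral>u. G (1 / support_fun Z u / t) u \<partial>\<sigma>)"
    unfolding Y by (simp add: mult.commute)
  also have "\<dots> = ?T" unfolding t_def by (rule Z.integral_level)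
  finally have "?Y \<in> B_tilde G" using YK by (simp add: B_tilde_iff)
  then have "r \<le> orlicz_norm \<mu> \<phi> (support_fun ?Y)" by (rule min)
  \<comment> \<open>Convexity of \<open>\<phi>\<close> bounds the norm of \<open>Z\<close> by the
    common value \<open>r\<close> of \<open>P\<close> and \<open>Q\<close>, and scaling a body by
    \<open>t\<close> scales its norm by \<open>t\<close>.\<close>
  also have "\<dots> \<le> t * r"
  proof -
    note \<Phi> = class_I_class_G_I[OF \<phi>, where 'a='a]
    have cont\<phi>: "continuous_on unit_sphere (\<lambda>u. \<phi> (support_fun X u / r))" if "X \<in> convex_bodies_o" for X :: "'a set"
      by (rule continuous_on_class_G_I[OF \<Phi>])
        (use continuous_on_support_fun[OF that] support_fun_pos[OF that] r in \<open>auto intro!: continuous_intros\<close>)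
    have "(\<integral>u. \<phi> (support_fun ?Y u / (t * r)) \<partial>\<mu>) = (\<integral>u. \<phi> (support_fun Z u / r) \<partial>\<mu>)"
      unfolding Y using t0 by simp
    also have "\<dots> \<le> (\<integral>u. (\<phi> (?p u / r) + \<phi> (?q u / r)) / 2 \<partial>\<mu>)"
    proof (rule integral_mono_sphere[OF \<mu>(1) cont\<phi>[OF ZK]])
      show "continuous_on unit_sphere (\<lambda>u. (\<phi> (?p u / r) + \<phi> (?q u / r)) / 2)"
        using cont\<phi>[OF PK] cont\<phi>[OF QK] by (intro continuous_intros) auto
      fix u :: 'a assume u: "u \<in> unit_sphere"
      have "support_fun Z u / r = (?p u / r + ?q u / r) / 2" unfolding Z using r by (simp add: field_simps)
      moreover have "\<phi> ((?p u / r + ?q u / r) / 2) \<le> (\<phi> (?p u / r) + \<phi> (?q u / r)) / 2"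
        using r support_fun_pos[OF PK u] support_fun_pos[OF QK u] by (intro mid[OF cvx(1)]) auto
      ultimately show "\<phi> (support_fun Z u / r) \<le> (\<phi> (?p u / r) + \<phi> (?q u / r)) / 2" by (simp only:)
    qed
    also have "\<dots> = ((\<integral>u. \<phi> (?p u / r) \<partial>\<mu>) + (\<integral>u. \<phi> (?q u / r) \<partial>\<mu>)) / 2"
      using integrable_continuous_on_sphere[OF \<mu>(1) cont\<phi>] PK QK by simp
    also have "\<dots> = measure \<mu> unit_sphere"
      using orlicz_norm_integral[OF PK] orlicz_norm_integral[OF QK] P(2) Q(2) by simp
    finally show ?thesis using orlicz_norm_le_iff[OF YK, of "t * r"] t0 r by simp
  qed
  also have "\<dots> < 1 * r" using t1 r by (intro mult_strict_right_mono)
  finally show False by simp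
qed

end

section \<open>Stability of the minimizers\<close>

lemma tendsto_orlicz_norm:
  fixes \<mu> :: "'a::euclidean_space measure"
  assumes w: "weakly_converges_on_sphere \<mu>s \<mu>"
    and \<mu>: "\<And>i. finite_borel_on_sphere (\<mu>s i)" "finite_borel_on_sphere \<mu>"
      "\<And>i. measure (\<mu>s i) unit_sphere > 0" "measure \<mu> unit_sphere > 0"
    and \<phi>: "\<phi> \<in> class_I" and Q: "\<And>i. Q i \<in> convex_bodies_o" and K: "K \<in> convex_bodies_o"
    and unif: "uniform_limit unit_sphere (\<lambda>i. support_fun (Q i)) (support_fun K) sequentially"
  shows "(\<lambda>i. orlicz_norm (\<mu>s i) \<phi> (support_fun (Q i))) \<longlonglongrightarrow> orlicz_norm \<mu> \<phi> (support_fun K)"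
  unfolding orlicz_norm_eq_level[OF \<mu>(3)] orlicz_norm_eq_level[OF \<mu>(4)]
  by (rule tendsto_level[OF class_I_class_G_I[OF \<phi>] w \<mu> \<mu>(3,4) weakly_converges_mass[OF w \<mu>(1,2)]
        continuous_on_support_fun[OF K] support_fun_pos[OF K] continuous_on_support_fun[OF Q]
        support_fun_pos[OF Q] unif])

text \<open>Limit bodies come from compactness, along further subsequences of a given one; this
  recovers convergence of the full sequence.\<close>

lemma tendsto_if_subseq:
  fixes x :: "nat \<Rightarrow> 'b::metric_space"
  assumes sub: "\<And>r :: nat \<Rightarrow> nat. strict_mono r \<Longrightarrow> \<exists>k :: nat \<Rightarrow> nat. strict_mono k \<and> (\<lambda>n. x (r (k n))) \<longlonglongrightarrow> L"
  shows "x \<longlonglongrightarrow> L"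
proof (rule ccontr)
  assume "\<not> x \<longlonglongrightarrow> L"
  then obtain e where e: "e > 0" "\<not> eventually (\<lambda>n. dist (x n) L < e) sequentially"
    by (auto simp: tendsto_iff)
  then have "infinite {n. e \<le> dist (x n) L}"
    by (simp add: not_le frequently_cofinite[symmetric] cofinite_eq_sequentially frequently_def)
  then obtain r :: "nat \<Rightarrow> nat" where r: "strict_mono r" "\<And>n. r n \<in> {n. e \<le> dist (x n) L}"
    using infinite_enumerate by blast
  obtain k :: "nat \<Rightarrow> nat" where "(\<lambda>n. x (r (k n))) \<longlonglongrightarrow> L" using sub[OF r(1)] by blast
  then have "eventually (\<lambda>n. dist (x (r (k n))) L < e) sequentially" using e(1) by (rule tendstoD)
  then obtain n where "dist (x (r (k n))) L < e" by (auto dest: eventually_happens)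
  then show False using r(2)[of "k n"] by simp
qed

lemma hausdorff_dist_tendsto:
  fixes Q :: "nat \<Rightarrow> 'a::euclidean_space set"
  assumes unif: "uniform_limit unit_sphere (\<lambda>i. support_fun (Q i)) (support_fun K) sequentially"
    and Q: "\<And>i. Q i \<in> convex_bodies_o" "K \<in> convex_bodies_o"
  shows "(\<lambda>i. hausdorff_dist (Q i) K) \<longlonglongrightarrow> 0"
proof (rule tendstoI)
  fix e :: real assume e: "e > 0"
  obtain e0 :: 'a where e0: "e0 \<in> unit_sphere" by (metis all_not_in_conv sphere_eq_empty zero_le_one not_less)
  \<comment> \<open>Half of \<open>e\<close> leaves room, since a supremum of values below a bound
    may equal that bound.\<close>
  have "eventually (\<lambda>i. \<forall>u\<in>unit_sphere. dist (support_fun (Q i) u) (support_fun K u) < e / 2) sequentially"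
    using uniform_limitD[OF unif, of "e / 2"] e by simp
  then show "eventually (\<lambda>i. dist (hausdorff_dist (Q i) K) 0 < e) sequentially"
  proof eventually_elim
    case (elim i)
    let ?d = "\<lambda>u. \<bar>support_fun (Q i) u - support_fun K u\<bar>"
    have le: "?d u \<le> e / 2" if "u \<in> unit_sphere" for u
      using elim that by (simp add: dist_real_def less_imp_le)
    then have "hausdorff_dist (Q i) K \<le> e / 2"
      unfolding hausdorff_dist_def using e0 by (intro cSUP_least) auto
    moreover have "?d e0 \<le> hausdorff_dist (Q i) K"
      unfolding hausdorff_dist_def using e0 le by (intro cSUP_upper bdd_aboveI2[of _ _ "e/2"]) auto
    then have "0 \<le> hausdorff_dist (Q i) K" by linarith
    ultimately show ?case using e by (simp add: dist_real_def)
  qed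
qed

text \<open>\<open>M\<close> is a competitor for every \<open>\<mu>s i\<close>, and its norms
  converge along with those of the minimizers; so a limit body \<open>K\<close> has norm at most
  that of \<open>M\<close>, hence the same norm. This value does not depend on the subsequence
  although \<open>K\<close> may, and under convexity \<open>K\<close> and \<open>M\<close> have the
  same support function.\<close>

proposition B_tilde_stability:
  fixes \<mu>s :: "nat \<Rightarrow> 'a::euclidean_space measure" and \<mu> :: "'a measure"
    and G :: "real \<Rightarrow> 'a \<Rightarrow> real" and \<phi> :: "real \<Rightarrow> real"
  assumes dim: "DIM('a) \<ge> 2"
    and \<mu>s: "\<And>i. finite_borel_on_sphere (\<mu>s i)" "\<And>i. not_concentrated_on_closed_hemisphere (\<mu>s i)"
    and \<mu>: "finite_borel_on_sphere \<mu>" "not_concentrated_on_closed_hemisphere \<mu>"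
    and w: "weakly_converges_on_sphere \<mu>s \<mu>"
    and G: "G \<in> class_G_I"
    and growth: "c > 0" "\<And>t u. t \<ge> 1 \<Longrightarrow> u \<in> unit_sphere \<Longrightarrow> c * t ^ (DIM('a) - 1) \<le> G t u"
    and \<phi>: "\<phi> \<in> class_I"
    and Ms: "\<And>i. solves_min_problem (\<mu>s i) \<phi> (B_tilde G) (Ms i)"
    and M: "solves_min_problem \<mu> \<phi> (B_tilde G) M"
  shows "(\<lambda>i. orlicz_norm (\<mu>s i) \<phi> (support_fun (Ms i))) \<longlonglongrightarrow> orlicz_norm \<mu> \<phi> (support_fun M)" (is ?A)
    and "convex_on {0<..} \<phi> \<Longrightarrow> (\<And>u. u \<in> unit_sphere \<Longrightarrow> convex_on {0<..} (\<lambda>t. G t u)) \<Longrightarrow>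
      (\<lambda>i. hausdorff_dist (Ms i) M) \<longlonglongrightarrow> 0"
proof -
  note pos = measure_pos_of_not_concentrated
  note mass = pos[OF \<mu>s(1,2)] pos[OF \<mu>]
  note Msol = solves_min_problemD[OF \<mu>(1) mass(2) \<phi> M]
  note Mssol = solves_min_problemD[OF \<mu>s(1) mass(1) \<phi> Ms]
  have MK: "M \<in> convex_bodies_o" and MsK: "\<And>i. Ms i \<in> convex_bodies_o"
    using Msol(1) Mssol(1) by (auto simp: B_tilde_iff)
  have ball: "cball 0 1 \<in> B_tilde G"
  proof -
    have "(\<integral>u. G (1 / support_fun (cball 0 1) u) u \<partial>\<sigma>) = (\<integral>u. G 1 u \<partial>\<sigma>)"
      by (rule integral_cong_sphere[OF finite_borel_on_sphere_spherical_measure]) (simp only: support_fun_cball div_by_1)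
    then show ?thesis by (simp add: B_tilde_iff cball_in_convex_bodies_o)
  qed
  have norm_le_1: "orlicz_norm (\<mu>s i) \<phi> (support_fun (Ms i)) \<le> 1" for i
    using Mssol(2)[OF ball, of i] orlicz_norm_cball_le[OF \<mu>s(1) mass(1) \<phi>, of i] by linarith
  \<comment> \<open>A norm of at most 1 makes \<open>r = 1\<close> admissible, which is the integral
    bound in \<open>bodies_uniformly_bounded\<close>.\<close>
  have mean_le: "(\<integral>u. \<phi> (support_fun (Ms i) u) \<partial>\<mu>s i) \<le> measure (\<mu>s i) unit_sphere" for i
    using orlicz_norm_le_iff[OF \<mu>s(1)[of i] mass(1)[of i] \<phi> MsK[of i], of 1] norm_le_1[of i] by simp
  obtain R where R: "R > 0" "\<And>i. Ms i \<subseteq> cball 0 R"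
    using bodies_uniformly_bounded[OF w \<mu>s(1) \<mu> \<phi> MsK mean_le] by blast
  have sub: "\<exists>k K. strict_mono k \<and> K \<in> B_tilde G \<and>
      orlicz_norm \<mu> \<phi> (support_fun K) = orlicz_norm \<mu> \<phi> (support_fun M) \<and>
      (\<lambda>n. orlicz_norm (\<mu>s (r (k n))) \<phi> (support_fun (Ms (r (k n))))) \<longlonglongrightarrow> orlicz_norm \<mu> \<phi> (support_fun M) \<and>
      uniform_limit unit_sphere (\<lambda>n. support_fun (Ms (r (k n)))) (support_fun K) sequentially"
    if r: "strict_mono r" for r :: "nat \<Rightarrow> nat"
  proof -
    obtain k K where k: "strict_mono (k :: nat \<Rightarrow> nat)" and K: "K \<in> B_tilde G"
      and unif: "uniform_limit unit_sphere (\<lambda>n. support_fun (Ms (r (k n)))) (support_fun K) sequentially"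
      using limit_in_B_tilde[OF dim G growth, of "\<lambda>i. Ms (r i)" R] Mssol(1) R by blast
    have KK: "K \<in> convex_bodies_o" using K by (simp add: B_tilde_iff)
    have "strict_mono (\<lambda>n. r (k n))" using r k by (simp add: strict_mono_def)
    then have w': "weakly_converges_on_sphere (\<lambda>n. \<mu>s (r (k n))) \<mu>"
      by (intro weakly_converges_filterlim[OF w] filterlim_subseq)
    have lim: "(\<lambda>n. orlicz_norm (\<mu>s (r (k n))) \<phi> (support_fun (Ms (r (k n))))) \<longlonglongrightarrow> orlicz_norm \<mu> \<phi> (support_fun K)"
      by (rule tendsto_orlicz_norm[OF w' \<mu>s(1) \<mu>(1) mass \<phi> MsK KK unif])
    moreover have "(\<lambda>n. orlicz_norm (\<mu>s (r (k n))) \<phi> (support_fun M)) \<longlonglongrightarrow> orlicz_norm \<mu> \<phi> (support_fun M)"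
      by (rule tendsto_orlicz_norm[OF w' \<mu>s(1) \<mu>(1) mass \<phi> MK MK uniform_limit_const])
    ultimately have "orlicz_norm \<mu> \<phi> (support_fun K) \<le> orlicz_norm \<mu> \<phi> (support_fun M)"
      by (rule LIMSEQ_le) (use Mssol(2)[OF Msol(1)] in auto)
    with Msol(2)[OF K] have eq: "orlicz_norm \<mu> \<phi> (support_fun K) = orlicz_norm \<mu> \<phi> (support_fun M)" by simp
    show ?thesis using k K eq lim unif by auto
  qed
  show ?A by (rule tendsto_if_subseq) (use sub in blast)
  assume cvx: "convex_on {0<..} \<phi>" "\<And>u. u \<in> unit_sphere \<Longrightarrow> convex_on {0<..} (\<lambda>t. G t u)"
  show "(\<lambda>i. hausdorff_dist (Ms i) M) \<longlonglongrightarrow> 0"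
  proof (rule tendsto_if_subseq)
    fix r :: "nat \<Rightarrow> nat" assume "strict_mono r"
    then obtain k K where k: "strict_mono k" and K: "K \<in> B_tilde G"
      "orlicz_norm \<mu> \<phi> (support_fun K) = orlicz_norm \<mu> \<phi> (support_fun M)"
      and unif: "uniform_limit unit_sphere (\<lambda>n. support_fun (Ms (r (k n)))) (support_fun K) sequentially"
      using sub by blast
    have "support_fun K u = support_fun M u" if "u \<in> unit_sphere" for u
      by (rule minimizers_support_fun_eq[OF \<mu>(1) mass(2) \<phi> dim G cvx K Msol(1) refl Msol(2) that])
    then have "uniform_limit unit_sphere (\<lambda>n. support_fun (Ms (r (k n)))) (support_fun M) sequentially"
      using unif unfolding uniform_limit_iff by simp
    then show "\<exists>k. strict_mono k \<and> (\<lambda>n. hausdorff_dist (Ms (r (k n))) M) \<longlonglongrightarrow> 0"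
      using k hausdorff_dist_tendsto[of "\<lambda>n. Ms (r (k n))" M] MsK MK by blast
  qed
qed

text \<open>\<open>t / \<eta>\<close> may be below 1, where the growth bound is silent. It is still
  at least \<open>1 / \<eta>\<close>, and there the positive minimum of
  \<open>G (1 / \<eta>)\<close> over the sphere takes over.\<close>

lemma growth_rescale:
  fixes G :: "real \<Rightarrow> 'a::euclidean_space \<Rightarrow> real"
  assumes G: "G \<in> class_G_I" and \<eta>: "\<eta> > 0"
    and growth: "c > 0" "\<And>t u. t \<ge> 1 \<Longrightarrow> u \<in> unit_sphere \<Longrightarrow> c * t ^ p \<le> G t u"
  obtains c' where "c' > 0" "\<And>t u. t \<ge> 1 \<Longrightarrow> u \<in> unit_sphere \<Longrightarrow> c' * t ^ p \<le> G (t / \<eta>) u"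
proof -
  obtain m where m: "m > 0" "\<And>u. u \<in> unit_sphere \<Longrightarrow> m \<le> G (1 / \<eta>) u"
    using positive_on_sphere_lower_bound[OF continuous_on_class_G_I[OF G, of "\<lambda>_. 1 / \<eta>"]] class_G_I_D(2)[OF G] \<eta>
    by (metis continuous_on_const zero_less_divide_1_iff)
  show ?thesis
  proof (rule that[of "min c m / \<eta> ^ p"])
    show "min c m / \<eta> ^ p > 0" using growth(1) m(1) \<eta> by simp
    fix t :: real and u :: 'a assume t: "t \<ge> 1" and u: "u \<in> unit_sphere"
    have "min c m / \<eta> ^ p * t ^ p = min c m * (t / \<eta>) ^ p" by (simp add: power_divide)
    also have "\<dots> \<le> G (t / \<eta>) u"
    proof (cases "t / \<eta> \<ge> 1")
      case True
      have "min c m * (t / \<eta>) ^ p \<le> c * (t / \<eta>) ^ p" using t \<eta> by (intro mult_right_mono) auto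
      then show ?thesis using growth(2)[OF True u] by simp
    next
      case False
      have "min c m * (t / \<eta>) ^ p \<le> m * 1"
        using False t \<eta> m(1) growth(1) by (intro mult_mono power_le_one) auto
      also have "\<dots> \<le> G (1 / \<eta>) u" using m(2)[OF u] by simp
      also have "\<dots> \<le> G (t / \<eta>) u" using t \<eta> u by (intro class_G_I_D(4)[OF G]) (auto simp: divide_right_mono)
      finally show ?thesis .
    qed
    finally show "min c m / \<eta> ^ p * t ^ p \<le> G (t / \<eta>) u" .
  qed
qed

text \<open>For \<open>t \<ge> 1\<close> powers increase with the exponent, so \<open>q\<close> may
  be lowered to the integer \<open>DIM('a) - 1\<close> that matches the bound on caps.\<close>

lemma growth_of_Inf:
  fixes G :: "real \<Rightarrow> 'a::euclidean_space \<Rightarrow> real"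
  assumes G: "G \<in> class_G_I" and q: "q \<ge> real DIM('a) - 1"
    and Inf: "Inf {G t u / t powr q | t u. t \<ge> 1 \<and> u \<in> sphere 0 1} > 0"
  obtains c where "c > 0" "\<And>t u. t \<ge> 1 \<Longrightarrow> u \<in> unit_sphere \<Longrightarrow> c * t ^ (DIM('a) - 1) \<le> G t u"
proof -
  let ?X = "{G t u / t powr q | t u. t \<ge> 1 \<and> u \<in> sphere 0 1}"
  have bdd: "bdd_below ?X"
    by (rule bdd_belowI[of _ 0]) (use class_G_I_D(2)[OF G] in \<open>force simp: less_imp_le\<close>)
  show ?thesis
  proof (rule that[OF Inf])
    fix t :: real and u :: 'a assume t: "t \<ge> 1" and u: "u \<in> unit_sphere"
    have "Inf ?X \<le> G t u / t powr q" using t u by (intro cInf_lower bdd) blast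
    then have "Inf ?X * t powr q \<le> G t u" using t by (simp add: field_simps)
    moreover have "t ^ (DIM('a) - 1) \<le> t powr q"
    proof -
      have "t ^ (DIM('a) - 1) = t powr (real DIM('a) - 1)"
        using t by (simp add: powr_realpow[symmetric] of_nat_diff Suc_leI)
      also have "\<dots> \<le> t powr q" using t q by (intro powr_mono)
      finally show ?thesis .
    qed
    then have "Inf ?X * t ^ (DIM('a) - 1) \<le> Inf ?X * t powr q"
      using Inf by (intro mult_left_mono) auto
    ultimately show "Inf ?X * t ^ (DIM('a) - 1) \<le> G t u" by linarith
  qed
qed

lemma convex_on_rescale:
  fixes f :: "real \<Rightarrow> real"
  assumes "convex_on {0<..} f" "\<eta> > 0"
  shows "convex_on {0<..} (\<lambda>t. f (t / \<eta>))"
proof (rule convex_onI)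
  fix t x y :: real assume *: "0 < t" "t < 1" "x \<in> {0<..}" "y \<in> {0<..}"
  have "((1 - t) *\<^sub>R x + t *\<^sub>R y) / \<eta> = (1 - t) *\<^sub>R (x / \<eta>) + t *\<^sub>R (y / \<eta>)"
    by (simp add: add_divide_distrib)
  then show "f (((1 - t) *\<^sub>R x + t *\<^sub>R y) / \<eta>) \<le> (1 - t) * f (x / \<eta>) + t * f (y / \<eta>)"
    using convex_onD[OF assms(1), of t "x / \<eta>" "y / \<eta>"] * assms(2) by simp
qed (simp add: convex_real_interval)

theorem theorem5p5:
  fixes \<mu>s :: "nat \<Rightarrow> 'a::euclidean_space measure" and \<mu> :: "'a measure"
    and G :: "real \<Rightarrow> 'a \<Rightarrow> real" and \<phi> :: "real \<Rightarrow> real"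
  assumes "DIM('a) \<ge> 2"
    and "\<And>i. finite_borel_on_sphere (\<mu>s i)"
    and "\<And>i. not_concentrated_on_closed_hemisphere (\<mu>s i)"
    and "finite_borel_on_sphere \<mu>"
    and "not_concentrated_on_closed_hemisphere \<mu>"
    and "weakly_converges_on_sphere \<mu>s \<mu>"
    and "G \<in> class_G_I"
    and "\<exists>q::real. q \<ge> real DIM('a) - 1 \<and>
           Inf {G t u / t powr q | t u. t \<ge> 1 \<and> u \<in> sphere 0 1} > 0"
    and "\<phi> \<in> class_I"
  shows "(\<forall>Ms M.
           (\<forall>i. solves_min_problem (\<mu>s i) \<phi> (B_tilde G) (Ms i)) \<and>
           solves_min_problem \<mu> \<phi> (B_tilde G) M \<longrightarrow>
             (\<lambda>i. orlicz_norm (\<mu>s i) \<phi> (support_fun (Ms i)))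
               \<longlonglongrightarrow> orlicz_norm \<mu> \<phi> (support_fun M) \<and>
             (convex_on {0<..} \<phi> \<and> (\<forall>u\<in>sphere 0 1. convex_on {0<..} (\<lambda>t. G t u)) \<longrightarrow>
               (\<lambda>i. hausdorff_dist (Ms i) M) \<longlonglongrightarrow> 0)) \<and>
         (\<forall>Ms M.
           (\<forall>i. solves_min_problem (\<mu>s i) \<phi> (B_hat G) (Ms i)) \<and>
           solves_min_problem \<mu> \<phi> (B_hat G) M \<longrightarrow>
             (\<lambda>i. orlicz_norm (\<mu>s i) \<phi> (support_fun (Ms i)))
               \<longlonglongrightarrow> orlicz_norm \<mu> \<phi> (support_fun M) \<and>
             (convex_on {0<..} \<phi> \<and> (\<forall>u\<in>sphere 0 1. convex_on {0<..} (\<lambda>t. G t u)) \<longrightarrow>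
               (\<lambda>i. hausdorff_dist (Ms i) M) \<longlonglongrightarrow> 0))"
proof -
  obtain q where q: "q \<ge> real DIM('a) - 1"
    "Inf {G t u / t powr q | t u. t \<ge> 1 \<and> u \<in> sphere 0 1} > 0"
    using assms(8) by blast
  obtain c where c: "c > 0" "\<And>t u. t \<ge> 1 \<Longrightarrow> u \<in> unit_sphere \<Longrightarrow> c * t ^ (DIM('a) - 1) \<le> G t u"
    using growth_of_Inf[OF assms(7) q] by blast
  obtain \<eta> where \<eta>: "\<eta> > 0" and hat: "B_hat G = B_tilde (\<lambda>t u. G (t / \<eta>) u)"
    using B_hat_eq_B_tilde[OF assms(1,7)] by blast
  obtain c' where c': "c' > 0"
    "\<And>t u. t \<ge> 1 \<Longrightarrow> u \<in> unit_sphere \<Longrightarrow> c' * t ^ (DIM('a) - 1) \<le> G (t / \<eta>) u"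
    using growth_rescale[OF assms(7) \<eta> c] by blast
  note tilde = B_tilde_stability[OF assms(1-7) c assms(9)]
  \<comment> \<open>The homogeneous case is the same statement for \<open>G\<close> rescaled by the
    fixed \<open>\<eta>\<close>: growth holds with the constant \<open>c'\<close>, and convexity
    carries over by \<open>convex_on_rescale\<close>.\<close>
  note hat_stab = B_tilde_stability[OF assms(1-6) class_G_I_rescale[OF assms(7) \<eta>] c' assms(9)]
  show ?thesis
    unfolding hat
  proof (intro conjI allI impI; elim conjE)
    fix Ms M
    assume sol: "\<forall>i. solves_min_problem (\<mu>s i) \<phi> (B_tilde G) (Ms i)"
      "solves_min_problem \<mu> \<phi> (B_tilde G) M"
    show "(\<lambda>i. orlicz_norm (\<mu>s i) \<phi> (support_fun (Ms i))) \<longlonglongrightarrow> orlicz_norm \<mu> \<phi> (support_fun M)"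
      using sol by (intro tilde(1)) auto
    assume "convex_on {0<..} \<phi>" "\<forall>u\<in>unit_sphere. convex_on {0<..} (\<lambda>t. G t u)"
    then show "(\<lambda>i. hausdorff_dist (Ms i) M) \<longlonglongrightarrow> 0"
      using sol by (intro tilde(2)) auto
  next
    fix Ms M
    assume sol: "\<forall>i. solves_min_problem (\<mu>s i) \<phi> (B_tilde (\<lambda>t u. G (t / \<eta>) u)) (Ms i)"
      "solves_min_problem \<mu> \<phi> (B_tilde (\<lambda>t u. G (t / \<eta>) u)) M"
    show "(\<lambda>i. orlicz_norm (\<mu>s i) \<phi> (support_fun (Ms i))) \<longlonglongrightarrow> orlicz_norm \<mu> \<phi> (support_fun M)"
      using sol by (intro hat_stab(1)) auto
    assume "convex_on {0<..} \<phi>" "\<forall>u\<in>unit_sphere. convex_on {0<..} (\<lambda>t. G t u)"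
    then show "(\<lambda>i. hausdorff_dist (Ms i) M) \<longlonglongrightarrow> 0"
      using sol by (intro hat_stab(2) convex_on_rescale \<eta>) auto
  qed
qed

end
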